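(* For every formula $\varphi\in\mathrm{FO}^2(+1,\prec_{suc})$ over ordered-data words over a finite alphabet $\Sigma$, one can effectively construct a weak ODTA $\mathcal{S}$ such that: (i) for every text $w$, if $w$ satisfies $\varphi$ then $w$ is accepted by $\mathcal{S}$; and (ii) for every ordered-data word $w$ accepted by $\mathcal{S}$ there exists a text $w'$ satisfying $\varphi$ with $\mathrm{Proj}(w)=\mathrm{Proj}(w')$. The construction of $\mathcal{S}$ takes double exponential time in the size of $\varphi$.
   Context: An ordered-data word $w=\binom{a_1}{d_1}\cdots\binom{a_n}{d_n}$ over $\Sigma$ has positions $1,\dots,n$ with labels $a_i\in\Sigma$ and data values $d_i\in\mathbb{N}$; it is regarded as an ordered-data tree in which every node has at most one child. $\mathrm{Proj}(w)=a_1\cdots a_n$. It is a text if all data values are distinct and $\{d_1,\dots,d_n\}=\{1,\dots,n\}$. $\mathrm{FO}^2(+1,\prec_{suc})$ is two-variable first-order logic with label predicates, the successor relation $+1$ on positions, and $x\prec_{suc}y$ meaning $d_y$ is the least data value occurring in $w$ greater than $d_x$. For an ordered-data tree $t$ over $\Gamma$, $V_t(a)$ is the set of data values of $a$-nodes, $[S]_t=\bigcap_{a\in S}V_t(a)\cap\bigcap_{b\notin S}\overline{V_t(b)}$, and if $d_1<\dots<d_m$ are all data values of $t$, $\mathcal{V}_\Gamma(t)=S_1\cdots S_m$ over $2^\Gamma\setminus\{\emptyset\}$ with $d_i\in[S_i]_t$. A letter-to-letter tree transducer from $\Sigma$ to $\Gamma$ is an unranked tree automaton with an output relation $\mu\subseteq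 Q\times\Sigma\times\Gamma$; $t'$ is an output on $t$ if there is an accepting run $\rho$ on $t$ with $(\rho(u),\mathrm{lab}_t(u),\mathrm{lab}_{t'}(u))\in\mu$ at every node. A weak ODTA over $\Sigma$ is $\langle\mathcal{T},\mathcal{M},\Gamma_0\rangle$ with $\mathcal{T}$ such a transducer from $\Sigma$ to $\Gamma$, $\mathcal{M}$ a finite string automaton over $2^\Gamma$, $\Gamma_0\subseteq\Gamma$; it accepts $t$ iff there is an output $t'$ of $\mathcal{T}$ on $\mathrm{Proj}(t)$ (carrying $t$'s data values) with $\mathcal{M}$ accepting $\mathcal{V}_\Gamma(t')$ and, for each $a\in\Gamma_0$, the $a$-nodes of $t'$ having pairwise distinct data values. *)

theory Defs
  imports Main
begin

section \<open>Ordered-data words and ordered-data trees\<close>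

text \<open>
  Every finite alphabet is an initial segment \<open>{..<k}\<close> of the natural numbers, so that letters can
  be written down in the input and output of an algorithm.  Words are nonempty, because they are
  regarded as trees.
\<close>

type_synonym data_word = "(nat \<times> nat) list"

definition ordered_data_word :: "nat \<Rightarrow> data_word \<Rightarrow> bool" where
  "ordered_data_word k w \<longleftrightarrow> w \<noteq> [] \<and> fst ` set w \<subseteq> {..<k}"

definition proj_word :: "data_word \<Rightarrow> nat list" where
  "proj_word w = map fst w"

definition text_word :: "nat \<Rightarrow> data_word \<Rightarrow> bool" where
  "text_word k w \<longleftrightarrow>
     ordered_data_word k w \<and> distinct (map snd w) \<and> snd ` set w = {1..length w}"

datatype 'l tree = Node (root: 'l) (children: "'l tree list")

type_synonym data_tree = "(nat \<times> nat) tree"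

fun is_node :: "'l tree \<Rightarrow> nat list \<Rightarrow> bool" where
  "is_node t [] \<longleftrightarrow> True"
| "is_node t (i # u) \<longleftrightarrow> i < length (children t) \<and> is_node (children t ! i) u"

definition nodes :: "'l tree \<Rightarrow> nat list set" where
  "nodes t = {u. is_node t u}"

fun subtree :: "'l tree \<Rightarrow> nat list \<Rightarrow> 'l tree" where
  "subtree t [] = t"
| "subtree t (i # u) = subtree (children t ! i) u"

definition lab :: "'l tree \<Rightarrow> nat list \<Rightarrow> 'l" where
  "lab t u = root (subtree t u)"

definition arity :: "'l tree \<Rightarrow> nat list \<Rightarrow> nat" where
  "arity t u = length (children (subtree t u))"

definition proj_tree :: "data_tree \<Rightarrow> nat tree" where
  "proj_tree t = map_tree fst t"

text \<open>The first position is the root; the empty word has no tree.\<close>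

fun word_tree :: "'l list \<Rightarrow> 'l tree" where
  "word_tree [p] = Node p []"
| "word_tree (p # q # w) = Node p [word_tree (q # w)]"


section \<open>Two-variable logic\<close>

datatype var = VX | VY

datatype fo2 =
    Lab nat var
  | Eq var var
  | Succ var var
  | DSucc var var
  | Neg fo2
  | And fo2 fo2
  | Or fo2 fo2
  | Exi var fo2
  | All var fo2

primrec fv :: "fo2 \<Rightarrow> var set" where
  "fv (Lab a x) = {x}"
| "fv (Eq x y) = {x, y}"
| "fv (Succ x y) = {x, y}"
| "fv (DSucc x y) = {x, y}"
| "fv (Neg \<phi>) = fv \<phi>"
| "fv (And \<phi> \<psi>) = fv \<phi> \<union> fv \<psi>"
| "fv (Or \<phi> \<psi>) = fv \<phi> \<union> fv \<psi>"
| "fv (Exi x \<phi>) = fv \<phi> - {x}"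
| "fv (All x \<phi>) = fv \<phi> - {x}"

primrec letters :: "fo2 \<Rightarrow> nat set" where
  "letters (Lab a x) = {a}"
| "letters (Eq x y) = {}"
| "letters (Succ x y) = {}"
| "letters (DSucc x y) = {}"
| "letters (Neg \<phi>) = letters \<phi>"
| "letters (And \<phi> \<psi>) = letters \<phi> \<union> letters \<psi>"
| "letters (Or \<phi> \<psi>) = letters \<phi> \<union> letters \<psi>"
| "letters (Exi x \<phi>) = letters \<phi>"
| "letters (All x \<phi>) = letters \<phi>"

definition fo2_sentence :: "nat \<Rightarrow> fo2 \<Rightarrow> bool" where
  "fo2_sentence k \<phi> \<longleftrightarrow> fv \<phi> = {} \<and> letters \<phi> \<subseteq> {..<k}"

text \<open>Number of symbols, each variable and each letter being one symbol.\<close>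

primrec fo2_size :: "fo2 \<Rightarrow> nat" where
  "fo2_size (Lab a x) = 2"
| "fo2_size (Eq x y) = 3"
| "fo2_size (Succ x y) = 3"
| "fo2_size (DSucc x y) = 3"
| "fo2_size (Neg \<phi>) = 1 + fo2_size \<phi>"
| "fo2_size (And \<phi> \<psi>) = 1 + fo2_size \<phi> + fo2_size \<psi>"
| "fo2_size (Or \<phi> \<psi>) = 1 + fo2_size \<phi> + fo2_size \<psi>"
| "fo2_size (Exi x \<phi>) = 2 + fo2_size \<phi>"
| "fo2_size (All x \<phi>) = 2 + fo2_size \<phi>"

definition data_succ :: "data_word \<Rightarrow> nat \<Rightarrow> nat \<Rightarrow> bool" where
  "data_succ w d e \<longleftrightarrow> d < e \<and> (\<forall>d' \<in> snd ` set w. d < d' \<longrightarrow> e \<le> d')"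

text \<open>Positions are numbered from 0; only the data values of a text start at 1.\<close>

primrec sat :: "data_word \<Rightarrow> (var \<Rightarrow> nat) \<Rightarrow> fo2 \<Rightarrow> bool" where
  "sat w s (Lab a x) \<longleftrightarrow> fst (w ! s x) = a"
| "sat w s (Eq x y) \<longleftrightarrow> s x = s y"
| "sat w s (Succ x y) \<longleftrightarrow> s y = s x + 1"
| "sat w s (DSucc x y) \<longleftrightarrow> data_succ w (snd (w ! s x)) (snd (w ! s y))"
| "sat w s (Neg \<phi>) \<longleftrightarrow> \<not> sat w s \<phi>"
| "sat w s (And \<phi> \<psi>) \<longleftrightarrow> sat w s \<phi> \<and> sat w s \<psi>"
| "sat w s (Or \<phi> \<psi>) \<longleftrightarrow> sat w s \<phi> \<or> sat w s \<psi>"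
| "sat w s (Exi x \<phi>) \<longleftrightarrow> (\<exists>i < length w. sat w (s(x := i)) \<phi>)"
| "sat w s (All x \<phi>) \<longleftrightarrow> (\<forall>i < length w. sat w (s(x := i)) \<phi>)"

text \<open>The assignment is irrelevant for sentences, the only formulas this is applied to.\<close>

definition models :: "data_word \<Rightarrow> fo2 \<Rightarrow> bool" where
  "models w \<phi> \<longleftrightarrow> sat w (\<lambda>_. 0) \<phi>"


section \<open>String automata, tree transducers and weak ODTA\<close>

text \<open>
  Automata are given by finite tables, since they are the output of an algorithm: lists are read as
  finite sets, and the states are \<open>{..<n}\<close> for the number \<open>n\<close> recorded.
\<close>

record 'l nfa =
  nfa_states :: nat
  nfa_init :: "nat list"
  nfa_trans :: "(nat \<times> 'l \<times> nat) list"
  nfa_final :: "nat list"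

definition wf_nfa :: "'l set \<Rightarrow> 'l nfa \<Rightarrow> bool" where
  "wf_nfa L A \<longleftrightarrow>
     set (nfa_init A) \<subseteq> {..<nfa_states A} \<and>
     set (nfa_trans A) \<subseteq> {..<nfa_states A} \<times> L \<times> {..<nfa_states A} \<and>
     set (nfa_final A) \<subseteq> {..<nfa_states A}"

definition nfa_lang :: "'l nfa \<Rightarrow> 'l list set" where
  "nfa_lang A = {w. \<exists>qs. length qs = Suc (length w) \<and>
     hd qs \<in> set (nfa_init A) \<and>
     (\<forall>i < length w. (qs ! i, w ! i, qs ! Suc i) \<in> set (nfa_trans A)) \<and>
     last qs \<in> set (nfa_final A)}"

text \<open>
  The transition function of an unranked tree automaton maps each pair of a state and a letter to a
  regular language of words of states; it is given by a table of string automata.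
\<close>

record transducer =
  tr_states :: nat
  tr_delta :: "((nat \<times> nat) \<times> nat nfa) list"
  tr_final :: "nat list"
  tr_out :: "(nat \<times> nat \<times> nat) list"

definition wf_transducer :: "nat \<Rightarrow> nat \<Rightarrow> transducer \<Rightarrow> bool" where
  "wf_transducer k g T \<longleftrightarrow>
     (\<forall>((q, a), A) \<in> set (tr_delta T). q < tr_states T \<and> a < k \<and> wf_nfa {..<tr_states T} A) \<and>
     set (tr_final T) \<subseteq> {..<tr_states T} \<and>
     set (tr_out T) \<subseteq> {..<tr_states T} \<times> {..<k} \<times> {..<g}"

definition delta :: "transducer \<Rightarrow> nat \<Rightarrow> nat \<Rightarrow> nat list set" where
  "delta T q a = (\<Union>A \<in> {A. ((q, a), A) \<in> set (tr_delta T)}. nfa_lang A)"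

definition accepting_run :: "transducer \<Rightarrow> nat tree \<Rightarrow> (nat list \<Rightarrow> nat) \<Rightarrow> bool" where
  "accepting_run T t \<rho> \<longleftrightarrow>
     (\<forall>u \<in> nodes t. \<rho> u < tr_states T \<and>
        map (\<lambda>i. \<rho> (u @ [i])) [0..<arity t u] \<in> delta T (\<rho> u) (lab t u)) \<and>
     \<rho> [] \<in> set (tr_final T)"

definition output_on :: "transducer \<Rightarrow> nat tree \<Rightarrow> nat tree \<Rightarrow> bool" where
  "output_on T t t' \<longleftrightarrow> nodes t' = nodes t \<and>
     (\<exists>\<rho>. accepting_run T t \<rho> \<and> (\<forall>u \<in> nodes t. (\<rho> u, lab t u, lab t' u) \<in> set (tr_out T)))"

definition V :: "data_tree \<Rightarrow> nat \<Rightarrow> nat set" where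
  "V t a = {snd (lab t u) | u. u \<in> nodes t \<and> fst (lab t u) = a}"

definition V_class :: "nat set \<Rightarrow> data_tree \<Rightarrow> nat set \<Rightarrow> nat set" where
  "V_class \<Gamma> t S = (\<Inter>a \<in> S. V t a) \<inter> (\<Inter>b \<in> \<Gamma> - S. - V t b)"

definition data_values :: "data_tree \<Rightarrow> nat set" where
  "data_values t = {snd (lab t u) | u. u \<in> nodes t}"

definition V_string :: "nat set \<Rightarrow> data_tree \<Rightarrow> nat set list" where
  "V_string \<Gamma> t =
     map (\<lambda>d. THE S. S \<subseteq> \<Gamma> \<and> d \<in> V_class \<Gamma> t S) (sorted_list_of_set (data_values t))"

lemma V_string_eq:
  "V_string \<Gamma> t = map (\<lambda>d. {a \<in> \<Gamma>. d \<in> V t a}) (sorted_list_of_set (data_values t))"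
proof -
  have "(THE S. S \<subseteq> \<Gamma> \<and> d \<in> V_class \<Gamma> t S) = {a \<in> \<Gamma>. d \<in> V t a}" for d
    by (rule the_equality) (auto simp: V_class_def)
  then show ?thesis by (simp add: V_string_def)
qed

text \<open>The output alphabet \<open>\<Gamma>\<close> is \<open>{..<odta_letters S}\<close>.\<close>

record weak_odta =
  odta_letters :: nat
  odta_trans :: transducer
  odta_aut :: "nat set nfa"
  odta_key :: "nat list"

definition wf_weak_odta :: "nat \<Rightarrow> weak_odta \<Rightarrow> bool" where
  "wf_weak_odta k S \<longleftrightarrow>
     wf_transducer k (odta_letters S) (odta_trans S) \<and>
     wf_nfa (Pow {..<odta_letters S}) (odta_aut S) \<and>
     set (odta_key S) \<subseteq> {..<odta_letters S}"

definition odta_accepts :: "weak_odta \<Rightarrow> data_tree \<Rightarrow> bool" where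
  "odta_accepts S t \<longleftrightarrow> (\<exists>t'.
     output_on (odta_trans S) (proj_tree t) (proj_tree t') \<and>
     (\<forall>u \<in> nodes t. snd (lab t' u) = snd (lab t u)) \<and>
     V_string {..<odta_letters S} t' \<in> nfa_lang (odta_aut S) \<and>
     (\<forall>a \<in> set (odta_key S).
        inj_on (\<lambda>u. snd (lab t' u)) {u \<in> nodes t'. fst (lab t' u) = a}))"


section \<open>Algorithms and their running time\<close>

text \<open>
  Algorithms are programs of a first-order functional language over binary trees, in the style of
  Jones's language F.  A program is a list of function bodies; function 0 is the main function, and
  \<open>EVar i\<close> is the \<open>i\<close>-th argument of the function being executed.

  Every evaluation step is charged one unit plus the size of the value it produces.  Nothing is
  gained by sharing subtrees, the size of the result is a lower bound for the running time, and this
  running time and that of multi-tape Turing machines are polynomially related.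
\<close>

datatype val = Leaf | Pair val val

primrec val_size :: "val \<Rightarrow> nat" where
  "val_size Leaf = 1"
| "val_size (Pair u v) = 1 + val_size u + val_size v"

primrec left :: "val \<Rightarrow> val" where
  "left Leaf = Leaf"
| "left (Pair u v) = u"

primrec right :: "val \<Rightarrow> val" where
  "right Leaf = Leaf"
| "right (Pair u v) = v"

datatype exp =
    EVar nat
  | ELeaf
  | EPair exp exp
  | ELeft exp
  | ERight exp
  | EIf exp exp exp
  | ECall nat "exp list"

type_synonym program = "exp list"

text \<open>
  \<open>eval P vs e v t\<close>: with arguments \<open>vs\<close>, expression \<open>e\<close> evaluates to \<open>v\<close> in time \<open>t\<close>.
  \<open>EIf\<close> tests whether a value is different from \<open>Leaf\<close>.
\<close>

inductive
  eval :: "program \<Rightarrow> val list \<Rightarrow> exp \<Rightarrow> val \<Rightarrow> nat \<Rightarrow> bool" and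
  evals :: "program \<Rightarrow> val list \<Rightarrow> exp list \<Rightarrow> val list \<Rightarrow> nat \<Rightarrow> bool"
  for P :: program
where
  eval_var: "i < length vs \<Longrightarrow> eval P vs (EVar i) (vs ! i) (1 + val_size (vs ! i))"
| eval_leaf: "eval P vs ELeaf Leaf (1 + val_size Leaf)"
| eval_pair: "eval P vs e1 v1 t1 \<Longrightarrow> eval P vs e2 v2 t2 \<Longrightarrow>
    eval P vs (EPair e1 e2) (Pair v1 v2) (t1 + t2 + 1 + val_size (Pair v1 v2))"
| eval_left: "eval P vs e v t \<Longrightarrow> eval P vs (ELeft e) (left v) (t + 1 + val_size (left v))"
| eval_right: "eval P vs e v t \<Longrightarrow> eval P vs (ERight e) (right v) (t + 1 + val_size (right v))"
| eval_if_true: "eval P vs e v t \<Longrightarrow> v \<noteq> Leaf \<Longrightarrow> eval P vs e1 v1 t1 \<Longrightarrow>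
    eval P vs (EIf e e1 e2) v1 (t + t1 + 1 + val_size v1)"
| eval_if_false: "eval P vs e Leaf t \<Longrightarrow> eval P vs e2 v2 t2 \<Longrightarrow>
    eval P vs (EIf e e1 e2) v2 (t + t2 + 1 + val_size v2)"
| eval_call: "evals P vs es us t \<Longrightarrow> f < length P \<Longrightarrow> eval P us (P ! f) v t' \<Longrightarrow>
    eval P vs (ECall f es) v (t + t' + 1 + val_size v)"
| evals_Nil: "evals P vs [] [] 0"
| evals_Cons: "eval P vs e v t \<Longrightarrow> evals P vs es us t' \<Longrightarrow>
    evals P vs (e # es) (v # us) (t + t')"

definition runs :: "program \<Rightarrow> val \<Rightarrow> val \<Rightarrow> nat \<Rightarrow> bool" where
  "runs P inp out t \<longleftrightarrow> P \<noteq> [] \<and> eval P [inp] (P ! 0) out t"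

inductive_cases eval_elims:
  "eval P vs (EVar i) v t" "eval P vs ELeaf v t" "eval P vs (EPair e1 e2) v t"
  "eval P vs (ELeft e) v t" "eval P vs (ERight e) v t" "eval P vs (EIf e e1 e2) v t"
  "eval P vs (ECall f es) v t"
inductive_cases evals_elims: "evals P vs [] us t" "evals P vs (e # es) us t"

lemma eval_deterministic:
  "eval P vs e v t \<Longrightarrow> eval P vs e v' t' \<Longrightarrow> v' = v \<and> t' = t"
  "evals P vs es us t \<Longrightarrow> evals P vs es us' t' \<Longrightarrow> us' = us \<and> t' = t"
proof (induction arbitrary: v' t' and us' t' rule: eval_evals.inducts)
  case (eval_var i vs)
  then show ?case by (auto elim: eval_elims)
next
  case (eval_leaf vs)
  then show ?case by (auto elim: eval_elims)
next
  case (eval_pair vs e1 v1 t1 e2 v2 t2)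
  from eval_pair.prems show ?case by (rule eval_elims) (auto dest!: eval_pair.IH(2,4))
next
  case (eval_left vs e v t)
  from eval_left.prems show ?case by (rule eval_elims) (auto dest!: eval_left.IH(2))
next
  case (eval_right vs e v t)
  from eval_right.prems show ?case by (rule eval_elims) (auto dest!: eval_right.IH(2))
next
  case (eval_if_true vs e v t e1 v1 t1 e2)
  from eval_if_true.prems show ?case
    by (rule eval_elims) (auto simp: eval_if_true.hyps dest!: eval_if_true.IH(2,4))
next
  case (eval_if_false vs e t e2 v2 t2 e1)
  from eval_if_false.prems show ?case by (rule eval_elims) (auto dest!: eval_if_false.IH(2,4))
next
  case (eval_call vs es us t f v t')
  from eval_call.prems show ?case
    by (rule eval_elims) (auto dest!: eval_call.IH(2,5))
next
  case (evals_Nil vs)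
  then show ?case by (auto elim: evals_elims)
next
  case (evals_Cons vs e v t es us t')
  from evals_Cons.prems show ?case by (rule evals_elims) (auto dest!: evals_Cons.IH(2,4))
qed

lemma eval_time_ge_size: "eval P vs e v t \<Longrightarrow> val_size v \<le> t"
  by (erule eval.cases) auto


section \<open>Encodings as binary trees\<close>

text \<open>Numbers are encoded in unary.\<close>

primrec enc_nat :: "nat \<Rightarrow> val" where
  "enc_nat 0 = Leaf"
| "enc_nat (Suc n) = Pair Leaf (enc_nat n)"

primrec enc_list :: "('b \<Rightarrow> val) \<Rightarrow> 'b list \<Rightarrow> val" where
  "enc_list f [] = Leaf"
| "enc_list f (x # xs) = Pair (f x) (enc_list f xs)"

definition enc_prod :: "('b \<Rightarrow> val) \<Rightarrow> ('c \<Rightarrow> val) \<Rightarrow> 'b \<times> 'c \<Rightarrow> val" where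
  "enc_prod f g p = Pair (f (fst p)) (g (snd p))"

definition enc_set :: "nat set \<Rightarrow> val" where
  "enc_set A = enc_list enc_nat (sorted_list_of_set A)"

primrec enc_var :: "var \<Rightarrow> val" where
  "enc_var VX = enc_nat 0"
| "enc_var VY = enc_nat 1"

primrec enc_fo2 :: "fo2 \<Rightarrow> val" where
  "enc_fo2 (Lab a x) = Pair (enc_nat 0) (Pair (enc_nat a) (enc_var x))"
| "enc_fo2 (Eq x y) = Pair (enc_nat 1) (Pair (enc_var x) (enc_var y))"
| "enc_fo2 (Succ x y) = Pair (enc_nat 2) (Pair (enc_var x) (enc_var y))"
| "enc_fo2 (DSucc x y) = Pair (enc_nat 3) (Pair (enc_var x) (enc_var y))"
| "enc_fo2 (Neg \<phi>) = Pair (enc_nat 4) (enc_fo2 \<phi>)"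
| "enc_fo2 (And \<phi> \<psi>) = Pair (enc_nat 5) (Pair (enc_fo2 \<phi>) (enc_fo2 \<psi>))"
| "enc_fo2 (Or \<phi> \<psi>) = Pair (enc_nat 6) (Pair (enc_fo2 \<phi>) (enc_fo2 \<psi>))"
| "enc_fo2 (Exi x \<phi>) = Pair (enc_nat 7) (Pair (enc_var x) (enc_fo2 \<phi>))"
| "enc_fo2 (All x \<phi>) = Pair (enc_nat 8) (Pair (enc_var x) (enc_fo2 \<phi>))"

definition enc_nfa :: "('l \<Rightarrow> val) \<Rightarrow> 'l nfa \<Rightarrow> val" where
  "enc_nfa f A =
     Pair (enc_nat (nfa_states A))
    (Pair (enc_list enc_nat (nfa_init A))
    (Pair (enc_list (enc_prod enc_nat (enc_prod f enc_nat)) (nfa_trans A))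
          (enc_list enc_nat (nfa_final A))))"

definition enc_transducer :: "transducer \<Rightarrow> val" where
  "enc_transducer T =
     Pair (enc_nat (tr_states T))
    (Pair (enc_list (enc_prod (enc_prod enc_nat enc_nat) (enc_nfa enc_nat)) (tr_delta T))
    (Pair (enc_list enc_nat (tr_final T))
          (enc_list (enc_prod enc_nat (enc_prod enc_nat enc_nat)) (tr_out T))))"

definition enc_weak_odta :: "weak_odta \<Rightarrow> val" where
  "enc_weak_odta S =
     Pair (enc_nat (odta_letters S))
    (Pair (enc_transducer (odta_trans S))
    (Pair (enc_nfa enc_set (odta_aut S))
          (enc_list enc_nat (odta_key S))))"

text \<open>The input consists of the alphabet \<open>{..<k}\<close> and the formula.\<close>

definition enc_input :: "nat \<Rightarrow> fo2 \<Rightarrow> val" where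
  "enc_input k \<phi> = Pair (enc_nat k) (enc_fo2 \<phi>)"

end

theory Submission
  imports Defs "HOL-Combinatorics.Transposition"
begin

text \<open>
  A text is a set of positions with two successor relations.  The automaton guesses at every
  position its 1-type (the letter and the quantified subformulas that hold there), the 1-types
  of its up to four neighbours, the number of occurrences of every 1-type up to 6, and whether the
  neighbours in the two orders coincide.  Everything except the coincidences can be
  checked by comparing neighbours, the transducer looking at the word and the string automaton at
  the data.  These guesses determine the truth of the formula, because two positions that are not
  neighbours are related only through their 1-types.

  A guessed coincidence cannot be checked, but it can be enforced by changing the data values: follow
  the guess where there is one and the given data order elsewhere.  The result is a permutation of
  the positions, and its cycles can be merged into one by exchanging the data successors of positions
  with the same letter.  For the latter, the letters of the positions in a maximal block of guessed
  coincidences contain the letter at the end of the block, and for no coincidence to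
  arise by accident, the positions are coloured such that the guessed colour of the data
  successor differs from the colours of the neighbours in the word.
\<close>

section \<open>Programs\<close>

text \<open>The obstacle is that in a text the two orders meet only in the letters: the transducer
  sees the word, the string automaton sees the data, and neither sees whether a data successor is
  also a word neighbour. The bound 6: a position and its at most four neighbours fill at most five
  slots, and a further position with a given core exists iff that core occurs more often in the word
  than in the slots; so it suffices to know which of the numbers 0 to 5 a count exceeds. Five
  colours: each position has to differ from at most four others. The double exponential: a core
  contains a set of subtrees of the formula, and a record of counts is a set of pairs of a threshold
  and a core. These two subset constructions are nested; the rest is polynomial in their result. Why
  letters describe block ends: only unclaimed positions may be exchanged. If no exchange leads out
  of a union of cycles, then equal block ends show that the given data order does not lead out of it
  either, and so the union is everything.\<close>

primrec growth :: "nat \<Rightarrow> nat \<Rightarrow> nat \<Rightarrow> nat" where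
  "growth 0 c s = (s + 2) ^ c"
| "growth (Suc j) c s = 2 ^ growth j c s"

definition dominated :: "nat \<Rightarrow> (nat \<Rightarrow> nat) \<Rightarrow> bool" where
  "dominated j p \<longleftrightarrow> (\<exists>c. \<forall>s. p s \<le> growth j c s)"

section \<open>Closure properties of iterated exponentials\<close>

lemma growth_mono: "c \<le> d \<Longrightarrow> s \<le> r \<Longrightarrow> growth j c s \<le> growth j d r"
proof (induction j)
  case 0
  then have "(s + 2) ^ c \<le> (r + 2) ^ c" by (intro power_mono) auto
  also have "\<dots> \<le> (r + 2) ^ d" using 0 by (intro power_increasing) auto
  finally show ?case by simp
qed simp

lemma growth_pos: "1 \<le> growth j c s"
  by (induction j) auto

lemma growth_ge_const: "K \<le> growth j K s"
proof (induction j)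
  case 0
  have "K \<le> 2 ^ K" by (simp add: less_imp_le)
  also have "\<dots> \<le> (s + 2) ^ K" by (intro power_mono) auto
  finally show ?case by simp
next
  case (Suc j)
  then show ?case by (simp add: order.trans[OF _ less_imp_le[OF less_exp]])
qed

text \<open>Both bounds are proved together because one level up a product of exponentials is the
  exponential of the sum below, and the sum of two exponentials is bounded by the same
  value.\<close>

lemma growth_add_mult:
  "growth j c s + growth j d s \<le> growth j (c + d + 2) s \<and>
   growth j c s * growth j d s \<le> growth j (c + d + 2) s"
proof (induction j arbitrary: c d)
  case 0
  define a b x :: nat where "a = (s + 2) ^ c" and "b = (s + 2) ^ d" and "x = (s + 2) ^ 2"
  have "a \<ge> 1" "b \<ge> 1" "x \<ge> 2"
    by (auto simp: a_def b_def x_def power2_eq_square)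
  then have "a + b \<le> a * b * x" "a * b \<le> a * b * x"
  proof -
    have "a * b + a * b \<le> a * b * x"
      using mult_le_mono2[OF \<open>x \<ge> 2\<close>, of "a * b"] by (simp only: mult_2_right)
    moreover have "a \<le> a * b" "b \<le> a * b" using \<open>a \<ge> 1\<close> \<open>b \<ge> 1\<close> by auto
    ultimately show "a + b \<le> a * b * x" "a * b \<le> a * b * x" by linarith+
  qed
  then show ?case by (simp only: a_def b_def x_def power_add growth.simps conj_absorb simp_thms)
next
  case (Suc j)
  define a b z where "a = growth j c s" and "b = growth j d s" and "z = growth j (c + d + 2) s"
  have z: "a + b \<le> z" using Suc.IH by (simp add: a_def b_def z_def)
  have "a \<ge> 1" "b \<ge> 1" using growth_pos by (auto simp: a_def b_def)
  have "2 * 2 ^ (a - 1) = (2 ^ a :: nat)" "2 * 2 ^ (b - 1) = (2 ^ b :: nat)"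
    using \<open>a \<ge> 1\<close> \<open>b \<ge> 1\<close> by (auto simp flip: power_Suc)
  have "(2 ^ a :: nat) \<le> 2 ^ (a + b - 1)" "(2 ^ b :: nat) \<le> 2 ^ (a + b - 1)"
    using \<open>a \<ge> 1\<close> \<open>b \<ge> 1\<close> by (auto intro!: power_increasing)
  then have "2 ^ a + 2 ^ b \<le> (2 * 2 ^ (a + b - 1) :: nat)" by linarith
  also have "\<dots> = 2 ^ (a + b)" using \<open>a \<ge> 1\<close> by (simp flip: power_Suc)
  also have "\<dots> \<le> 2 ^ z" using z by (intro power_increasing) auto
  finally have 1: "2 ^ a + 2 ^ b \<le> (2 ^ z :: nat)" .
  have "2 ^ a * 2 ^ b \<le> (2 ^ z :: nat)"
    using z by (simp flip: power_add)
  with 1 show ?case by (simp add: a_def b_def z_def)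
qed

lemma dominated_const: "dominated j (\<lambda>_. K)"
  using growth_ge_const by (auto simp: dominated_def)

lemma dominated_growth: "dominated j (growth j c)"
  by (auto simp: dominated_def)

lemma dominated_add: "dominated j p \<Longrightarrow> dominated j q \<Longrightarrow> dominated j (\<lambda>s. p s + q s)"
  unfolding dominated_def by (meson add_mono growth_add_mult order.trans)

lemma dominated_mult: "dominated j p \<Longrightarrow> dominated j q \<Longrightarrow> dominated j (\<lambda>s. p s * q s)"
  unfolding dominated_def by (meson mult_le_mono growth_add_mult order.trans)

lemma dominated_power: "dominated j p \<Longrightarrow> dominated j (\<lambda>s. p s ^ d)"
  by (induction d) (auto intro: dominated_const dominated_mult)

lemma growth_ge_id: "s \<le> growth j 1 s"
  by (induction j) (auto simp: order.trans[OF _ less_imp_le[OF less_exp]])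

lemma dominated_id: "dominated j (\<lambda>s. s)"
  using growth_ge_id by (auto simp: dominated_def)

lemmas dominated_intros = dominated_const dominated_id dominated_growth dominated_add dominated_mult
  dominated_power

text \<open>Heights of exponentials add under composition, which is how two nested subset
  constructions come to cost a double exponential.\<close>

lemma dominated_comp: "dominated j q \<Longrightarrow> dominated (i + j) (\<lambda>s. growth i c (q s))"
proof (induction i)
  case 0
  then have "dominated j (\<lambda>s. (q s + 2) ^ c)" by (intro dominated_intros)
  then show ?case by simp
next
  case (Suc i)
  then obtain d where "\<And>s. growth i c (q s) \<le> growth (i + j) d s" by (auto simp: dominated_def)
  then have "2 ^ growth i c (q s) \<le> (2 ^ growth (i + j) d s :: nat)" for s
    by (intro power_increasing) auto
  then show ?case by (auto simp: dominated_def)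
qed

section \<open>Composition of programs\<close>

lemma eval_append:
  "eval P vs e v t \<Longrightarrow> eval (P @ Q) vs e v t"
  "evals P vs es us t \<Longrightarrow> evals (P @ Q) vs es us t"
proof (induction rule: eval_evals.inducts)
  case (eval_call vs es us t f v t')
  then have "eval (P @ Q) us ((P @ Q) ! f) v t'" by (simp add: nth_append)
  with eval_call show ?case by (intro eval_evals.eval_call) auto
qed (blast intro: eval_evals.intros)+

lemma evals_vars:
  "set is \<subseteq> {..<length vs} \<Longrightarrow>
   evals P vs (map EVar is) (map ((!) vs) is) (\<Sum>i\<leftarrow>is. 1 + val_size (vs ! i))"
proof (induction "is")
  case (Cons i "is")
  then have "evals P vs (EVar i # map EVar is) (vs ! i # map ((!) vs) is)
      ((1 + val_size (vs ! i)) + (\<Sum>i\<leftarrow>is. 1 + val_size (vs ! i)))"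
    by (intro evals_Cons eval_var) auto
  then show ?case by simp
qed (simp add: evals_Nil)

definition esize :: "nat \<Rightarrow> (nat \<Rightarrow> val) \<Rightarrow> nat" where
  "esize n e = (\<Sum>i<n. val_size (e i))"

lemma esize_Suc: "esize (Suc n) e = val_size (e 0) + esize n (\<lambda>i. e (Suc i))"
  unfolding esize_def by (rule sum.lessThan_Suc_shift)

lemma val_size_le_esize: "i < n \<Longrightarrow> val_size (e i) \<le> esize n e"
  unfolding esize_def by (rule member_le_sum) auto

text \<open>
  \<open>computable j n F\<close>: some program computes the \<open>n\<close>-ary function \<open>F\<close> in time
  \<open>j\<close>-fold exponential in a polynomial of the input size.  The program can be appended to
  every given one, and the code does not depend on the latter beyond its length.
\<close>

definition computable :: "nat \<Rightarrow> nat \<Rightarrow> ((nat \<Rightarrow> val) \<Rightarrow> val) \<Rightarrow> bool" where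
  "computable j n F \<longleftrightarrow> (\<exists>c. \<forall>m. \<exists>P x. \<forall>Q. length Q = m \<longrightarrow>
     (\<forall>e. \<exists>t \<le> growth j c (esize n e). eval (Q @ P) (map e [0..<n]) x (F e) t))"

definition computables :: "nat \<Rightarrow> nat \<Rightarrow> ((nat \<Rightarrow> val) \<Rightarrow> val) list \<Rightarrow> bool" where
  "computables j n Fs \<longleftrightarrow> (\<exists>c. \<forall>m. \<exists>P xs. \<forall>Q. length Q = m \<longrightarrow>
     (\<forall>e. \<exists>t \<le> growth j c (esize n e).
        evals (Q @ P) (map e [0..<n]) xs (map (\<lambda>F. F e) Fs) t))"

lemma computableI:
  assumes "dominated j p"
    and "\<And>m. \<exists>P x. \<forall>Q. length Q = m \<longrightarrow>
      (\<forall>e. \<exists>t \<le> p (esize n e). eval (Q @ P) (map e [0..<n]) x (F e) t)"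
  shows "computable j n F"
  using assms unfolding computable_def dominated_def by (meson order.trans)

lemma computablesI:
  assumes "dominated j p"
    and "\<And>m. \<exists>P x. \<forall>Q. length Q = m \<longrightarrow>
      (\<forall>e. \<exists>t \<le> p (esize n e). evals (Q @ P) (map e [0..<n]) x (map (\<lambda>F. F e) Fs) t)"
  shows "computables j n Fs"
  using assms unfolding computables_def dominated_def by (meson order.trans)

text \<open>Every evaluation step pays for the size of its value, so a time bound is also a bound on
  the size of the result.\<close>

lemma computable_size:
  assumes "computable j n F"
  obtains c where "\<And>e. val_size (F e) \<le> growth j c (esize n e)"
proof -
  obtain c where c: "\<forall>m. \<exists>P x. \<forall>Q. length Q = m \<longrightarrow>
     (\<forall>e. \<exists>t \<le> growth j c (esize n e). eval (Q @ P) (map e [0..<n]) x (F e) t)"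
    using assms by (auto simp: computable_def)
  have "val_size (F e) \<le> growth j c (esize n e)" for e
    using c[rule_format, of 0] eval_time_ge_size by (metis list.size(3) order.trans)
  then show ?thesis by (rule that)
qed

lemma computable_var:
  assumes "i < n"
  shows "computable j n (\<lambda>e. e i)"
proof (rule computableI[of _ "\<lambda>s. 1 + s"])
  fix m
  have "\<exists>t \<le> 1 + esize n e. eval Q (map e [0..<n]) (EVar i) (e i) t" for Q e
    using eval_var[of i "map e [0..<n]" Q] val_size_le_esize[OF assms, of e] assms
    by (intro exI[of _ "1 + val_size (e i)"]) auto
  then show "\<exists>P x. \<forall>Q. length Q = m \<longrightarrow>
      (\<forall>e. \<exists>t \<le> 1 + esize n e. eval (Q @ P) (map e [0..<n]) x (e i) t)" by blast
qed (intro dominated_intros)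

lemma computable_Leaf: "computable j n (\<lambda>_. Leaf)"
proof (rule computableI[of _ "\<lambda>s. 2"])
  fix m
  have "\<exists>t \<le> 2. eval Q (map e [0..<n]) ELeaf Leaf t" for Q e
    using eval_leaf[of Q "map e [0..<n]"] by (intro exI[of _ 2]) (auto simp: numeral_2_eq_2)
  then show "\<exists>P x. \<forall>Q. length Q = m \<longrightarrow>
      (\<forall>e. \<exists>t \<le> 2. eval (Q @ P) (map e [0..<n]) x Leaf t)" by blast
qed (intro dominated_intros)

lemma computable_unary:
  assumes F: "computable j n F"
    and C: "\<And>P vs x v t. eval P vs x v t \<Longrightarrow> eval P vs (C x) (f v) (t + 1 + val_size (f v))"
    and f: "\<And>v. val_size (f v) \<le> val_size v"
  shows "computable j n (\<lambda>e. f (F e))"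
proof -
  obtain c where c: "\<And>m. \<exists>P x. \<forall>Q. length Q = m \<longrightarrow>
     (\<forall>e. \<exists>t \<le> growth j c (esize n e). eval (Q @ P) (map e [0..<n]) x (F e) t)"
    using F by (auto simp: computable_def)
  show ?thesis
  proof (rule computableI)
    show "dominated j (\<lambda>s. growth j c s + 1 + growth j c s)" by (intro dominated_intros)
  next
    fix m
    obtain P x where P: "\<And>Q e. length Q = m \<Longrightarrow>
      \<exists>t \<le> growth j c (esize n e). eval (Q @ P) (map e [0..<n]) x (F e) t"
      using c[of m] by blast
    have "\<exists>t \<le> growth j c (esize n e) + 1 + growth j c (esize n e).
        eval (Q @ P) (map e [0..<n]) (C x) (f (F e)) t" if Q: "length Q = m" for Q e
    proof -
      obtain t where t: "t \<le> growth j c (esize n e)" "eval (Q @ P) (map e [0..<n]) x (F e) t"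
        using P[OF Q] by blast
      have "val_size (F e) \<le> t" using t(2) by (rule eval_time_ge_size)
      with f[of "F e"] t show ?thesis by (intro exI[of _ "t + 1 + val_size (f (F e))"] conjI C) auto
    qed
    then show "\<exists>P x. \<forall>Q. length Q = m \<longrightarrow> (\<forall>e. \<exists>t \<le> growth j c (esize n e) + 1 + growth j c (esize n e).
        eval (Q @ P) (map e [0..<n]) x (f (F e)) t)" by blast
  qed
qed

lemma val_size_left: "val_size (left v) \<le> val_size v"
  by (cases v) auto

lemma val_size_right: "val_size (right v) \<le> val_size v"
  by (cases v) auto

lemma computable_left: "computable j n F \<Longrightarrow> computable j n (\<lambda>e. left (F e))"
  by (erule computable_unary[where C = ELeft]) (auto simp del: add_Suc_right intro!: val_size_left dest: eval_left)

lemma computable_right: "computable j n F \<Longrightarrow> computable j n (\<lambda>e. right (F e))"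
  by (erule computable_unary[where C = ERight]) (auto simp del: add_Suc_right intro!: val_size_right dest: eval_right)

lemma computables_Nil: "computables j n []"
  by (rule computablesI[of _ "\<lambda>_. 0"]) (auto intro!: exI[of _ "[]"] evals_Nil dominated_const)

text \<open>The code of the tail is laid out behind that of the head and hence compiled for the
  offset \<open>m + length P\<close>. Functions are called by index, so the head keeps its meaning
  when more code is appended.\<close>

lemma computables_Cons:
  assumes "computable j n F" "computables j n Fs"
  shows "computables j n (F # Fs)"
proof -
  obtain c where c: "\<And>m. \<exists>P x. \<forall>Q. length Q = m \<longrightarrow>
     (\<forall>e. \<exists>t \<le> growth j c (esize n e). eval (Q @ P) (map e [0..<n]) x (F e) t)"
    using assms(1) by (auto simp: computable_def)
  obtain d where d: "\<And>m. \<exists>P xs. \<forall>Q. length Q = m \<longrightarrow>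
     (\<forall>e. \<exists>t \<le> growth j d (esize n e).
        evals (Q @ P) (map e [0..<n]) xs (map (\<lambda>F. F e) Fs) t)"
    using assms(2) by (auto simp: computables_def)
  show ?thesis
  proof (rule computablesI)
    show "dominated j (\<lambda>s. growth j c s + growth j d s)" by (intro dominated_intros)
  next
    fix m
    obtain P x where P: "\<And>Q e. length Q = m \<Longrightarrow>
      \<exists>t \<le> growth j c (esize n e). eval (Q @ P) (map e [0..<n]) x (F e) t"
      using c[of m] by blast
    obtain P' xs where P': "\<And>Q e. length Q = m + length P \<Longrightarrow>
      \<exists>t \<le> growth j d (esize n e). evals (Q @ P') (map e [0..<n]) xs (map (\<lambda>F. F e) Fs) t"
      using d[of "m + length P"] by blast
    have "\<exists>t \<le> growth j c (esize n e) + growth j d (esize n e).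
        evals (Q @ P @ P') (map e [0..<n]) (x # xs) (map (\<lambda>F. F e) (F # Fs)) t"
      if Q: "length Q = m" for Q e
    proof -
      obtain t where t: "t \<le> growth j c (esize n e)" "eval (Q @ P) (map e [0..<n]) x (F e) t"
        using P[OF Q] by blast
      obtain t' where t': "t' \<le> growth j d (esize n e)"
          "evals ((Q @ P) @ P') (map e [0..<n]) xs (map (\<lambda>F. F e) Fs) t'"
        using P'[of "Q @ P"] Q by auto
      show ?thesis
        using t(1) t'(1) evals_Cons[OF eval_append(1)[OF t(2), of P'] t'(2)]
        by (intro exI[of _ "t + t'"]) auto
    qed
    then show "\<exists>P x. \<forall>Q. length Q = m \<longrightarrow> (\<forall>e. \<exists>t \<le> growth j c (esize n e) + growth j d (esize n e).
        evals (Q @ P) (map e [0..<n]) x (map (\<lambda>F. F e) (F # Fs)) t)" by blast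
  qed
qed

text \<open>\<open>C\<close> builds an expression from argument expressions and \<open>f\<close> is
  its effect on values. The bound \<open>2 * t + 5\<close> fits constructs whose result is at most
  one node larger than the arguments together, since the time \<open>t\<close> already pays for the
  sizes of those.\<close>

lemma computable_via_list:
  assumes Fs: "computables j n Fs"
    and C: "\<And>P vs xs vs' t. evals P vs xs vs' t \<Longrightarrow> length vs' = length Fs \<Longrightarrow>
      \<exists>t' \<le> 2 * t + 5. eval P vs (C xs) (f vs') t'"
  shows "computable j n (\<lambda>e. f (map (\<lambda>F. F e) Fs))"
proof -
  obtain c where c: "\<And>m. \<exists>P xs. \<forall>Q. length Q = m \<longrightarrow>
     (\<forall>e. \<exists>t \<le> growth j c (esize n e).
        evals (Q @ P) (map e [0..<n]) xs (map (\<lambda>F. F e) Fs) t)"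
    using Fs by (auto simp: computables_def)
  show ?thesis
  proof (rule computableI)
    show "dominated j (\<lambda>s. 2 * growth j c s + 5)" by (intro dominated_intros)
  next
    fix m
    obtain P xs where P: "\<And>Q e. length Q = m \<Longrightarrow>
      \<exists>t \<le> growth j c (esize n e). evals (Q @ P) (map e [0..<n]) xs (map (\<lambda>F. F e) Fs) t"
      using c[of m] by blast
    have "\<exists>t \<le> 2 * growth j c (esize n e) + 5.
        eval (Q @ P) (map e [0..<n]) (C xs) (f (map (\<lambda>F. F e) Fs)) t" if Q: "length Q = m" for Q e
    proof -
      obtain t where t: "t \<le> growth j c (esize n e)" "evals (Q @ P) (map e [0..<n]) xs (map (\<lambda>F. F e) Fs) t"
        using P[OF Q] by blast
      obtain t' where "t' \<le> 2 * t + 5" "eval (Q @ P) (map e [0..<n]) (C xs) (f (map (\<lambda>F. F e) Fs)) t'"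
        using C[OF t(2)] by auto
      with t(1) show ?thesis by (intro exI[of _ t']) auto
    qed
    then show "\<exists>P x. \<forall>Q. length Q = m \<longrightarrow> (\<forall>e. \<exists>t \<le> 2 * growth j c (esize n e) + 5.
        eval (Q @ P) (map e [0..<n]) x (f (map (\<lambda>F. F e) Fs)) t)" by blast
  qed
qed

lemma computable_Pair:
  assumes "computable j n F" "computable j n G"
  shows "computable j n (\<lambda>e. Pair (F e) (G e))"
proof -
  have "\<exists>t' \<le> 2 * t + 5. eval P vs (EPair (xs ! 0) (xs ! 1)) (Pair (us ! 0) (us ! 1)) t'"
    if ev: "evals P vs xs us t" "length us = 2" for P vs xs us t
  proof -
    obtain v v' where us: "us = [v, v']" using ev(2) by (auto simp: length_Suc_conv numeral_2_eq_2)
    obtain x x' r r' where x: "xs = [x, x']" "t = r + r'" "eval P vs x v r" "eval P vs x' v' r'"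
      using ev(1) unfolding us by (auto elim!: evals.cases[of _ _ _ "_ # _"] evals.cases[of _ _ _ "[]"])
    have "val_size v \<le> r" "val_size v' \<le> r'" using x eval_time_ge_size by auto
    then show ?thesis
      unfolding us x(1,2) using eval_pair[OF x(3,4)]
      by (intro exI[of _ "r + r' + 1 + val_size (Pair v v')"]) auto
  qed
  from computable_via_list[of j n "[F, G]" "\<lambda>xs. EPair (xs ! 0) (xs ! 1)" "\<lambda>us. Pair (us ! 0) (us ! 1)"]
    this assms computables_Cons computables_Nil show ?thesis by simp
qed

lemma computable_if_Leaf:
  assumes "computable j n F" "computable j n G" "computable j n H"
  shows "computable j n (\<lambda>e. if F e = Leaf then H e else G e)"
proof -
  let ?f = "\<lambda>us. if us ! 0 = Leaf then us ! 2 else us ! 1"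
  have "\<exists>t' \<le> 2 * t + 5. eval P vs (EIf (xs ! 0) (xs ! 1) (xs ! 2)) (?f us) t'"
    if ev: "evals P vs xs us t" "length us = 3" for P vs xs us t
  proof -
    obtain v v' v'' where us: "us = [v, v', v'']"
      using ev(2) by (auto simp: length_Suc_conv numeral_3_eq_3)
    obtain x x' x'' r r' r'' where x: "xs = [x, x', x'']" "t = r + (r' + r'')" "eval P vs x v r"
        "eval P vs x' v' r'" "eval P vs x'' v'' r''"
      using ev(1) unfolding us by (auto elim!: evals.cases[of _ _ _ "_ # _"] evals.cases[of _ _ _ "[]"])
    have s: "val_size v' \<le> r'" "val_size v'' \<le> r''" using x eval_time_ge_size by auto
    show ?thesis
    proof (cases "v = Leaf")
      case True
      then show ?thesis
        unfolding us x(1,2) using s eval_if_false[of P vs x r x'' v'' r'' x'] x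
        by (intro exI[of _ "r + r'' + 1 + val_size v''"]) auto
    next
      case False
      then show ?thesis
        unfolding us x(1,2) using s eval_if_true[of P vs x v r x' v' r' x''] x
        by (intro exI[of _ "r + r' + 1 + val_size v'"]) auto
    qed
  qed
  from computable_via_list[of j n "[F, G, H]" "\<lambda>xs. EIf (xs ! 0) (xs ! 1) (xs ! 2)" ?f]
    this assms computables_Cons computables_Nil show ?thesis by (simp add: numeral_3_eq_3 cong: if_cong)
qed

lemma esize_nth: "esize (length us) ((!) us) = sum_list (map val_size us)"
  by (simp add: esize_def sum_list_sum_nth atLeast0LessThan)

lemma evals_size: "evals P vs es us t \<Longrightarrow> sum_list (map val_size us) \<le> t"
proof (induction es arbitrary: us t)
  case Nil
  then show ?case by (auto elim: evals_elims)
next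
  case (Cons e es)
  from Cons.prems show ?case by (rule evals_elims) (auto dest: Cons.IH eval_time_ge_size intro: add_mono)
qed

text \<open>The body of \<open>H\<close> becomes a function of its own, placed last at index
  \<open>?f\<close> and reached by a call, so that its variables refer to the values of
  \<open>Fs\<close>. These values are no larger than the time spent on them, which gives the height
  \<open>i + j\<close>.\<close>

lemma computable_apply:
  assumes "computable i (length Fs) H" "computables j n Fs"
  shows "computable (i + j) n (\<lambda>e. H ((!) (map (\<lambda>F. F e) Fs)))"
proof -
  obtain c where c: "\<And>m. \<exists>P x. \<forall>Q. length Q = m \<longrightarrow>
     (\<forall>e. \<exists>t \<le> growth i c (esize (length Fs) e). eval (Q @ P) (map e [0..<length Fs]) x (H e) t)"
    using assms(1) by (auto simp: computable_def)
  obtain d where d: "\<And>m. \<exists>P xs. \<forall>Q. length Q = m \<longrightarrow>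
     (\<forall>e. \<exists>t \<le> growth j d (esize n e).
        evals (Q @ P) (map e [0..<n]) xs (map (\<lambda>F. F e) Fs) t)"
    using assms(2) by (auto simp: computables_def)
  let ?p = "\<lambda>s. growth j d s + growth i c (growth j d s) + 1 + growth i c (growth j d s)"
  show ?thesis
  proof (rule computableI)
    have "dominated (i + j) (\<lambda>s. growth i c (growth j d s))" by (intro dominated_comp dominated_growth)
    moreover have "dominated (i + j) (growth j d)"
    proof (induction i)
      case (Suc i)
      have "growth (i + j) r s \<le> growth (Suc i + j) r s" for r s
        by (simp add: less_imp_le)
      with Suc show ?case unfolding dominated_def by (meson order.trans)
    qed (simp add: dominated_growth)
    ultimately show "dominated (i + j) ?p" by (intro dominated_intros)
  next
    fix m
    obtain P xs where P: "\<And>Q e. length Q = m \<Longrightarrow>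
      \<exists>t \<le> growth j d (esize n e). evals (Q @ P) (map e [0..<n]) xs (map (\<lambda>F. F e) Fs) t"
      using d[of m] by blast
    obtain P' x where P': "\<And>Q e. length Q = m + length P \<Longrightarrow>
      \<exists>t \<le> growth i c (esize (length Fs) e). eval (Q @ P') (map e [0..<length Fs]) x (H e) t"
      using c[of "m + length P"] by blast
    let ?f = "m + length P + length P'"
    have "\<exists>t \<le> ?p (esize n e). eval (Q @ P @ P' @ [x]) (map e [0..<n]) (ECall ?f xs)
        (H ((!) (map (\<lambda>F. F e) Fs))) t" if Q: "length Q = m" for Q e
    proof -
      let ?us = "map (\<lambda>F. F e) Fs"
      obtain t where t: "t \<le> growth j d (esize n e)" "evals (Q @ P) (map e [0..<n]) xs ?us t"
        using P[OF Q] by blast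
      obtain t' where t': "t' \<le> growth i c (esize (length Fs) ((!) ?us))"
          "eval ((Q @ P) @ P') (map ((!) ?us) [0..<length Fs]) x (H ((!) ?us)) t'"
        using P'[of "Q @ P"] Q by auto
      have us: "map ((!) ?us) [0..<length Fs] = ?us"
        using map_nth[of ?us] by simp
      have "esize (length Fs) ((!) ?us) \<le> t"
        using esize_nth[of ?us] evals_size[OF t(2)] by simp
      then have "t' \<le> growth i c (growth j d (esize n e))"
        using t t'(1) by (meson growth_mono order.trans le_refl)
      moreover have "val_size (H ((!) ?us)) \<le> t'" using t'(2) by (rule eval_time_ge_size)
      moreover have "eval (Q @ P @ P' @ [x]) (map e [0..<n]) (ECall ?f xs) (H ((!) ?us))
          (t + t' + 1 + val_size (H ((!) ?us)))"
        using eval_append(2)[OF t(2), of "P' @ [x]"] eval_append(1)[OF t'(2), of "[x]"] Q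
        unfolding us by (intro eval_call[of _ _ _ ?us]) (auto simp: nth_append)
      ultimately show ?thesis using t(1)
        by (intro exI[of _ "t + t' + 1 + val_size (H ((!) ?us))"]) auto
    qed
    then show "\<exists>P x. \<forall>Q. length Q = m \<longrightarrow> (\<forall>e. \<exists>t \<le> ?p (esize n e).
        eval (Q @ P) (map e [0..<n]) x (H ((!) (map (\<lambda>F. F e) Fs))) t)" by blast
  qed
qed

section \<open>Structural recursion\<close>

lemma evals_suffix:
  assumes "length us = a" "length ys = n"
  shows "evals P (us @ ys) (map EVar [a..<a + n]) ys (n + sum_list (map val_size ys))"
proof -
  have eq: "map ((!) (us @ ys)) [a..<a + n] = ys"
    using assms by (intro nth_equalityI) (auto simp: nth_append)
  have "(\<Sum>i\<leftarrow>[a..<a + n]. 1 + val_size ((us @ ys) ! i)) =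
      sum_list (map (\<lambda>v. 1 + val_size v) (map ((!) (us @ ys)) [a..<a + n]))"
    by (simp add: comp_def)
  also have "\<dots> = n + sum_list (map val_size ys)"
    unfolding eq using assms by (simp only: sum_list_addf) (simp add: sum_list_triv)
  finally have "(\<Sum>i\<leftarrow>[a..<a + n]. 1 + val_size ((us @ ys) ! i)) = n + sum_list (map val_size ys)" .
  moreover have "set [a..<a + n] \<subseteq> {..<length (us @ ys)}" using assms by auto
  ultimately show ?thesis
    using evals_vars[of "[a..<a + n]" "us @ ys" P] by (simp only: eq)
qed

lemma esize_conv_sum_list: "sum_list (map val_size (map e [0..<n])) = esize n e"
  by (simp add: esize_def sum_list_sum_nth atLeast0LessThan)

lemma map_case_nat: "map (case_nat v e) [0..<Suc n] = v # map e [0..<n]"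
  by (simp only: map_upt_Suc) simp

lemma esize_case_nat: "esize (Suc n) (case_nat v e) = val_size v + esize n e"
  by (simp add: esize_Suc)

text \<open>
  The only recursion scheme used: the second argument follows the descent in the first one, which
  makes equality of values an instance.
\<close>

fun descend :: "(val \<Rightarrow> val) \<Rightarrow> (val \<Rightarrow> val \<Rightarrow> val \<Rightarrow> val \<Rightarrow> val \<Rightarrow> val) \<Rightarrow> val \<Rightarrow> val \<Rightarrow> val" where
  "descend b s Leaf y = b y"
| "descend b s (Pair u v) y = s u v (descend b s u (left y)) (descend b s v (right y)) y"

text \<open>The program gets three more functions: \<open>xb\<close> for the base, \<open>xs\<close>
  for the step and \<open>body\<close> for the recursion. Each node costs at most \<open>K N\<close>
  besides its recursive calls, hence \<open>N * K N\<close> in all. The values of the recursion need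
  a bound of their own: a polynomial step fed with its own results could square the size at every
  level of the tree.\<close>

lemma computable_descend:
  fixes b :: "val \<Rightarrow> (nat \<Rightarrow> val) \<Rightarrow> val"
  assumes base: "computable 0 (Suc n) (\<lambda>e. b (e 0) (\<lambda>i. e (Suc i)))"
    and step: "computable 0 (n + 5) (\<lambda>e. s (e 0) (e 1) (e 2) (e 3) (e 4) (\<lambda>i. e (i + 5)))"
    and size: "dominated j p" "\<And>t y e. val_size (descend (\<lambda>y. b y e) (\<lambda>u v q r y. s u v q r y e) t y)
       \<le> p (val_size t + val_size y + esize n e)"
  shows "computable j (n + 2)
    (\<lambda>e. descend (\<lambda>y. b y (\<lambda>i. e (i + 2))) (\<lambda>u v q r y. s u v q r y (\<lambda>i. e (i + 2))) (e 0) (e 1))"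
proof -
  let ?F = "\<lambda>e. descend (\<lambda>y. b y e) (\<lambda>u v q r y. s u v q r y e)"
  obtain d where d: "\<And>s. p s \<le> growth j d s" using size(1) by (auto simp: dominated_def)
  obtain cb where cb: "\<And>m. \<exists>P x. \<forall>Q. length Q = m \<longrightarrow>
     (\<forall>e. \<exists>t \<le> growth 0 cb (esize (Suc n) e).
        eval (Q @ P) (map e [0..<Suc n]) x (b (e 0) (\<lambda>i. e (Suc i))) t)"
    using base unfolding computable_def by blast
  obtain cs where cs: "\<And>m. \<exists>P x. \<forall>Q. length Q = m \<longrightarrow>
     (\<forall>e. \<exists>t \<le> growth 0 cs (esize (n + 5) e).
        eval (Q @ P) (map e [0..<n + 5]) x (s (e 0) (e 1) (e 2) (e 3) (e 4) (\<lambda>i. e (i + 5))) t)"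
    using step unfolding computable_def by blast
  \<comment> \<open>The first summand pays for passing arguments and results, the others for base
    and step run on arguments of size at most \<open>N\<close> and, for recursive results,
    \<open>growth j d N\<close>.\<close>
  define K where "K N = 40 * (n + N + growth j d N + 2) + (N + 2) ^ cb + (4 * N + 2 * growth j d N + 4) ^ cs" for N
  show ?thesis
  proof (rule computableI)
    show "dominated j (\<lambda>N. N * K N)"
      unfolding K_def by (intro dominated_intros)
  next
    fix m
    obtain Pb xb where Pb: "\<And>Q e. length Q = m \<Longrightarrow> \<exists>t \<le> growth 0 cb (esize (Suc n) e).
        eval (Q @ Pb) (map e [0..<Suc n]) xb (b (e 0) (\<lambda>i. e (Suc i))) t"
      using cb[of m] by blast
    obtain Ps xs where Ps: "\<And>Q e. length Q = m + length Pb \<Longrightarrow> \<exists>t \<le> growth 0 cs (esize (n + 5) e).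
        eval (Q @ Ps) (map e [0..<n + 5]) xs (s (e 0) (e 1) (e 2) (e 3) (e 4) (\<lambda>i. e (i + 5))) t"
      using cs[of "m + length Pb"] by blast
    define fb where "fb = m + length Pb + length Ps"
    define rest where "rest = map EVar [2..<2 + n]"
    define body where "body = EIf (EVar 0)
       (ECall (fb + 1) ([ELeft (EVar 0), ERight (EVar 0),
           ECall (fb + 2) (ELeft (EVar 0) # ELeft (EVar 1) # rest),
           ECall (fb + 2) (ERight (EVar 0) # ERight (EVar 1) # rest), EVar 1] @ rest))
       (ECall fb (EVar 1 # rest))"
    have "\<exists>t \<le> esize (n + 2) e * K (esize (n + 2) e).
        eval (Q @ Pb @ Ps @ [xb, xs, body]) (map e [0..<n + 2]) body
          (?F (\<lambda>i. e (i + 2)) (e 0) (e 1)) t" if Q: "length Q = m" for Q e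
    proof -
      let ?P = "Q @ Pb @ Ps @ [xb, xs, body]"
      define e' where "e' = (\<lambda>i. e (i + 2))"
      define ys where "ys = map e' [0..<n]"
      define N where "N = esize (n + 2) e"
      have len: "length ys = n" by (simp add: ys_def)
      have N: "N = val_size (e 0) + val_size (e 1) + esize n e'"
        by (simp add: N_def esize_Suc e'_def numeral_2_eq_2)
      have vs: "map e [0..<n + 2] = e 0 # e 1 # ys"
        by (simp only: add_2_eq_Suc' map_upt_Suc) (simp add: ys_def e'_def)
      have nths: "?P ! fb = xb" "?P ! (fb + 1) = xs" "?P ! (fb + 2) = body" "fb + 2 < length ?P"
        using Q by (auto simp: fb_def nth_append)
      have rest: "evals ?P (t # y # ys) rest ys (n + esize n e')" for t y
        using evals_suffix[of "[t, y]" 2 ys n ?P] len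
        by (simp add: rest_def ys_def esize_conv_sum_list[unfolded map_map] esize_def sum_list_sum_nth atLeast0LessThan)
      have eb: "\<exists>\<tau> \<le> (val_size y + esize n e' + 2) ^ cb. eval ?P (y # ys) xb (b y e') \<tau>" for y
      proof -
        obtain \<tau> where "\<tau> \<le> growth 0 cb (esize (Suc n) (case_nat y e'))"
            "eval (Q @ Pb) (map (case_nat y e') [0..<Suc n]) xb
              (b (case_nat y e' 0) (\<lambda>i. case_nat y e' (Suc i))) \<tau>"
          using Pb[OF Q, of "case_nat y e'"] by blast
        then show ?thesis
          unfolding map_case_nat esize_case_nat
          by (intro exI[of _ \<tau>]) (auto simp: ys_def dest: eval_append(1)[where Q = "Ps @ [xb, xs, body]"])
      qed
      have es: "\<exists>\<tau> \<le> (val_size u + val_size v + val_size q + val_size r + val_size y + esize n e' + 2) ^ cs.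
         eval ?P (u # v # q # r # y # ys) xs (s u v q r y e') \<tau>" for u v q r y
      proof -
        let ?e = "case_nat u (case_nat v (case_nat q (case_nat r (case_nat y e'))))"
        have 5: "n + 5 = Suc (Suc (Suc (Suc (Suc n))))" by simp
        obtain \<tau> where \<tau>: "\<tau> \<le> growth 0 cs (esize (n + 5) ?e)"
            "eval ((Q @ Pb) @ Ps) (map ?e [0..<n + 5]) xs
              (s (?e 0) (?e 1) (?e 2) (?e 3) (?e 4) (\<lambda>i. ?e (i + 5))) \<tau>"
          using Ps[of "Q @ Pb" ?e] Q by auto
        have "?e 0 = u" "?e 1 = v" "?e 2 = q" "?e 3 = r" "?e 4 = y" "(\<lambda>i. ?e (i + 5)) = e'"
          by (auto simp: numeral_eq_Suc)
        with \<tau> show ?thesis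
          unfolding 5 map_case_nat esize_case_nat
          by (intro exI[of _ \<tau>])
             (auto simp: ys_def algebra_simps dest: eval_append(1)[where Q = "[xb, xs, body]"])
      qed
      have main: "\<exists>\<tau> \<le> val_size t * K N. eval ?P (t # y # ys) body (?F e' t y) \<tau>"
        if "val_size t + val_size y + esize n e' \<le> N" for t y
        using that
      proof (induction t arbitrary: y)
        case Leaf
        obtain \<tau> where \<tau>: "\<tau> \<le> (val_size y + esize n e' + 2) ^ cb" "eval ?P (y # ys) xb (b y e') \<tau>"
          using eb by blast
        let ?r = "val_size (b y e')"
        have r: "?r \<le> \<tau>" using \<tau>(2) by (rule eval_time_ge_size)
        have r': "?r \<le> growth j d N"
          using order.trans[OF order.trans[OF size(2)[where t = Leaf] d] growth_mono[OF le_refl Leaf]] by simp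
        have \<tau>': "\<tau> \<le> (N + 2) ^ cb"
          using \<tau>(1) Leaf by (elim order.trans) (auto intro!: power_mono)
        have "eval ?P (Leaf # y # ys) (EVar 0) Leaf 2"
          using eval_var[of 0 "Leaf # y # ys" ?P] by (simp add: numeral_2_eq_2)
        moreover have "eval ?P (Leaf # y # ys) (ECall fb (EVar 1 # rest)) (b y e')
            ((1 + val_size y) + (n + esize n e') + \<tau> + 1 + ?r)"
          using \<tau>(2) nths eval_var[of 1 "Leaf # y # ys" ?P] rest[of Leaf y]
          by (intro eval_call[where us = "y # ys"] evals_Cons) auto
        ultimately have "eval ?P (Leaf # y # ys) body (b y e')
            (2 + ((1 + val_size y) + (n + esize n e') + \<tau> + 1 + ?r) + 1 + ?r)"
          unfolding body_def by (rule eval_if_false)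
        moreover have "2 + ((1 + val_size y) + (n + esize n e') + \<tau> + 1 + ?r) + 1 + ?r \<le> K N"
          using \<tau>' r' Leaf by (simp add: K_def)
        ultimately show ?case by auto
      next
        case (Pair u v)
        have su: "val_size (left y) \<le> val_size y" "val_size (right y) \<le> val_size y"
          by (auto intro: val_size_left val_size_right)
        define q r z where "q = ?F e' u (left y)" and "r = ?F e' v (right y)" and "z = s u v q r y e'"
        have z: "?F e' (Pair u v) y = z" by (simp add: q_def r_def z_def)
        have bnd: "val_size (?F e' t' y') \<le> growth j d N"
          if "val_size t' + val_size y' + esize n e' \<le> N" for t' y'
          using order.trans[OF order.trans[OF size(2) d] growth_mono[OF le_refl that]] .
        have le: "val_size q \<le> growth j d N" "val_size r \<le> growth j d N" "val_size z \<le> growth j d N"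
          using bnd[of u "left y"] bnd[of v "right y"] bnd[of "Pair u v" y] su Pair.prems
          unfolding z by (auto simp: q_def r_def)
        obtain \<tau>1 where \<tau>1: "\<tau>1 \<le> val_size u * K N" "eval ?P (u # left y # ys) body q \<tau>1"
          using Pair.IH(1)[of "left y"] Pair.prems su unfolding q_def by auto
        obtain \<tau>2 where \<tau>2: "\<tau>2 \<le> val_size v * K N" "eval ?P (v # right y # ys) body r \<tau>2"
          using Pair.IH(2)[of "right y"] Pair.prems su unfolding r_def by auto
        obtain \<tau> where \<tau>: "\<tau> \<le> (val_size u + val_size v + val_size q + val_size r + val_size y + esize n e' + 2) ^ cs"
            "eval ?P (u # v # q # r # y # ys) xs z \<tau>"
          using es unfolding z_def by blast
        have "val_size u + val_size v + val_size q + val_size r + val_size y + esize n e' + 2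
            \<le> 4 * N + 2 * growth j d N + 4"
          using Pair.prems le by simp
        then have \<tau>': "\<tau> \<le> (4 * N + 2 * growth j d N + 4) ^ cs"
          using \<tau>(1) by (meson order.trans power_mono zero_le)
        let ?vs = "Pair u v # y # ys"
        have v0: "eval ?P ?vs (EVar 0) (Pair u v) (1 + val_size (Pair u v))"
          using eval_var[of 0 ?vs ?P] by simp
        have v1: "eval ?P ?vs (EVar 1) y (1 + val_size y)"
          using eval_var[of 1 ?vs ?P] by simp
        note l0 = eval_left[OF v0, simplified left.simps] and r0 = eval_right[OF v0, simplified right.simps]
        note l1 = eval_left[OF v1] and r1 = eval_right[OF v1]
        note restv = rest[of "Pair u v" y]
        note argl = evals_Cons[OF l0 evals_Cons[OF l1 restv]]
        note argr = evals_Cons[OF r0 evals_Cons[OF r1 restv]]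
        have f: "fb + 1 < length ?P" using nths(4) by simp
        note calll = eval_call[OF argl nths(4), unfolded nths, OF \<tau>1(2)]
        note callr = eval_call[OF argr nths(4), unfolded nths, OF \<tau>2(2)]
        note args = evals_Cons[OF l0 evals_Cons[OF r0 evals_Cons[OF calll evals_Cons[OF callr evals_Cons[OF v1 restv]]]]]
        note call = eval_call[OF args f, unfolded nths, OF \<tau>(2)]
        note all = eval_if_true[OF v0 val.distinct(2) call, where ?e2.0 = "ECall fb (EVar 1 # rest)"]
        have "\<exists>\<tau>. \<tau> \<le> \<tau>1 + \<tau>2 + K N \<and> eval ?P ?vs body z \<tau>"
          by (rule exI, rule conjI[OF _ all[folded body_def[unfolded append_Cons append_Nil]]]) (use Pair.prems su le \<tau>' in \<open>simp add: K_def\<close>)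
        then obtain \<tau>3 where "\<tau>3 \<le> \<tau>1 + \<tau>2 + K N" "eval ?P ?vs body z \<tau>3" by blast
        moreover have "\<tau>1 + \<tau>2 + K N \<le> val_size (Pair u v) * K N"
          using \<tau>1(1) \<tau>2(1) by (simp add: algebra_simps)
        ultimately show ?case unfolding z by (meson order.trans)
      qed
      obtain \<tau> where "\<tau> \<le> val_size (e 0) * K N" "eval ?P (e 0 # e 1 # ys) body (?F e' (e 0) (e 1)) \<tau>"
        using main[of "e 0" "e 1"] N by auto
      moreover have "val_size (e 0) * K N \<le> N * K N" using N by simp
      ultimately show ?thesis unfolding vs N_def[symmetric] e'_def[symmetric] by (meson order.trans)
    qed
    then show "\<exists>P x. \<forall>Q. length Q = m \<longrightarrow> (\<forall>e. \<exists>t \<le> esize (n + 2) e * K (esize (n + 2) e).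
        eval (Q @ P) (map e [0..<n + 2]) x (?F (\<lambda>i. e (i + 2)) (e 0) (e 1)) t)"
      by (intro exI[of _ "Pb @ Ps @ [xb, xs, body]"] exI[of _ body]) simp
  qed
qed

text \<open>The program receives only the first \<open>n\<close> arguments, and evaluation is
  deterministic.\<close>

lemma computable_cong:
  assumes "computable j n F" "\<And>i. i < n \<Longrightarrow> e i = e' i"
  shows "F e = F e'"
proof -
  obtain c P x where P: "\<And>e. \<exists>t \<le> growth j c (esize n e). eval ([] @ P) (map e [0..<n]) x (F e) t"
    using assms(1) unfolding computable_def by (metis list.size(3))
  have "map e [0..<n] = map e' [0..<n]" using assms(2) by simp
  with P[of e] P[of e'] show ?thesis by (metis eval_deterministic(1))
qed

lemma computables_vars: "(\<And>i. i \<in> set is \<Longrightarrow> i < n) \<Longrightarrow> computables j n (map (\<lambda>i e. e i) is)"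
  by (induction "is") (auto intro: computables_Nil computables_Cons computable_var)

lemma computable_rename:
  assumes "computable j m F" "\<And>i. i < m \<Longrightarrow> \<sigma> i < n"
  shows "computable j n (\<lambda>e. F (\<lambda>i. e (\<sigma> i)))"
proof -
  let ?Fs = "map (\<lambda>i e. e i) (map \<sigma> [0..<m])"
  have "computable (j + 0) n (\<lambda>e. F ((!) (map (\<lambda>F. F e) ?Fs)))"
    using assms by (intro computable_apply computables_vars) auto
  moreover have "F ((!) (map (\<lambda>F. F e) ?Fs)) = F (\<lambda>i. e (\<sigma> i))" for e
    by (rule computable_cong[OF assms(1)]) simp
  ultimately show ?thesis by simp
qed

lemma computable_comp1:
  assumes "computable i 1 (\<lambda>e. f (e 0))" "computable j n F"
  shows "computable (i + j) n (\<lambda>e. f (F e))"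
  using computable_apply[of i "[F]" _ j n, OF _ computables_Cons[OF assms(2) computables_Nil],
    where H = "\<lambda>e. f (e 0)"] assms(1)
  by simp

lemma computable_comp2:
  assumes "computable i 2 (\<lambda>e. f (e 0) (e 1))" "computable j n F" "computable j n G"
  shows "computable (i + j) n (\<lambda>e. f (F e) (G e))"
  using computable_apply[of i "[F, G]" _ j n, OF _ computables_Cons[OF assms(2)
    computables_Cons[OF assms(3) computables_Nil]], where H = "\<lambda>e. f (e 0) (e 1)"] assms(1)
  by (simp add: numeral_2_eq_2)

text \<open>The tree and its companion are now computed instead of being arguments 0 and 1. The
  environment reaches the recursion as a list that agrees with \<open>e\<close> only below
  \<open>n\<close>; \<open>computable_cong\<close> bridges the difference.\<close>

lemma computable_descend':
  fixes b :: "val \<Rightarrow> (nat \<Rightarrow> val) \<Rightarrow> val"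
  assumes base: "computable 0 (Suc n) (\<lambda>e. b (e 0) (\<lambda>i. e (Suc i)))"
    and step: "computable 0 (n + 5) (\<lambda>e. s (e 0) (e 1) (e 2) (e 3) (e 4) (\<lambda>i. e (i + 5)))"
    and size: "dominated j p" "\<And>t y e. val_size (descend (\<lambda>y. b y e) (\<lambda>u v q r y. s u v q r y e) t y)
       \<le> p (val_size t + val_size y + esize n e)"
    and T: "computable 0 n T" and Y: "computable 0 n Y"
  shows "computable j n (\<lambda>e. descend (\<lambda>y. b y e) (\<lambda>u v q r y. s u v q r y e) (T e) (Y e))"
proof -
  let ?Fs = "T # Y # map (\<lambda>i e. e i) [0..<n]"
  let ?H = "\<lambda>e. descend (\<lambda>y. b y (\<lambda>i. e (i + 2))) (\<lambda>u v q r y. s u v q r y (\<lambda>i. e (i + 2))) (e 0) (e 1)"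
  have "computable (j + 0) n (\<lambda>e. ?H ((!) (map (\<lambda>F. F e) ?Fs)))"
    using computable_descend[OF base step size] T Y
    by (intro computable_apply computables_Cons computables_vars) auto
  moreover have "?H ((!) (map (\<lambda>F. F e) ?Fs)) =
      descend (\<lambda>y. b y e) (\<lambda>u v q r y. s u v q r y e) (T e) (Y e)" for e
  proof -
    let ?e = "\<lambda>i. map (\<lambda>F. F e) ?Fs ! (i + 2)"
    have e: "?e i = e i" if "i < n" for i using that by simp
    have "b y ?e = b y e" for y
      using computable_cong[OF base, of "case_nat y ?e" "case_nat y e"] e
      by (auto split: nat.split)
    moreover have "s u v q r y ?e = s u v q r y e" for u v q r y
    proof -
      let ?x = "\<lambda>e. case_nat u (case_nat v (case_nat q (case_nat r (case_nat y e))))"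
      have "?x f 0 = u" "?x f 1 = v" "?x f 2 = q" "?x f 3 = r" "?x f 4 = y" "(\<lambda>i. ?x f (i + 5)) = f" for f
        by (auto simp: numeral_eq_Suc)
      then show ?thesis
        using computable_cong[OF step, of "?x ?e" "?x e"] e
        by (auto split: nat.split)
    qed
    ultimately show ?thesis by simp
  qed
  ultimately show ?thesis by simp
qed

section \<open>Booleans and lists as values\<close>

definition tv :: "bool \<Rightarrow> val" where
  "tv b = (if b then Pair Leaf Leaf else Leaf)"

lemma tv_simps [simp]: "tv True = Pair Leaf Leaf" "tv False = Leaf" "tv b = Leaf \<longleftrightarrow> \<not> b"
  "tv b = tv c \<longleftrightarrow> b = c" "val_size (tv b) \<le> 3"
  by (auto simp: tv_def)

primrec vl :: "val \<Rightarrow> val list" where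
  "vl Leaf = []"
| "vl (Pair u v) = u # vl v"

primrec lv :: "val list \<Rightarrow> val" where
  "lv [] = Leaf"
| "lv (x # xs) = Pair x (lv xs)"

lemma vl_lv [simp]: "vl (lv xs) = xs"
  by (induction xs) auto

lemma lv_vl [simp]: "lv (vl v) = v"
  by (induction v) auto

lemma lv_inject [simp]: "lv xs = lv ys \<longleftrightarrow> xs = ys"
  by (metis vl_lv)

lemma val_size_lv: "val_size (lv xs) = 1 + (\<Sum>x\<leftarrow>xs. 1 + val_size x)"
  by (induction xs) auto

lemma val_size_lv_append: "val_size (lv (xs @ ys)) \<le> val_size (lv xs) + val_size (lv ys)"
  by (simp add: val_size_lv)

lemma length_vl: "length (vl t) \<le> val_size t"
  by (induction t) auto

lemma val_size_member: "x \<in> set (vl t) \<Longrightarrow> val_size x \<le> val_size t"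
  by (induction t) auto

primrec vrec :: "val \<Rightarrow> (val \<Rightarrow> val \<Rightarrow> val \<Rightarrow> val \<Rightarrow> val) \<Rightarrow> val \<Rightarrow> val" where
  "vrec b s Leaf = b"
| "vrec b s (Pair u v) = s u v (vrec b s u) (vrec b s v)"

lemma vrec_descend: "vrec b s t = descend (\<lambda>_. b) (\<lambda>u v q r _. s u v q r) t y"
  by (induction t arbitrary: y) auto

lemma computable_vrec:
  assumes base: "computable 0 n b"
    and step: "computable 0 (n + 4) (\<lambda>e. s (e 0) (e 1) (e 2) (e 3) (\<lambda>i. e (i + 4)))"
    and size: "dominated j p" "\<And>t e. val_size (vrec (b e) (\<lambda>u v q r. s u v q r e) t) \<le> p (val_size t + esize n e)"
    and T: "computable 0 n T"
  shows "computable j n (\<lambda>e. vrec (b e) (\<lambda>u v q r. s u v q r e) (T e))"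
proof -
  obtain c where c: "\<And>s. p s \<le> growth j c s" using size(1) by (auto simp: dominated_def)
  have "computable j n (\<lambda>e. descend (\<lambda>y. b e) (\<lambda>u v q r y. s u v q r e) (T e) Leaf)"
  proof (rule computable_descend'[where b = "\<lambda>y e. b e" and s = "\<lambda>u v q r y e. s u v q r e"])
    show "computable 0 (Suc n) (\<lambda>e. b (\<lambda>i. e (Suc i)))"
      by (rule computable_rename[OF base]) auto
    have "computable 0 (n + 5) (\<lambda>e. (\<lambda>e. s (e 0) (e 1) (e 2) (e 3) (\<lambda>i. e (i + 4)))
        (\<lambda>i. e (if i < 4 then i else i + 1)))"
      by (rule computable_rename[OF step]) auto
    then show "computable 0 (n + 5) (\<lambda>e. s (e 0) (e 1) (e 2) (e 3) (\<lambda>i. e (i + 5)))"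
      by (simp add: add.commute)
    show "dominated j (growth j c)" by (rule dominated_growth)
    show "val_size (descend (\<lambda>y. b e) (\<lambda>u v q r y. s u v q r e) t y)
        \<le> growth j c (val_size t + val_size y + esize n e)" for t y e
    proof -
      have "val_size (vrec (b e) (\<lambda>u v q r. s u v q r e) t) \<le> growth j c (val_size t + esize n e)"
        using size(2) c order.trans by blast
      also have "\<dots> \<le> growth j c (val_size t + val_size y + esize n e)"
        by (rule growth_mono) auto
      finally show ?thesis by (simp only: vrec_descend[where y = y])
    qed
  qed (use T computable_Leaf in auto)
  then show ?thesis by (simp flip: vrec_descend)
qed

text \<open>A list is the right spine of a tree, so a fold is tree recursion that ignores the result
  \<open>q\<close> for the left subtree.\<close>

lemma foldr_vrec: "foldr s (vl t) b = vrec b (\<lambda>u v q r. s u r) t"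
  by (induction t) auto

lemma computable_foldr:
  assumes base: "computable 0 n b"
    and step: "computable 0 (n + 2) (\<lambda>e. s (e 0) (e 1) (\<lambda>i. e (i + 2)))"
    and size: "dominated j p" "\<And>t e. val_size (foldr (\<lambda>x r. s x r e) (vl t) (b e)) \<le> p (val_size t + esize n e)"
    and T: "computable 0 n (\<lambda>e. lv (T e))"
  shows "computable j n (\<lambda>e. foldr (\<lambda>x r. s x r e) (T e) (b e))"
proof -
  have "computable j n (\<lambda>e. vrec (b e) (\<lambda>u v q r. s u r e) (lv (T e)))"
  proof (rule computable_vrec[where s = "\<lambda>u v q r e. s u r e" and T = "\<lambda>e. lv (T e)"])
    have "computable 0 (n + 4) (\<lambda>e. (\<lambda>e. s (e 0) (e 1) (\<lambda>i. e (i + 2)))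
        (\<lambda>i. e (if i = 0 then 0 else i + 2)))"
      by (rule computable_rename[OF step]) auto
    then show "computable 0 (n + 4) (\<lambda>e. s (e 0) (e 3) (\<lambda>i. e (i + 4)))"
      by (simp add: numeral_eq_Suc)
  qed (use base T size in \<open>auto simp flip: foldr_vrec\<close>)
  then show ?thesis by (simp flip: foldr_vrec)
qed

lemma computable_const: "computable j n (\<lambda>_. v)"
  by (induction v) (auto intro: computable_Leaf computable_Pair)

lemma computable_if:
  assumes "computable 0 n (\<lambda>e. tv (Q e))" "computable 0 n F" "computable 0 n G"
  shows "computable 0 n (\<lambda>e. if Q e then F e else G e)"
proof -
  have "(\<lambda>e. if tv (Q e) = Leaf then G e else F e) = (\<lambda>e. if Q e then F e else G e)" by auto
  with computable_if_Leaf[OF assms] show ?thesis by simp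
qed

lemma computable_not:
  assumes "computable 0 n (\<lambda>e. tv (Q e))"
  shows "computable 0 n (\<lambda>e. tv (\<not> Q e))"
proof -
  have "(\<lambda>e. if Q e then Leaf else Pair Leaf Leaf) = (\<lambda>e. tv (\<not> Q e))" by (auto simp: tv_def)
  with computable_if[OF assms computable_const[of 0 n Leaf] computable_const[of 0 n "Pair Leaf Leaf"]]
  show ?thesis by simp
qed

lemma computable_if_bool:
  assumes "computable 0 n (\<lambda>e. tv (Q e))" "computable 0 n (\<lambda>e. tv (R e))" "computable 0 n (\<lambda>e. tv (S e))"
  shows "computable 0 n (\<lambda>e. tv (if Q e then R e else S e))"
proof -
  have "(\<lambda>e. if Q e then tv (R e) else tv (S e)) = (\<lambda>e. tv (if Q e then R e else S e))" by auto
  with computable_if[OF assms] show ?thesis by simp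
qed

lemma computable_conj:
  assumes "computable 0 n (\<lambda>e. tv (Q e))" "computable 0 n (\<lambda>e. tv (R e))"
  shows "computable 0 n (\<lambda>e. tv (Q e \<and> R e))"
proof -
  have "computable 0 n (\<lambda>e. tv (if Q e then R e else False))"
    by (rule computable_if_bool) (intro assms computable_const)+
  moreover have "(if a then b else False) = (a \<and> b)" for a b by simp
  ultimately show ?thesis by (simp only:)
qed

lemma computable_disj:
  assumes "computable 0 n (\<lambda>e. tv (Q e))" "computable 0 n (\<lambda>e. tv (R e))"
  shows "computable 0 n (\<lambda>e. tv (Q e \<or> R e))"
proof -
  have "computable 0 n (\<lambda>e. tv (\<not> (\<not> Q e \<and> \<not> R e)))"
    by (intro computable_not computable_conj assms)
  then show ?thesis by simp
qed

lemma computable_imp: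
  assumes "computable 0 n (\<lambda>e. tv (Q e))" "computable 0 n (\<lambda>e. tv (R e))"
  shows "computable 0 n (\<lambda>e. tv (Q e \<longrightarrow> R e))"
proof -
  have "computable 0 n (\<lambda>e. tv (\<not> (Q e \<and> \<not> R e)))"
    by (intro computable_not computable_conj assms)
  then show ?thesis by simp
qed

lemma computable_iff:
  assumes "computable 0 n (\<lambda>e. tv (Q e))" "computable 0 n (\<lambda>e. tv (R e))"
  shows "computable 0 n (\<lambda>e. tv (Q e = R e))"
proof -
  have "computable 0 n (\<lambda>e. tv ((Q e \<longrightarrow> R e) \<and> (R e \<longrightarrow> Q e)))"
    by (intro computable_imp computable_conj assms)
  then show ?thesis by (simp only: iff_conv_conj_imp)
qed

text \<open>The test \<open>y = Leaf\<close> at inner nodes matters: \<open>left\<close> and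
  \<open>right\<close> map \<open>Leaf\<close> to itself, so a bare descent would take
  \<open>Leaf\<close> to be equal to larger trees such as \<open>Pair Leaf Leaf\<close>.\<close>

lemma descend_eq:
  "descend (\<lambda>y. tv (y = Leaf)) (\<lambda>u v q r y. if y = Leaf then Leaf else if q = Leaf then Leaf else r) t y = tv (t = y)"
proof (induction t arbitrary: y)
  case (Pair u v)
  then show ?case by (cases y) auto
qed auto

lemma computable_Leaf_eq: "computable 0 n F \<Longrightarrow> computable 0 n (\<lambda>e. tv (F e = Leaf))"
  using computable_if_Leaf[of 0 n F "\<lambda>_. Leaf" "\<lambda>_. Pair Leaf Leaf"] computable_const by (simp add: tv_def)

lemma computable_eq:
  assumes "computable 0 n F" "computable 0 n G"
  shows "computable 0 n (\<lambda>e. tv (F e = G e))"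
proof -
  have "computable 0 n (\<lambda>e. descend (\<lambda>y. tv (y = Leaf))
     (\<lambda>u v q r y. if y = Leaf then Leaf else if q = Leaf then Leaf else r) (F e) (G e))"
    by (rule computable_descend'[where p = "\<lambda>_. 3"])
      (auto intro!: computable_Leaf_eq computable_if computable_const computable_var assms dominated_const
       simp: descend_eq)
  then show ?thesis by (simp add: descend_eq)
qed

lemma foldr_bex: "foldr (\<lambda>x r. if Q x then Pair Leaf Leaf else r) xs Leaf = tv (\<exists>x\<in>set xs. Q x)"
  by (induction xs) auto

lemma computable_bex:
  assumes "computable 0 n (\<lambda>e. lv (T e))" "computable 0 (Suc n) (\<lambda>e. tv (Q (e 0) (\<lambda>i. e (Suc i))))"
  shows "computable 0 n (\<lambda>e. tv (\<exists>x\<in>set (T e). Q x e))"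
proof -
  have "computable 0 (n + 2) (\<lambda>e. (\<lambda>e. tv (Q (e 0) (\<lambda>i. e (Suc i)))) (\<lambda>i. e (if i = 0 then 0 else i + 1)))"
    by (rule computable_rename[OF assms(2)]) auto
  then have "computable 0 n (\<lambda>e. foldr (\<lambda>x r. if Q x e then Pair Leaf Leaf else r) (T e) Leaf)"
    by (intro computable_foldr[where p = "\<lambda>_. 3"] computable_if)
      (auto simp: foldr_bex intro!: computable_const dominated_const computable_var assms(1))
  then show ?thesis by (simp add: foldr_bex)
qed

lemma computable_ball:
  assumes "computable 0 n (\<lambda>e. lv (T e))" "computable 0 (Suc n) (\<lambda>e. tv (Q (e 0) (\<lambda>i. e (Suc i))))"
  shows "computable 0 n (\<lambda>e. tv (\<forall>x\<in>set (T e). Q x e))"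
proof -
  have "computable 0 n (\<lambda>e. tv (\<not> (\<exists>x\<in>set (T e). \<not> Q x e)))"
    by (intro computable_not computable_bex assms)
  then show ?thesis by simp
qed

lemma computable_member:
  assumes "computable 0 n F" "computable 0 n (\<lambda>e. lv (T e))"
  shows "computable 0 n (\<lambda>e. tv (F e \<in> set (T e)))"
proof -
  have "computable 0 n (\<lambda>e. tv (\<exists>x\<in>set (T e). x = F e))"
    by (intro computable_bex computable_eq assms computable_var computable_rename[OF assms(1)]) auto
  then show ?thesis by (simp add: bex_simps)
qed

lemma foldr_Pair: "foldr Pair xs v = lv (xs @ vl v)"
  by (induction xs) auto

lemma computable_append:
  assumes "computable 0 n (\<lambda>e. lv (S e))" "computable 0 n (\<lambda>e. lv (T e))"
  shows "computable 0 n (\<lambda>e. lv (S e @ T e))"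
proof -
  have "computable 0 2 (\<lambda>e. foldr (\<lambda>x r. Pair x r) (vl (e 0)) (e 1))"
    by (rule computable_foldr[where p = "\<lambda>s. s"])
      (auto intro!: computable_Pair computable_var dominated_id order.trans[OF val_size_lv_append]
        simp: foldr_Pair esize_def numeral_2_eq_2)
  then have "computable (0 + 0) n (\<lambda>e. foldr (\<lambda>x r. Pair x r) (vl (lv (S e))) (lv (T e)))"
    by (rule computable_comp2) (use assms in auto)
  then show ?thesis by (simp add: foldr_Pair)
qed

text \<open>The result has at most as many pieces as the tree has nodes, and each piece is
  polynomial because \<open>f\<close> is computable at height 0.\<close>

lemma computable_concat:
  assumes T: "computable 0 n (\<lambda>e. lv (T e))"
    and f: "computable 0 (Suc n) (\<lambda>e. lv (f (e 0) (\<lambda>i. e (Suc i))))"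
  shows "computable 0 n (\<lambda>e. lv (concat (map (\<lambda>x. f x e) (T e))))"
proof -
  have eq: "foldr (\<lambda>x r. lv (f x e @ vl r)) xs Leaf = lv (concat (map (\<lambda>x. f x e) xs))" for e xs
    by (induction xs) auto
  obtain c where c: "\<And>e. val_size (lv (f (e 0) (\<lambda>i. e (Suc i)))) \<le> growth 0 c (esize (Suc n) e)"
    using computable_size[OF f] by blast
  have c: "val_size (lv (f x e)) \<le> growth 0 c (val_size x + esize n e)" for x e
    using c[of "case_nat x e"] by (simp add: esize_case_nat)
  have size: "val_size (lv (concat (map (\<lambda>x. f x e) (vl t)))) \<le>
      1 + (val_size t + esize n e) * growth 0 c (val_size t + esize n e)" for t e
  proof -
    have "val_size (lv (concat (map (\<lambda>x. f x e) xs))) \<le> 1 + length xs * K"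
      if "\<And>x. x \<in> set xs \<Longrightarrow> val_size (lv (f x e)) \<le> K" for xs K
      using that
    proof (induction xs)
      case (Cons x xs)
      have "val_size (lv (concat (map (\<lambda>x. f x e) (x # xs)))) \<le>
          val_size (lv (f x e)) + val_size (lv (concat (map (\<lambda>x. f x e) xs)))"
        using val_size_lv_append[of "f x e" "concat (map (\<lambda>x. f x e) xs)"] by simp
      with Cons.IH Cons.prems[of x] Cons.prems show ?case by fastforce
    qed simp
    moreover have "val_size (lv (f x e)) \<le> growth 0 c (val_size t + esize n e)" if "x \<in> set (vl t)" for x
      using val_size_member[OF that] by (intro order.trans[OF c growth_mono]) auto
    ultimately have "val_size (lv (concat (map (\<lambda>x. f x e) (vl t)))) \<le>
        1 + length (vl t) * growth 0 c (val_size t + esize n e)" by blast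
    also have "\<dots> \<le> 1 + (val_size t + esize n e) * growth 0 c (val_size t + esize n e)"
      using length_vl[of t] by (intro add_left_mono mult_le_mono1) auto
    finally show ?thesis .
  qed
  have dom: "dominated 0 (\<lambda>s. 1 + s * growth 0 c s)" by (intro dominated_intros)
  have "computable 0 (n + 2) (\<lambda>e. (\<lambda>e. lv (f (e 0) (\<lambda>i. e (Suc i)))) (\<lambda>i. e (if i = 0 then 0 else i + 1)))"
    by (rule computable_rename[OF f]) auto
  then have "computable 0 n (\<lambda>e. foldr (\<lambda>x r. lv (f x e @ vl r)) (T e) Leaf)"
    by (intro computable_foldr[where p = "\<lambda>s. 1 + s * growth 0 c s"] computable_append)
      (use size dom in \<open>auto intro!: computable_const computable_var T simp: eq simp del: growth.simps\<close>)
  then show ?thesis by (simp add: eq)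
qed

lemma computable_Cons:
  "computable 0 n F \<Longrightarrow> computable 0 n (\<lambda>e. lv (T e)) \<Longrightarrow> computable 0 n (\<lambda>e. lv (F e # T e))"
  by (simp add: computable_Pair)

lemma computable_Nil: "computable 0 n (\<lambda>e. lv [])"
  by (simp add: computable_Leaf)

lemma computable_vl: "computable 0 n F \<Longrightarrow> computable 0 n (\<lambda>e. lv (vl (F e)))"
  by simp

lemma computable_map:
  assumes "computable 0 n (\<lambda>e. lv (T e))" "computable 0 (Suc n) (\<lambda>e. f (e 0) (\<lambda>i. e (Suc i)))"
  shows "computable 0 n (\<lambda>e. lv (map (\<lambda>x. f x e) (T e)))"
proof -
  have "computable 0 n (\<lambda>e. lv (concat (map (\<lambda>x. [f x e]) (T e))))"
    by (intro computable_concat computable_Cons computable_Nil assms)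
  then show ?thesis by simp
qed

lemma computable_if_list:
  assumes "computable 0 n (\<lambda>e. tv (Q e))" "computable 0 n (\<lambda>e. lv (S e))" "computable 0 n (\<lambda>e. lv (T e))"
  shows "computable 0 n (\<lambda>e. lv (if Q e then S e else T e))"
proof -
  have "(\<lambda>e. if Q e then lv (S e) else lv (T e)) = (\<lambda>e. lv (if Q e then S e else T e))" by auto
  with computable_if[OF assms] show ?thesis by simp
qed

lemma computable_filter:
  assumes "computable 0 n (\<lambda>e. lv (T e))" "computable 0 (Suc n) (\<lambda>e. tv (Q (e 0) (\<lambda>i. e (Suc i))))"
  shows "computable 0 n (\<lambda>e. lv (filter (\<lambda>x. Q x e) (T e)))"
proof -
  have "concat (map (\<lambda>x. if Q x e then [x] else []) xs) = filter (\<lambda>x. Q x e) xs" for xs e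
    by (induction xs) auto
  moreover have "computable 0 n (\<lambda>e. lv (concat (map (\<lambda>x. if Q x e then [x] else []) (T e))))"
    by (intro computable_concat computable_if_list computable_Cons computable_Nil computable_var assms) simp
  ultimately show ?thesis by simp
qed

lemma computable_length:
  assumes "computable 0 n (\<lambda>e. lv (T e))"
  shows "computable 0 n (\<lambda>e. enc_nat (length (T e)))"
proof -
  have eq: "foldr (\<lambda>x. Pair Leaf) xs Leaf = enc_nat (length xs)" for xs :: "val list"
    by (induction xs) auto
  have enc: "val_size (enc_nat l) = 2 * l + 1" for l by (induction l) auto
  have "computable 0 n (\<lambda>e. foldr (\<lambda>x r. Pair Leaf r) (T e) Leaf)"
  proof (rule computable_foldr[where p = "\<lambda>s. 2 * s + 1"])
    show "val_size (foldr (\<lambda>x. Pair Leaf) (vl t) Leaf) \<le> 2 * (val_size t + esize n e) + 1" for t e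
      using length_vl[of t] by (simp add: eq enc)
    show "dominated 0 (\<lambda>s. 2 * s + 1)" by (intro dominated_intros)
  qed (auto intro!: computable_const computable_Pair computable_var assms)
  then show ?thesis by (simp add: eq)
qed

lemmas computable_intros = computable_var computable_Nil computable_Cons computable_vl computable_append
  computable_concat computable_map computable_filter computable_if_list computable_length
  computable_bex computable_ball computable_member computable_not computable_conj computable_disj
  computable_imp computable_if_bool computable_eq computable_iff computable_if computable_left computable_right
  computable_Pair computable_const

section \<open>Subtrees, numberings, subsets, Boolean combinations and tuples\<close>

fun subtrees :: "val \<Rightarrow> val list" where
  "subtrees Leaf = [Leaf]"
| "subtrees (Pair u v) = Pair u v # subtrees u @ subtrees v"

lemma length_subtrees: "length (subtrees t) = val_size t"
  by (induction t) auto

lemma val_size_subtrees: "u \<in> set (subtrees t) \<Longrightarrow> val_size u \<le> val_size t"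
  by (induction t) auto

lemma val_size_lv_le:
  assumes "\<And>x. x \<in> set xs \<Longrightarrow> val_size x \<le> K"
  shows "val_size (lv xs) \<le> 1 + length xs * (1 + K)"
  using assms
proof (induction xs)
  case (Cons x xs)
  then have "val_size x \<le> K" "val_size (lv xs) \<le> 1 + length xs * (1 + K)" by auto
  then show ?case by simp
qed simp

lemma computable_subtrees:
  assumes "computable 0 n T"
  shows "computable 0 n (\<lambda>e. lv (subtrees (T e)))"
proof -
  let ?s = "\<lambda>u v q r. lv (Pair u v # vl q @ vl r)"
  have eq: "vrec (lv [Leaf]) ?s t = lv (subtrees t)" for t
    by (induction t) auto
  have "computable 0 n (\<lambda>e. vrec (lv [Leaf]) ?s (T e))"
  proof (rule computable_vrec[where p = "\<lambda>s. 1 + s * (1 + s)"])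
    show "dominated 0 (\<lambda>s. 1 + s * (1 + s))" by (intro dominated_intros)
    show "val_size (vrec (lv [Leaf]) ?s t) \<le> 1 + (val_size t + esize n e) * (1 + (val_size t + esize n e))" for t e
    proof -
      have "val_size (lv (subtrees t)) \<le> 1 + val_size t * (1 + val_size t)"
        using val_size_lv_le[of "subtrees t" "val_size t"] val_size_subtrees by (simp add: length_subtrees)
      also have "\<dots> \<le> 1 + (val_size t + esize n e) * (1 + (val_size t + esize n e))"
        by (intro add_left_mono mult_le_mono) auto
      finally show ?thesis by (simp only: eq)
    qed
  qed (intro computable_intros assms; simp)+
  then show ?thesis by (simp only: eq)
qed

text \<open>The numbers run downwards because a recursion over the list knows the length of the
  tail. This is why the tables of the automaton are built from \<open>rev [0..<N]\<close> and the
  letter with number \<open>q\<close> is looked up in the reversed list.\<close>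

primrec numbered :: "val list \<Rightarrow> val list" where
  "numbered [] = []"
| "numbered (x # xs) = Pair (enc_nat (length xs)) x # numbered xs"

lemma val_size_enc_nat: "val_size (enc_nat n) = 2 * n + 1"
  by (induction n) auto

lemma length_numbered: "length (numbered xs) = length xs"
  by (induction xs) auto

lemma computable_numbered:
  assumes "computable 0 n (\<lambda>e. lv (T e))"
  shows "computable 0 n (\<lambda>e. lv (numbered (T e)))"
proof -
  let ?s = "\<lambda>u v q r. lv (Pair (enc_nat (length (vl v))) u # vl r)"
  have eq: "vrec (lv []) ?s t = lv (numbered (vl t))" for t
    by (induction t) auto
  have size: "val_size x \<le> 2 + 3 * val_size t" if "x \<in> set (numbered (vl t))" for x t
    using that
  proof (induction t)
    case (Pair u v)
    then show ?case using length_vl[of v] by (auto simp: val_size_enc_nat)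
  qed simp
  have "computable 0 n (\<lambda>e. vrec (lv []) ?s (lv (T e)))"
  proof (rule computable_vrec[where p = "\<lambda>s. 1 + s * (3 + 3 * s)"])
    show "dominated 0 (\<lambda>s. 1 + s * (3 + 3 * s))" by (intro dominated_intros)
    show "val_size (vrec (lv []) ?s t) \<le> 1 + (val_size t + esize n e) * (3 + 3 * (val_size t + esize n e))" for t e
    proof -
      have "val_size (lv (numbered (vl t))) \<le> 1 + length (vl t) * (1 + (2 + 3 * val_size t))"
        using val_size_lv_le[of "numbered (vl t)" "2 + 3 * val_size t"] size by (simp add: length_numbered)
      also have "\<dots> \<le> 1 + (val_size t + esize n e) * (3 + 3 * (val_size t + esize n e))"
        using length_vl[of t] by (intro add_left_mono mult_le_mono) auto
      finally show ?thesis by (simp only: eq)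
    qed
  qed (intro computable_intros assms; simp)+
  then show ?thesis by (simp only: eq vl_lv)
qed

lemma computable_nums:
  assumes "computable 0 n T"
  shows "computable 0 n (\<lambda>e. lv (map enc_nat (rev [0..<length (vl (T e))])))"
proof -
  have "map left (numbered xs) = map enc_nat (rev [0..<length xs])" for xs
    by (induction xs) auto
  moreover have "computable 0 n (\<lambda>e. lv (map left (numbered (vl (T e)))))"
    by (intro computable_intros computable_numbered assms) simp
  ultimately show ?thesis by simp
qed

text \<open>The source of all exponentials: the list doubles with every element. It is applied
  twice, to the subtrees of the formula and to the pairs of thresholds and cores.\<close>

lemma computable_subseqs: "computable 1 1 (\<lambda>e. lv (map lv (subseqs (vl (e 0)))))"
proof -
  let ?s = "\<lambda>x r. lv (map (Pair x) (vl r) @ vl r)"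
  have eq: "foldr ?s xs (lv [Leaf]) = lv (map lv (subseqs xs))" for xs
    by (induction xs) (auto simp: Let_def)
  have size: "val_size x \<le> val_size t" if "x \<in> set (map lv (subseqs (vl t)))" for x t
    using that
  proof (induction t arbitrary: x)
    case (Pair u v)
    then show ?case by (fastforce simp: Let_def)
  qed simp
  have "computable 1 1 (\<lambda>e. foldr ?s (vl (e 0)) (lv [Leaf]))"
  proof (rule computable_foldr[where p = "\<lambda>s. 1 + growth 1 1 s * (1 + s)"])
    show "dominated 1 (\<lambda>s. 1 + growth 1 1 s * (1 + s))" by (intro dominated_intros)
    show "val_size (foldr ?s (vl t) (lv [Leaf])) \<le>
        1 + growth 1 1 (val_size t + esize 1 e) * (1 + (val_size t + esize 1 e))" for t e
    proof -
      have "(2::nat) ^ length (vl t) \<le> growth 1 1 (val_size t + esize 1 e)"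
      proof -
        have "growth 1 1 s = 2 ^ (s + 2)" for s by simp
        then show ?thesis using length_vl[of t] by (simp only:) (intro power_increasing, auto)
      qed
      moreover have "val_size (lv (map lv (subseqs (vl t)))) \<le> 1 + 2 ^ length (vl t) * (1 + val_size t)"
        using val_size_lv_le[of "map lv (subseqs (vl t))" "val_size t"] size by (simp add: length_subseqs)
      ultimately show ?thesis unfolding eq
        by (elim order.trans) (intro add_left_mono mult_le_mono, auto)
    qed
  qed (intro computable_intros; simp)+
  then show ?thesis by (simp only: eq)
qed

text \<open>
  Truth of the formula with code \<open>t\<close>, where \<open>A\<close> decides the maximal subformulas that
  are not Boolean combinations.
\<close>

function bev :: "(val \<Rightarrow> bool) \<Rightarrow> val \<Rightarrow> bool" where
  "bev A Leaf = A Leaf"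
| "bev A (Pair t b) =
    (if t = enc_nat 4 then \<not> bev A b
     else if t = enc_nat 5 then bev A (left b) \<and> bev A (right b)
     else if t = enc_nat 6 then bev A (left b) \<or> bev A (right b)
     else A (Pair t b))"
  by pat_completeness auto
termination
proof (relation "measure (\<lambda>(A, t). val_size t)")
qed (auto simp: less_Suc_eq_le val_size_left val_size_right intro: trans_le_add2)

text \<open>For conjunctions and disjunctions \<open>bev\<close> descends to grandchildren, since
  \<open>Pair t b\<close> has its two operands inside \<open>b\<close>. The recursion therefore
  returns three truth values for each tree: its own and those of its two children.\<close>

lemma computable_bev:
  assumes "computable 0 (Suc n) (\<lambda>e. tv (A (e 0) (\<lambda>i. e (Suc i))))" "computable 0 n T"
  shows "computable 0 n (\<lambda>e. tv (bev (\<lambda>a. A a e) (T e)))"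
proof -
  let ?b = "\<lambda>e. lv [tv (A Leaf e), tv (A Leaf e), tv (A Leaf e)]"
  let ?s = "\<lambda>u v q r e. lv [
    tv (if u = enc_nat 4 then \<not> left r \<noteq> Leaf
     else if u = enc_nat 5 then left (right r) \<noteq> Leaf \<and> left (right (right r)) \<noteq> Leaf
     else if u = enc_nat 6 then left (right r) \<noteq> Leaf \<or> left (right (right r)) \<noteq> Leaf
     else A (Pair u v) e), left q, left r]"
  have eq: "vrec (?b e) (\<lambda>u v q r. ?s u v q r e) t =
      lv (map (\<lambda>t. tv (bev (\<lambda>a. A a e) t)) [t, left t, right t])" for t e
    by (induction t) auto
  have A: "computable 0 n (\<lambda>e. tv (A (F e) e))" if "computable 0 n F" for F
    using computable_bex[of n "\<lambda>e. [F e]" A] assms(1) that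
    by (simp add: computable_Pair computable_Leaf)
  have A': "computable 0 (n + 4) (\<lambda>e. tv (A (Pair (e 0) (e 1)) (\<lambda>i. e (i + 4))))"
  proof -
    have "computable 0 (Suc (n + 4)) (\<lambda>e. (\<lambda>e. tv (A (e 0) (\<lambda>i. e (Suc i)))) (\<lambda>i. e (if i = 0 then 0 else i + 4)))"
      by (rule computable_rename[OF assms(1)]) auto
    then have "computable 0 (n + 4) (\<lambda>e. tv (\<exists>x\<in>set [Pair (e 0) (e 1)]. A x (\<lambda>i. e (i + 4))))"
      by (intro computable_bex computable_intros) auto
    then show ?thesis by simp
  qed
  have "computable 0 n (\<lambda>e. left (vrec (?b e) (\<lambda>u v q r. ?s u v q r e) (T e)))"
  proof (intro computable_left computable_vrec[where p = "\<lambda>_. 13"])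
    show "val_size (vrec (?b e) (\<lambda>u v q r. ?s u v q r e) t) \<le> 13" for t e
      unfolding eq by (auto simp: tv_def)
  qed (intro A computable_intros A' assms dominated_intros; simp)+
  then show ?thesis by (simp only: eq) simp
qed

primrec nthv :: "nat \<Rightarrow> val \<Rightarrow> val" where
  "nthv 0 v = left v"
| "nthv (Suc i) v = nthv i (right v)"

lemma nthv_lv: "i < length xs \<Longrightarrow> nthv i (lv xs) = xs ! i"
proof (induction xs arbitrary: i)
  case (Cons x xs)
  then show ?case by (cases i) auto
qed simp

lemma computable_nthv: "computable 0 n F \<Longrightarrow> computable 0 n (\<lambda>e. nthv i (F e))"
  by (induction i arbitrary: F) (auto intro: computable_left computable_right)

primrec tuples :: "val list list \<Rightarrow> val list" where
  "tuples [] = [Leaf]"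
| "tuples (xs # xss) = concat (map (\<lambda>x. map (Pair x) (tuples xss)) xs)"

lemma set_tuples: "set (tuples xss) = lv ` {xs. list_all2 (\<lambda>x ys. x \<in> set ys) xs xss}"
proof (induction xss)
  case (Cons ys xss)
  show ?case
    by (auto simp: Cons image_iff list_all2_Cons2 Bex_def) (metis lv.simps(2))+
qed simp

lemma computable_tuples_Nil: "computable 0 n (\<lambda>e. lv (tuples []))"
  by (simp only: tuples.simps) (intro computable_const)

lemma computable_tuples_Cons:
  assumes "computable 0 n (\<lambda>e. lv (T e))" "computable 0 n (\<lambda>e. lv (tuples (Ts e)))"
  shows "computable 0 n (\<lambda>e. lv (tuples (T e # Ts e)))"
proof -
  have "computable 0 2 (\<lambda>e. lv (concat (map (\<lambda>x. map (Pair x) (vl (e 1))) (vl (e 0)))))"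
    by (intro computable_intros; simp)
  then have "computable (0 + 0) n
      (\<lambda>e. lv (concat (map (\<lambda>x. map (Pair x) (vl (lv (tuples (Ts e))))) (vl (lv (T e))))))"
    by (rule computable_comp2) (rule assms)+
  then show ?thesis by simp
qed

section \<open>The automaton of a formula\<close>

text \<open>States and output letters are the same numbers, so a run labels every position with one
  \<open>q < N\<close>, tested by \<open>out\<close> against the input letter, by \<open>F1\<close>,
  \<open>R1\<close>, \<open>L1\<close> along the word and by \<open>F2\<close>, \<open>R2\<close>,
  \<open>L2\<close> along the data. The root is the first position, hence \<open>F1\<close> is
  tested by the final states of the transducer; \<open>N\<close> is a fresh initial state of the
  string automaton. That automaton reads singletons only, and every letter is a key: together this
  forces all data values to be distinct.\<close>

definition local_odta ::
  "nat \<Rightarrow> nat \<Rightarrow> (nat \<Rightarrow> bool) \<Rightarrow> (nat \<Rightarrow> nat \<Rightarrow> bool) \<Rightarrow> (nat \<Rightarrow> bool) \<Rightarrow> (nat \<Rightarrow> nat \<Rightarrow> bool) \<Rightarrow>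
   (nat \<Rightarrow> bool) \<Rightarrow> (nat \<Rightarrow> nat \<Rightarrow> bool) \<Rightarrow> (nat \<Rightarrow> bool) \<Rightarrow> weak_odta" where
  "local_odta k N F1 R1 L1 out F2 R2 L2 =
    \<lparr>odta_letters = N,
     odta_trans =
       \<lparr>tr_states = N,
        tr_delta = concat (map (\<lambda>q. map (\<lambda>a. ((q, a),
            \<lparr>nfa_states = 2, nfa_init = [0],
             nfa_trans = map (\<lambda>q'. (0, q', 1)) (filter (R1 q) (rev [0..<N])),
             nfa_final = (if L1 q then [1, 0] else [1])\<rparr>)) (rev [0..<k])) (rev [0..<N])),
        tr_final = filter F1 (rev [0..<N]),
        tr_out = concat (map (\<lambda>q. map (\<lambda>a. (q, a, q)) (filter (out q) (rev [0..<k]))) (rev [0..<N]))\<rparr>,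
     odta_aut =
       \<lparr>nfa_states = Suc N, nfa_init = [N],
        nfa_trans = map (\<lambda>q. (N, {q}, q)) (filter F2 (rev [0..<N])) @
          concat (map (\<lambda>q. map (\<lambda>q'. (q, {q'}, q')) (filter (R2 q) (rev [0..<N]))) (rev [0..<N])),
        nfa_final = filter L2 (rev [0..<N])\<rparr>,
     odta_key = rev [0..<N]\<rparr>"

text \<open>
  A letter is a pair of tuples, the description of a position and that of the end of its block.  The
  core of a position is its 1-type.  Neighbours are optional cores, with \<^term>\<open>Leaf\<close> for none.
  The claim for the data successor (predecessor) is 1 if it is guessed to be the next position, 2 if
  it is guessed to be the previous one, and 0 otherwise.  The counts contain the pair of \<open>j\<close> and
  \<open>c\<close> iff more than \<open>j\<close> positions have the core \<open>c\<close>, among all positions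
  or among those up to the present one.
\<close>

abbreviation core :: "val \<Rightarrow> val" where "core g \<equiv> nthv 0 (left g)"
abbreviation next_pos :: "val \<Rightarrow> val" where "next_pos g \<equiv> nthv 1 (left g)"
abbreviation prev_pos :: "val \<Rightarrow> val" where "prev_pos g \<equiv> nthv 2 (left g)"
abbreviation next_data :: "val \<Rightarrow> val" where "next_data g \<equiv> nthv 3 (left g)"
abbreviation prev_data :: "val \<Rightarrow> val" where "prev_data g \<equiv> nthv 4 (left g)"
abbreviation next_claim :: "val \<Rightarrow> val" where "next_claim g \<equiv> nthv 5 (left g)"
abbreviation prev_claim :: "val \<Rightarrow> val" where "prev_claim g \<equiv> nthv 6 (left g)"
abbreviation colour :: "val \<Rightarrow> val" where "colour g \<equiv> nthv 7 (left g)"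
abbreviation next_colour :: "val \<Rightarrow> val" where "next_colour g \<equiv> nthv 8 (left g)"
abbreviation total_counts :: "val \<Rightarrow> val" where "total_counts g \<equiv> nthv 9 (left g)"
abbreviation partial_counts_of :: "val \<Rightarrow> val" where "partial_counts_of g \<equiv> nthv 10 (left g)"

text \<open>The numbers 1 and 2 have two meanings here. In \<open>s\<close> they select the next or
  the previous position; in the result they say that this neighbour is the data successor or the
  data predecessor.\<close>

definition claim_rel :: "nat \<Rightarrow> val \<Rightarrow> val" where
  "claim_rel s g = (if next_claim g = enc_nat s then enc_nat 1
     else if prev_claim g = enc_nat s then enc_nat 2 else enc_nat 0)"

text \<open>
  The distinct positions related to the present one, each with its relation in the word (3: equal,
  1: next, 2: previous, 0: none), its relation in the data, and its core.
\<close>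

definition slots :: "val \<Rightarrow> val list" where
  "slots g = [Pair (enc_nat 3) (Pair (enc_nat 0) (core g))]
     @ (if next_pos g = Leaf then [] else [Pair (enc_nat 1) (Pair (claim_rel 1 g) (left (next_pos g)))])
     @ (if prev_pos g = Leaf then [] else [Pair (enc_nat 2) (Pair (claim_rel 2 g) (left (prev_pos g)))])
     @ (if next_data g \<noteq> Leaf \<and> next_claim g = enc_nat 0
        then [Pair (enc_nat 0) (Pair (enc_nat 1) (left (next_data g)))] else [])
     @ (if prev_data g \<noteq> Leaf \<and> prev_claim g = enc_nat 0
        then [Pair (enc_nat 0) (Pair (enc_nat 2) (left (prev_data g)))] else [])"

text \<open>
  Truth of an atomic or quantified formula with code \<open>a\<close> if the variable with code \<open>v\<close> is
  assigned a position with core \<open>cy\<close> and the other variable one with core \<open>cx\<close>, the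
  former being related to the latter by \<open>r1\<close> in the word and by \<open>r2\<close> in the data.
\<close>

definition pair_truth :: "val \<Rightarrow> val \<Rightarrow> val \<Rightarrow> val \<Rightarrow> val \<Rightarrow> val \<Rightarrow> bool" where
  "pair_truth v cx cy r1 r2 a =
    (if left a = enc_nat 0 then
       left (if (right (right a) = Leaf) = (v = Leaf) then cy else cx) = enc_nat (length (vl (left (right a))))
     else if left a = enc_nat 1 then
       (left (right a) = Leaf) = (right (right a) = Leaf) \<or> r1 = enc_nat 3
     else if left a = enc_nat 2 then
       \<not> (left (right a) = Leaf) = (right (right a) = Leaf) \<and>
       r1 = (if (right (right a) = Leaf) = (v = Leaf) then enc_nat 1 else enc_nat 2)
     else if left a = enc_nat 3 then
       \<not> (left (right a) = Leaf) = (right (right a) = Leaf) \<and>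
       r2 = (if (right (right a) = Leaf) = (v = Leaf) then enc_nat 1 else enc_nat 2)
     else if left a = enc_nat 7 \<or> left a = enc_nat 8 then
       a \<in> set (vl (right (if (left (right a) = Leaf) = (v = Leaf) then cx else cy)))
     else False)"

text \<open>
  A witness that is no neighbour exists iff its core occurs more often than in the neighbourhood.
\<close>

definition witness :: "val list \<Rightarrow> val \<Rightarrow> val \<Rightarrow> val \<Rightarrow> bool" where
  "witness C g v p \<longleftrightarrow>
     (\<exists>s\<in>set (slots g). bev (pair_truth v (core g) (right (right s)) (left s) (left (right s))) p) \<or>
     (\<exists>c\<in>set C. bev (pair_truth v (core g) c (enc_nat 0) (enc_nat 0)) p \<and>
        Pair (enc_nat (length (filter (\<lambda>s. right (right s) = c) (slots g)))) c \<in> set (vl (total_counts g)))"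

definition letter_ok :: "val list \<Rightarrow> val \<Rightarrow> val \<Rightarrow> bool" where
  "letter_ok C f g \<longleftrightarrow>
     (\<forall>a\<in>set (subtrees f).
        (left a = enc_nat 7 \<longrightarrow> (a \<in> set (vl (right (core g)))) =
           witness C g (left (right a)) (right (right a))) \<and>
        (left a = enc_nat 8 \<longrightarrow> (a \<in> set (vl (right (core g)))) =
           (\<not> witness C g (left (right a)) (Pair (enc_nat 4) (right (right a)))))) \<and>
     bev (pair_truth Leaf (core g) (core g) (enc_nat 3) (enc_nat 0)) f \<and>
     (next_claim g = enc_nat 0 \<or> next_claim g \<noteq> prev_claim g) \<and>
     (next_claim g = enc_nat 1 \<longrightarrow> next_pos g \<noteq> Leaf \<and> next_data g \<noteq> Leaf) \<and>
     (next_claim g = enc_nat 2 \<longrightarrow> prev_pos g \<noteq> Leaf \<and> next_data g \<noteq> Leaf) \<and>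
     (prev_claim g = enc_nat 1 \<longrightarrow> next_pos g \<noteq> Leaf \<and> prev_data g \<noteq> Leaf) \<and>
     (prev_claim g = enc_nat 2 \<longrightarrow> prev_pos g \<noteq> Leaf \<and> prev_data g \<noteq> Leaf) \<and>
     (next_claim g = enc_nat 0 \<longrightarrow> right g = left g)"

abbreviation thresholds :: "val list" where
  "thresholds \<equiv> [enc_nat 0, enc_nat 1, enc_nat 2, enc_nat 3, enc_nat 4, enc_nat 5]"

definition first_pos :: "val list \<Rightarrow> val \<Rightarrow> bool" where
  "first_pos C g \<longleftrightarrow> prev_pos g = Leaf \<and>
     (\<forall>c\<in>set C. \<forall>j\<in>set thresholds.
        (Pair j c \<in> set (vl (partial_counts_of g))) = (j = Leaf \<and> c = core g))"

definition last_pos :: "val \<Rightarrow> bool" where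
  "last_pos g \<longleftrightarrow> next_pos g = Leaf \<and> partial_counts_of g = total_counts g"

text \<open>Equality of the \<open>right\<close> components along claimed steps hands the
  description of the end of a block to all positions of the block; at the end itself
  \<open>letter_ok\<close> requires \<open>right g = left g\<close>.\<close>

definition data_link :: "val \<Rightarrow> val \<Rightarrow> bool" where
  "data_link g h \<longleftrightarrow> next_data g = Pair (core h) Leaf \<and> prev_data h = Pair (core g) Leaf \<and>
     next_colour g = colour h \<and> (next_claim g = enc_nat 0) = (prev_claim h = enc_nat 0) \<and>
     (next_claim g \<noteq> enc_nat 0 \<longrightarrow> right g = right h)"

text \<open>The two colour conditions concern the absence of a claim. They exclude the neighbour as
  data successor by letters alone, hence for every later rearrangement of the data that respects
  \<open>data_link\<close>. The last condition counts: more than \<open>j\<close> occurrences are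
  reached either before \<open>h\<close>, or with \<open>h\<close> when more than
  \<open>j - 1\<close> were reached before it.\<close>

definition pos_link :: "val list \<Rightarrow> val \<Rightarrow> val \<Rightarrow> bool" where
  "pos_link C g h \<longleftrightarrow> next_pos g = Pair (core h) Leaf \<and> prev_pos h = Pair (core g) Leaf \<and>
     (next_claim g = enc_nat 1) = (prev_claim h = enc_nat 2) \<and>
     (next_claim h = enc_nat 2) = (prev_claim g = enc_nat 1) \<and>
     (next_claim g = enc_nat 1 \<longrightarrow> data_link g h) \<and>
     (next_claim h = enc_nat 2 \<longrightarrow> data_link h g) \<and>
     (next_claim g \<noteq> enc_nat 1 \<and> next_data g \<noteq> Leaf \<longrightarrow> next_colour g \<noteq> colour h) \<and>
     (next_claim h \<noteq> enc_nat 2 \<and> next_data h \<noteq> Leaf \<longrightarrow> next_colour h \<noteq> colour g) \<and>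
     total_counts g = total_counts h \<and>
     (\<forall>c\<in>set C. \<forall>j\<in>set thresholds. (Pair j c \<in> set (vl (partial_counts_of h))) =
        (Pair j c \<in> set (vl (partial_counts_of g)) \<or> c = core h \<and> (j = Leaf \<or> Pair (right j) c \<in> set (vl (partial_counts_of g)))))"

definition first_data :: "val \<Rightarrow> bool" where
  "first_data g \<longleftrightarrow> prev_data g = Leaf"

definition last_data :: "val \<Rightarrow> bool" where
  "last_data g \<longleftrightarrow> next_data g = Leaf"

definition basics :: "val list \<Rightarrow> val list \<Rightarrow> val list" where
  "basics C T = (let opt = Leaf # map (\<lambda>c. Pair c Leaf) C;
      claims = map enc_nat [0, 1, 2]; colours = map enc_nat [0, 1, 2, 3, 4]
    in tuples [C, opt, opt, opt, opt, claims, claims, colours, colours, T, T])"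

definition code_letters :: "val list \<Rightarrow> val list \<Rightarrow> val list" where
  "code_letters C T = concat (map (\<lambda>b. map (Pair b) (basics C T)) (basics C T))"

definition cores :: "nat \<Rightarrow> val \<Rightarrow> val list" where
  "cores k f = concat (map (\<lambda>a. map (Pair a) (map lv (subseqs (subtrees f)))) (map enc_nat (rev [0..<k])))"

text \<open>The candidates for a record of counts are all subsets of a set that is already
  exponential.\<close>

definition counts :: "val list \<Rightarrow> val list" where
  "counts C = map lv (subseqs (concat (map (\<lambda>j. map (Pair j) C) thresholds)))"

definition letter_list :: "nat \<Rightarrow> val \<Rightarrow> val list" where
  "letter_list k f = code_letters (cores k f) (counts (cores k f))"

definition fo2_odta :: "nat \<Rightarrow> val \<Rightarrow> weak_odta" where
  "fo2_odta k f = (let C = cores k f; L = (\<lambda>q. rev (letter_list k f) ! q)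
    in local_odta k (length (letter_list k f))
      (\<lambda>q. first_pos C (L q)) (\<lambda>q q'. pos_link C (L q) (L q')) (\<lambda>q. last_pos (L q))
      (\<lambda>q a. letter_ok C f (L q) \<and> left (core (L q)) = enc_nat a)
      (\<lambda>q. first_data (L q)) (\<lambda>q q'. data_link (L q) (L q')) (\<lambda>q. last_data (L q)))"

text \<open>The encoding of the automaton, rewritten with computable list operations only.
  \<open>E\<close> lists the letters paired with their numbers, so that both are at hand when the
  tables are filled.\<close>

definition odta_code :: "val \<Rightarrow> val \<Rightarrow> val list \<Rightarrow> val list \<Rightarrow> val" where
  "odta_code k f C E =
    Pair (enc_nat (length E))
   (Pair
      (Pair (enc_nat (length E))
      (Pair (lv (concat (map (\<lambda>p. map (\<lambda>a. Pair (Pair (left p) a)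
          (Pair (enc_nat 2) (Pair (lv [enc_nat 0])
            (Pair (lv (map (\<lambda>q. Pair (enc_nat 0) (Pair (left q) (enc_nat 1))) (filter (\<lambda>q. pos_link C (right p) (right q)) E)))
              (lv (if last_pos (right p) then [enc_nat 1, enc_nat 0] else [enc_nat 1]))))))
            (map enc_nat (rev [0..<length (vl k)]))) E)))
      (Pair (lv (map left (filter (\<lambda>p. first_pos C (right p)) E)))
            (lv (concat (map (\<lambda>p. map (\<lambda>a. Pair (left p) (Pair a (left p)))
              (filter (\<lambda>a. letter_ok C f (right p) \<and> left (core (right p)) = a) (map enc_nat (rev [0..<length (vl k)])))) E))))))
   (Pair
      (Pair (enc_nat (Suc (length E)))
      (Pair (lv [enc_nat (length E)])
      (Pair (lv (map (\<lambda>q. Pair (enc_nat (length E)) (Pair (lv [left q]) (left q))) (filter (\<lambda>p. first_data (right p)) E) @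
              concat (map (\<lambda>p. map (\<lambda>q. Pair (left p) (Pair (lv [left q]) (left q))) (filter (\<lambda>q. data_link (right p) (right q)) E)) E)))
            (lv (map left (filter (\<lambda>p. last_data (right p)) E))))))
      (lv (map left E))))"

section \<open>Computing the automaton in double exponential time\<close>

lemma enc_list_lv: "enc_list f xs = lv (map f xs)"
  by (induction xs) auto

lemma enc_nat_inject [simp]: "enc_nat m = enc_nat n \<longleftrightarrow> m = n"
  by (metis val_size_enc_nat add_right_cancel mult_cancel1 zero_neq_numeral)

lemma length_vl_enc_nat [simp]: "length (vl (enc_nat k)) = k"
  by (induction k) auto

lemma numbered_conv: "numbered xs = map (\<lambda>q. Pair (enc_nat q) (rev xs ! q)) (rev [0..<length xs])"
proof (induction xs)
  case (Cons x xs)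
  then show ?case by (auto simp: nth_append)
qed simp

lemma enc_fo2_odta:
  "enc_weak_odta (fo2_odta k f) = odta_code (enc_nat k) f (cores k f) (numbered (letter_list k f))"
  unfolding numbered_conv
  by (simp add: fo2_odta_def Let_def local_odta_def odta_code_def enc_weak_odta_def enc_transducer_def
      enc_nfa_def enc_list_lv enc_prod_def enc_set_def filter_map comp_def map_concat
      if_distrib[of "map enc_nat"] cong: if_cong)

lemma computable_claim_rel:
  assumes "computable 0 n G" shows "computable 0 n (\<lambda>e. claim_rel s (G e))"
proof -
  have "computable 0 1 (\<lambda>e. claim_rel s (e 0))"
    unfolding claim_rel_def by (intro computable_intros computable_nthv; simp)
  from computable_comp1[OF this assms] show ?thesis by simp
qed

lemma computable_slots:
  assumes "computable 0 n G" shows "computable 0 n (\<lambda>e. lv (slots (G e)))"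
proof -
  have "computable 0 1 (\<lambda>e. lv (slots (e 0)))"
    unfolding slots_def by (intro computable_intros computable_nthv computable_claim_rel; simp)
  from computable_comp1[where f = "\<lambda>x. lv (slots x)", OF this assms] show ?thesis by simp
qed

lemma computable_pair_truth:
  assumes "computable 0 n U" "computable 0 n X" "computable 0 n Y" "computable 0 n R" "computable 0 n S" "computable 0 n A"
  shows "computable 0 n (\<lambda>e. tv (pair_truth (U e) (X e) (Y e) (R e) (S e) (A e)))"
proof -
  let ?H = "\<lambda>e. tv (pair_truth (e 0) (e 1) (e 2) (e 3) (e 4) (e 5))"
  have "computable 0 (length [U, X, Y, R, S, A]) ?H"
    unfolding pair_truth_def by (intro computable_intros; simp)
  from computable_apply[OF this, of 0 n] show ?thesis
    using assms by (simp add: computables_Cons computables_Nil)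
qed

lemma computable_witness:
  assumes "computable 0 n (\<lambda>e. lv (C e))" "computable 0 n G" "computable 0 n U" "computable 0 n A"
  shows "computable 0 n (\<lambda>e. tv (witness (C e) (G e) (U e) (A e)))"
proof -
  let ?H = "\<lambda>e. tv (witness (vl (e 0)) (e 1) (e 2) (e 3))"
  have "computable 0 (length [\<lambda>e. lv (C e), G, U, A]) ?H"
    unfolding witness_def
    by (intro computable_intros computable_nthv computable_slots computable_pair_truth computable_bev; simp)
  from computable_apply[OF this, of 0 n] show ?thesis
    using assms by (simp add: computables_Cons computables_Nil)
qed

lemma computable_letter_ok:
  assumes "computable 0 n (\<lambda>e. lv (C e))" "computable 0 n F" "computable 0 n G"
  shows "computable 0 n (\<lambda>e. tv (letter_ok (C e) (F e) (G e)))"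
proof -
  let ?H = "\<lambda>e. tv (letter_ok (vl (e 0)) (e 1) (e 2))"
  have "computable 0 (length [\<lambda>e. lv (C e), F, G]) ?H"
    unfolding letter_ok_def
    by (intro computable_intros computable_nthv computable_witness computable_pair_truth computable_bev
      computable_subtrees; simp)
  from computable_apply[OF this, of 0 n] show ?thesis
    using assms by (simp add: computables_Cons computables_Nil)
qed

lemma computable_first_pos:
  assumes "computable 0 n (\<lambda>e. lv (C e))" "computable 0 n G"
  shows "computable 0 n (\<lambda>e. tv (first_pos (C e) (G e)))"
proof -
  let ?H = "\<lambda>e. tv (first_pos (vl (e 0)) (e 1))"
  have "computable 0 (length [\<lambda>e. lv (C e), G]) ?H"
    unfolding first_pos_def by (intro computable_intros computable_nthv; simp)
  from computable_apply[OF this, of 0 n] show ?thesis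
    using assms by (simp add: computables_Cons computables_Nil)
qed

lemma computable_data_link:
  assumes "computable 0 n G" "computable 0 n H"
  shows "computable 0 n (\<lambda>e. tv (data_link (G e) (H e)))"
proof -
  let ?H = "\<lambda>e. tv (data_link (e 0) (e 1))"
  have "computable 0 (length [G, H]) ?H"
    unfolding data_link_def by (intro computable_intros computable_nthv; simp)
  from computable_apply[OF this, of 0 n] show ?thesis
    using assms by (simp add: computables_Cons computables_Nil)
qed

lemma computable_pos_link:
  assumes "computable 0 n (\<lambda>e. lv (C e))" "computable 0 n G" "computable 0 n H"
  shows "computable 0 n (\<lambda>e. tv (pos_link (C e) (G e) (H e)))"
proof -
  let ?H = "\<lambda>e. tv (pos_link (vl (e 0)) (e 1) (e 2))"
  have "computable 0 (length [\<lambda>e. lv (C e), G, H]) ?H"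
    unfolding pos_link_def by (intro computable_intros computable_nthv computable_data_link; simp)
  from computable_apply[OF this, of 0 n] show ?thesis
    using assms by (simp add: computables_Cons computables_Nil)
qed

text \<open>Height 0, because the exponentially long lists of cores and letters are inputs here: the
  tables are polynomial in them.\<close>

lemma computable_odta_code:
  "computable 0 4 (\<lambda>e. odta_code (e 0) (e 1) (vl (e 2)) (vl (e 3)))"
  unfolding odta_code_def enc_nat.simps(2) last_pos_def first_data_def last_data_def
  by (intro computable_intros computable_nthv computable_pos_link computable_data_link computable_letter_ok
     computable_first_pos computable_nums; simp)

lemma computable_code_letters: "computable 0 2 (\<lambda>e. lv (code_letters (vl (e 0)) (vl (e 1))))"
  unfolding code_letters_def basics_def Let_def
  by (intro computable_intros computable_tuples_Nil computable_tuples_Cons; simp)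

lemma computable_numbered_code_letters:
  "computable 0 2 (\<lambda>e. lv (numbered (code_letters (vl (e 0)) (vl (e 1)))))"
  by (intro computable_numbered computable_code_letters)

lemma computable_cores:
  "computable 1 1 (\<lambda>e. lv (cores (length (vl (left (e 0)))) (right (e 0))))"
proof -
  have "computable 0 1 (\<lambda>e. lv (subtrees (right (e 0))))"
    by (intro computable_subtrees computable_intros; simp)
  from computable_comp1[OF computable_subseqs this]
  have "computable 1 1 (\<lambda>e. lv (map lv (subseqs (subtrees (right (e 0))))))" by simp
  moreover have "computable 0 2 (\<lambda>e. lv (concat (map (\<lambda>a. map (Pair a) (vl (e 1)))
      (map enc_nat (rev [0..<length (vl (e 0))])))))"
    by (intro computable_intros computable_nums; simp)
  moreover have "computable 1 1 (\<lambda>e. left (e 0))"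
    by (intro computable_left computable_var) simp
  ultimately show ?thesis
    unfolding cores_def
    using computable_comp2[where i = 0 and j = 1 and n = 1 and F = "\<lambda>e. left (e 0)"
      and G = "\<lambda>e. lv (map lv (subseqs (subtrees (right (e 0)))))"
      and f = "\<lambda>x y. lv (concat (map (\<lambda>a. map (Pair a) (vl y)) (map enc_nat (rev [0..<length (vl x)]))))"]
    by simp
qed

lemma growth_Suc: "growth j c s \<le> growth (Suc j) c s"
  by (simp add: less_imp_le)

lemma computable_Suc:
  assumes "computable j n F" shows "computable (Suc j) n F"
proof -
  obtain c where c: "\<And>m. \<exists>P x. \<forall>Q. length Q = m \<longrightarrow>
     (\<forall>e. \<exists>t \<le> growth j c (esize n e). eval (Q @ P) (map e [0..<n]) x (F e) t)"
    using assms by (auto simp: computable_def)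
  show ?thesis
  proof (rule computableI)
    show "dominated (Suc j) (growth j c)"
      using growth_Suc by (auto simp: dominated_def simp del: growth.simps)
  qed (rule c)
qed

text \<open>The second subset construction, applied to the result of the first; their heights add up
  to 2.\<close>

lemma computable_counts:
  "computable 2 1 (\<lambda>e. lv (counts (cores (length (vl (left (e 0)))) (right (e 0)))))"
proof -
  have "computable 0 1 (\<lambda>e. lv (concat (map (\<lambda>j. map (Pair j) (vl (e 0))) thresholds)))"
    by (intro computable_intros; simp)
  from computable_comp1[OF this computable_cores]
  have "computable 1 1 (\<lambda>e. lv (concat (map (\<lambda>j. map (Pair j) (cores (length (vl (left (e 0)))) (right (e 0)))) thresholds)))"
    by simp
  from computable_comp1[OF computable_subseqs this]
  show ?thesis by (simp add: counts_def numeral_2_eq_2)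
qed

lemma computable_fo2_odta:
  "computable 2 1 (\<lambda>e. odta_code (left (e 0)) (right (e 0)) (cores (length (vl (left (e 0)))) (right (e 0)))
     (numbered (letter_list (length (vl (left (e 0)))) (right (e 0)))))"
proof -
  let ?C = "\<lambda>e. lv (cores (length (vl (left (e 0)))) (right (e 0)))"
  have C: "computable 2 1 ?C"
    using computable_Suc[OF computable_cores] by (simp add: numeral_2_eq_2)
  have E: "computable 2 1 (\<lambda>e. lv (numbered (letter_list (length (vl (left (e 0)))) (right (e 0)))))"
    using computable_comp2[where f = "\<lambda>x y. lv (numbered (code_letters (vl x) (vl y)))",
      OF computable_numbered_code_letters C computable_counts]
    by (simp add: letter_list_def numeral_2_eq_2)
  have "computable 2 1 (\<lambda>e. left (e 0))" "computable 2 1 (\<lambda>e. right (e 0))"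
    by (intro computable_left computable_right computable_var; simp)+
  then have "computables 2 1 [\<lambda>e. left (e 0), \<lambda>e. right (e 0), ?C,
      \<lambda>e. lv (numbered (letter_list (length (vl (left (e 0)))) (right (e 0))))]"
    using C E by (intro computables_Cons computables_Nil)
  from computable_apply[OF _ this, of 0 "\<lambda>e. odta_code (e 0) (e 1) (vl (e 2)) (vl (e 3))"]
  show ?thesis using computable_odta_code by (simp add: numeral_eq_Suc)
qed

lemma val_size_enc_var: "val_size (enc_var x) \<le> 3"
  by (cases x) auto

text \<open>The factor \<open>2 * k\<close> comes from letters being written in unary while they
  count as one symbol in \<open>fo2_size\<close>.\<close>

lemma val_size_enc_fo2: "letters \<phi> \<subseteq> {..<k} \<Longrightarrow> val_size (enc_fo2 \<phi>) \<le> (30 + 2 * k) * fo2_size \<phi>"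
proof (induction \<phi>)
  case (Lab a x)
  then show ?case using val_size_enc_var[of x] by (simp add: val_size_enc_nat)
next
  case (Eq x y)
  then show ?case using val_size_enc_var[of x] val_size_enc_var[of y] by (simp add: val_size_enc_nat)
next
  case (Succ x y)
  then show ?case using val_size_enc_var[of x] val_size_enc_var[of y] by (simp add: val_size_enc_nat)
next
  case (DSucc x y)
  then show ?case using val_size_enc_var[of x] val_size_enc_var[of y] by (simp add: val_size_enc_nat)
next
  case (Exi x \<phi>)
  then show ?case using val_size_enc_var[of x] by (simp add: val_size_enc_nat)
next
  case (All x \<phi>)
  then show ?case using val_size_enc_var[of x] by (simp add: val_size_enc_nat)
qed (simp_all add: val_size_enc_nat algebra_simps)

lemma fo2_size_pos: "1 \<le> fo2_size \<phi>"
  by (induction \<phi>) auto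

lemma val_size_enc_input:
  assumes "fo2_sentence k \<phi>"
  shows "val_size (enc_input k \<phi>) + 2 \<le> 36 * (k + fo2_size \<phi>) ^ 2"
proof -
  let ?s = "fo2_size \<phi>"
  have "val_size (enc_fo2 \<phi>) \<le> (30 + 2 * k) * ?s"
    using assms by (intro val_size_enc_fo2) (simp add: fo2_sentence_def)
  then have "val_size (enc_input k \<phi>) + 2 \<le> 4 + 2 * k + 30 * ?s + 2 * k * ?s"
    by (simp add: enc_input_def val_size_enc_nat algebra_simps)
  also have "\<dots> \<le> 36 * (k + ?s) * (k + ?s)"
  proof -
    define z where "z = (k + ?s) * (k + ?s)"
    have "1 \<le> ?s" by (rule fo2_size_pos)
    then have "1 \<le> k + ?s" by simp
    then have "(k + ?s) * 1 \<le> z" unfolding z_def by (intro mult_le_mono2)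
    then have 1: "k + ?s \<le> z" by simp
    define y where "y = k * ?s"
    have 2: "y \<le> z" unfolding z_def y_def by (intro mult_le_mono) auto
    have "4 + 2 * k + 30 * ?s + 2 * y \<le> 36 * z" using 1 2 \<open>1 \<le> ?s\<close> by linarith
    then show ?thesis by (simp only: y_def z_def mult.assoc)
  qed
  finally show ?thesis by (simp only: power2_eq_square mult.assoc)
qed

lemma fo2_odta_time:
  obtains P :: program and c :: nat where "\<And>k \<phi>. fo2_sentence k \<phi> \<Longrightarrow>
    \<exists>t. runs P (enc_input k \<phi>) (enc_weak_odta (fo2_odta k (enc_fo2 \<phi>))) t \<and>
      t \<le> 2 ^ (2 ^ (c * (k + fo2_size \<phi>) ^ c))"
proof -
  \<comment> \<open>The offset 1 reserves index 0 for the main function. The compiled expression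
    \<open>x\<close> is then put there itself, as \<open>Q = [x]\<close>; there is no circularity
    since it depends on \<open>Q\<close> through the length only.\<close>
  obtain c P x where P: "\<And>Q e. length Q = 1 \<Longrightarrow> \<exists>t \<le> growth 2 c (esize 1 e).
      eval (Q @ P) (map e [0..<1]) x (odta_code (left (e 0)) (right (e 0)) (cores (length (vl (left (e 0)))) (right (e 0)))
     (numbered (letter_list (length (vl (left (e 0)))) (right (e 0))))) t"
    using computable_fo2_odta unfolding computable_def by metis
  \<comment> \<open>Large enough for both the factor and the exponent of
    \<open>36 ^ c * ?m ^ (2 * c)\<close>.\<close>
  define d where "d = 36 ^ c + 2 * c"
  show ?thesis
  proof (rule that)
    fix k \<phi> assume \<phi>: "fo2_sentence k \<phi>"
    let ?m = "k + fo2_size \<phi>"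
    obtain t where t: "t \<le> growth 2 c (val_size (enc_input k \<phi>))"
        "eval ([x] @ P) [enc_input k \<phi>] x (enc_weak_odta (fo2_odta k (enc_fo2 \<phi>))) t"
      using P[of "[x]" "\<lambda>_. enc_input k \<phi>"]
      by (auto simp: enc_fo2_odta enc_input_def esize_def)
    have "1 \<le> ?m" using fo2_size_pos[of \<phi>] by simp
    have "(val_size (enc_input k \<phi>) + 2) ^ c \<le> (36 * ?m ^ 2) ^ c"
      by (intro power_mono val_size_enc_input \<phi>) simp
    also have "\<dots> = 36 ^ c * ?m ^ (2 * c)"
      by (simp add: power_mult_distrib power_mult)
    also have "\<dots> \<le> d * ?m ^ d"
      using \<open>1 \<le> ?m\<close> by (intro mult_le_mono power_increasing) (auto simp: d_def)
    finally have "growth 2 c (val_size (enc_input k \<phi>)) \<le> 2 ^ (2 ^ (d * ?m ^ d))"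
      by (auto simp: numeral_2_eq_2 intro!: power_increasing)
    with t show "\<exists>t. runs ([x] @ P) (enc_input k \<phi>) (enc_weak_odta (fo2_odta k (enc_fo2 \<phi>))) t \<and>
        t \<le> 2 ^ (2 ^ (d * ?m ^ d))"
      by (auto simp: runs_def)
  qed
qed

section \<open>Runs of local automata on words\<close>

lemma nodes_word_tree: "w \<noteq> [] \<Longrightarrow> nodes (word_tree w) = (\<lambda>i. replicate i 0) ` {..<length w}"
proof (induction w rule: word_tree.induct)
  case (1 p)
  have "is_node (Node p []) u \<longleftrightarrow> u = []" for u by (cases u) auto
  then show ?case by (simp add: nodes_def lessThan_Suc)
next
  case (2 p q w)
  have "is_node (word_tree (p # q # w)) u \<longleftrightarrow> u = [] \<or> u \<in> (#) 0 ` nodes (word_tree (q # w))" for u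
    by (cases u) (auto simp: nodes_def)
  then have "nodes (word_tree (p # q # w)) = insert [] ((#) 0 ` nodes (word_tree (q # w)))"
    by (auto simp: nodes_def)
  also have "\<dots> = (\<lambda>i. replicate i 0) ` {..<length (p # q # w)}"
    using 2 by (simp add: lessThan_Suc_eq_insert_0 image_image del: lessThan_Suc)
  finally show ?case .
qed auto

lemma lab_word_tree: "i < length w \<Longrightarrow> lab (word_tree w) (replicate i 0) = w ! i"
proof (induction w arbitrary: i rule: word_tree.induct)
  case (2 p q w)
  then show ?case by (cases i) (auto simp: lab_def)
qed (auto simp: lab_def)

lemma arity_word_tree:
  "i < length w \<Longrightarrow> arity (word_tree w) (replicate i 0) = (if Suc i < length w then 1 else 0)"
proof (induction w arbitrary: i rule: word_tree.induct)
  case (2 p q w)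
  then show ?case by (cases i) (auto simp: arity_def)
qed (auto simp: arity_def)

lemma map_word_tree: "w \<noteq> [] \<Longrightarrow> map_tree f (word_tree w) = word_tree (map f w)"
  by (induction w rule: word_tree.induct) auto

lemma subtree_map_tree:
  "is_node t u \<Longrightarrow> subtree (map_tree f t) u = map_tree f (subtree t u)"
  by (induction t u rule: is_node.induct) (auto simp: tree.map_sel)

lemma lab_map_tree: "u \<in> nodes t \<Longrightarrow> lab (map_tree f t) u = f (lab t u)"
  by (simp add: lab_def nodes_def subtree_map_tree tree.map_sel)

lemma nodes_map_tree: "nodes (map_tree f t) = nodes t"
proof -
  have "is_node (map_tree f t) u = is_node t u" for u
    by (induction t u rule: is_node.induct) (auto simp: tree.map_sel)
  then show ?thesis by (simp add: nodes_def)
qed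

lemma wf_local_odta: "wf_weak_odta k (local_odta k N F1 R1 L1 out F2 R2 L2)"
  by (auto simp: wf_weak_odta_def local_odta_def wf_transducer_def wf_nfa_def)

context
  fixes k N :: nat and F1 L1 F2 L2 :: "nat \<Rightarrow> bool" and R1 R2 out :: "nat \<Rightarrow> nat \<Rightarrow> bool"
    and A :: weak_odta
  defines "A \<equiv> local_odta k N F1 R1 L1 out F2 R2 L2"
begin

lemma mem_table:
  "((q, a), B) \<in> set (concat (map (\<lambda>q. map (\<lambda>a. ((q, a), c q)) xs) ys)) \<longleftrightarrow>
    q \<in> set ys \<and> a \<in> set xs \<and> B = c q"
  by auto

lemma delta_local:
  "delta (odta_trans A) q a = (if q < N \<and> a < k then nfa_lang
     \<lparr>nfa_states = 2, nfa_init = [0], nfa_trans = map (\<lambda>q'. (0, q', 1)) (filter (R1 q) (rev [0..<N])),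
      nfa_final = (if L1 q then [1, 0] else [1])\<rparr> else {})"
proof -
  have "((q, a), B) \<in> set (tr_delta (odta_trans A)) \<longleftrightarrow> q < N \<and> a < k \<and> B =
     \<lparr>nfa_states = 2, nfa_init = [0], nfa_trans = map (\<lambda>q'. (0, q', 1)) (filter (R1 q) (rev [0..<N])),
      nfa_final = (if L1 q then [1, 0] else [1])\<rparr>" for B
    by (simp only: A_def local_odta_def weak_odta.simps transducer.simps mem_table) simp
  then show ?thesis unfolding delta_def by auto
qed

lemma out_local: "(q, a, b) \<in> set (tr_out (odta_trans A)) \<longleftrightarrow> b = q \<and> q < N \<and> a < k \<and> out q a"
  by (auto simp: A_def local_odta_def)

lemma delta_Nil: "[] \<in> delta (odta_trans A) q a \<longleftrightarrow> q < N \<and> a < k \<and> L1 q"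
  by (auto simp: delta_local nfa_lang_def length_Suc_conv)

lemma delta_single: "[q'] \<in> delta (odta_trans A) q a \<longleftrightarrow> q < N \<and> a < k \<and> q' < N \<and> R1 q q'"
  by (auto simp: delta_local nfa_lang_def length_Suc_conv intro!: exI[of _ "[0, 1]"])

lemma nfa_lang_local:
  "Ss \<in> nfa_lang (odta_aut A) \<longleftrightarrow> (\<exists>rs. Ss = map (\<lambda>q. {q}) rs \<and> rs \<noteq> [] \<and> set rs \<subseteq> {..<N} \<and>
     F2 (rs ! 0) \<and> (\<forall>i. Suc i < length rs \<longrightarrow> R2 (rs ! i) (rs ! Suc i)) \<and> L2 (last rs))"
  (is "?l \<longleftrightarrow> ?r")
proof
  assume ?l
  then obtain qs where qs: "length qs = Suc (length Ss)" "hd qs = N"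
      "\<And>i. i < length Ss \<Longrightarrow> (qs ! i, Ss ! i, qs ! Suc i) \<in> set (nfa_trans (odta_aut A))"
      "last qs < N" "L2 (last qs)"
    by (auto simp: nfa_lang_def A_def local_odta_def)
  obtain rs where rs: "qs = N # rs" using qs(1,2) by (cases qs) auto
  have len: "length rs = length Ss" using qs(1) rs by simp
  \<comment> \<open>No transition enters \<open>N\<close>, so \<open>F2\<close> is tested at the
    first step only and \<open>R2\<close> at all others.\<close>
  have tr: "((N # rs) ! i = N \<and> F2 (rs ! i) \<or> (N # rs) ! i < N \<and> R2 ((N # rs) ! i) (rs ! i))
      \<and> Ss ! i = {rs ! i} \<and> rs ! i < N" if "i < length rs" for i
    using qs(3)[of i] that len unfolding rs by (auto simp: A_def local_odta_def)
  have ne: "rs \<noteq> []" using qs(4) rs by auto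
  show ?r
  proof (intro exI[of _ rs] conjI allI impI)
    show "Ss = map (\<lambda>q. {q}) rs" using tr len by (intro nth_equalityI) auto
    show "set rs \<subseteq> {..<N}" using tr by (auto simp: in_set_conv_nth)
    show "F2 (rs ! 0)" using tr[of 0] ne by auto
    show "L2 (last rs)" using qs(5) rs ne by simp
    fix i assume "Suc i < length rs"
    then show "R2 (rs ! i) (rs ! Suc i)" using tr[of "Suc i"] tr[of i] by auto
  qed (use ne in auto)
next
  assume ?r
  then obtain rs where rs: "Ss = map (\<lambda>q. {q}) rs" "rs \<noteq> []" "set rs \<subseteq> {..<N}" "F2 (rs ! 0)"
     "\<And>i. Suc i < length rs \<Longrightarrow> R2 (rs ! i) (rs ! Suc i)" "L2 (last rs)" by blast
  have mem: "rs ! i < N" if "i < length rs" for i using rs(3) that by (auto simp: subset_iff)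
  have "((N # rs) ! i, {rs ! i}, rs ! i) \<in> set (nfa_trans (odta_aut A))" if "i < length rs" for i
  proof (cases i)
    case 0
    then show ?thesis using rs(4) mem[of 0] that by (auto simp: A_def local_odta_def)
  next
    case (Suc j)
    then show ?thesis using rs(5)[of j] mem[of j] mem[of i] that by (auto simp: A_def local_odta_def)
  qed
  moreover have "last rs < N" using rs(2,3) by (auto simp: subset_iff)
  ultimately show ?l
    unfolding nfa_lang_def mem_Collect_eq
  proof (intro exI[of _ "N # rs"] conjI allI impI)
    show "hd (N # rs) \<in> set (nfa_init (odta_aut A))" by (simp add: A_def local_odta_def)
    show "last (N # rs) \<in> set (nfa_final (odta_aut A))"
      using \<open>last rs < N\<close> rs(2,6) by (simp add: A_def local_odta_def)
  qed (use rs(1) in auto)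
qed

text \<open>Acceptance with the trees removed: \<open>qs\<close> labels the positions and
  \<open>ps\<close> enumerates them by strictly increasing data values. Existence of such lists is
  shown to be equivalent to acceptance.\<close>

definition local_run :: "data_word \<Rightarrow> nat list \<Rightarrow> nat list \<Rightarrow> bool" where
  "local_run w qs ps \<longleftrightarrow> length qs = length w \<and>
     (\<forall>i < length w. qs ! i < N \<and> fst (w ! i) < k \<and> out (qs ! i) (fst (w ! i))) \<and>
     F1 (qs ! 0) \<and> (\<forall>i. Suc i < length w \<longrightarrow> R1 (qs ! i) (qs ! Suc i)) \<and> L1 (qs ! (length w - 1)) \<and>
     length ps = length w \<and> set ps = {..<length w} \<and> sorted_wrt (<) (map (\<lambda>i. snd (w ! i)) ps) \<and>
     F2 (qs ! (ps ! 0)) \<and> (\<forall>i. Suc i < length w \<longrightarrow> R2 (qs ! (ps ! i)) (qs ! (ps ! Suc i))) \<and>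
     L2 (qs ! (ps ! (length w - 1)))"

lemma V_string_word:
  assumes "nodes t = (\<lambda>i. replicate i 0) ` {..<length w}"
    and "\<And>i. i < length w \<Longrightarrow> lab t (replicate i 0) = (qs ! i, snd (w ! i))"
  shows "V_string {..<M} t =
    map (\<lambda>d. {a. a < M \<and> (\<exists>i < length w. snd (w ! i) = d \<and> qs ! i = a)}) (sorted_list_of_set (snd ` set w))"
proof -
  have "data_values t = snd ` set w"
  proof -
    have "data_values t = (\<lambda>u. snd (lab t u)) ` nodes t" by (auto simp: data_values_def)
    also have "\<dots> = (\<lambda>i. snd (w ! i)) ` {..<length w}"
      unfolding assms(1) image_image using assms(2) by (intro image_cong) auto
    also have "\<dots> = snd ` (!) w ` {..<length w}" by (simp only: image_image)
    also have "(!) w ` {..<length w} = set w" by (auto simp: set_conv_nth)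
    finally show ?thesis .
  qed
  moreover have "d \<in> V t a \<longleftrightarrow> (\<exists>i < length w. snd (w ! i) = d \<and> qs ! i = a)" for d a
  proof -
    have "d \<in> V t a \<longleftrightarrow> (\<exists>u \<in> nodes t. d = snd (lab t u) \<and> fst (lab t u) = a)" by (auto simp: V_def)
    also have "\<dots> \<longleftrightarrow> (\<exists>i \<in> {..<length w}. d = snd (lab t (replicate i 0)) \<and> fst (lab t (replicate i 0)) = a)"
      unfolding assms(1) by blast
    also have "\<dots> \<longleftrightarrow> (\<exists>i \<in> {..<length w}. d = snd (w ! i) \<and> qs ! i = a)"
      using assms(2) by (intro bex_cong) auto
    finally show ?thesis by auto
  qed
  ultimately show ?thesis by (simp add: V_string_eq)
qed

lemma accepts_imp_local_run:
  assumes "w \<noteq> []" "odta_accepts A (word_tree w)"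
  shows "\<exists>qs ps. local_run w qs ps"
proof -
  let ?n = "length w" and ?T = "odta_trans A"
  obtain t' where t': "output_on ?T (word_tree (map fst w)) (map_tree fst t')"
      "\<And>u. u \<in> nodes (word_tree w) \<Longrightarrow> snd (lab t' u) = snd (lab (word_tree w) u)"
      "V_string {..<N} t' \<in> nfa_lang (odta_aut A)"
      "\<And>a. a < N \<Longrightarrow> inj_on (\<lambda>u. snd (lab t' u)) {u \<in> nodes t'. fst (lab t' u) = a}"
    using assms by (auto simp: odta_accepts_def proj_tree_def map_word_tree A_def local_odta_def)
  have nodes: "nodes t' = (\<lambda>i. replicate i 0) ` {..<?n}"
    using t'(1) assms(1) by (simp add: output_on_def nodes_map_tree nodes_word_tree)
  obtain \<rho> where \<rho>: "accepting_run ?T (word_tree (map fst w)) \<rho>"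
     "\<And>u. u \<in> nodes t' \<Longrightarrow> (\<rho> u, lab (word_tree (map fst w)) u, fst (lab t' u)) \<in> set (tr_out ?T)"
    using t'(1) assms(1) by (auto simp: output_on_def nodes_map_tree lab_map_tree)
  define qs where "qs = map (\<lambda>i. fst (lab t' (replicate i 0))) [0..<?n]"
  have len: "length qs = ?n" by (simp add: qs_def)
  have node: "replicate i 0 \<in> nodes t'" if "i < ?n" for i using that nodes by auto
  have qs: "\<rho> (replicate i 0) = qs ! i \<and> qs ! i < N \<and> fst (w ! i) < k \<and> out (qs ! i) (fst (w ! i))"
    if "i < ?n" for i
    using \<rho>(2)[OF node[OF that]] that
    by (auto simp: lab_word_tree qs_def A_def local_odta_def)
  have run: "map (\<lambda>j. \<rho> (replicate i 0 @ [j])) [0..<arity (word_tree (map fst w)) (replicate i 0)]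
      \<in> delta ?T (qs ! i) (fst (w ! i))" if "i < ?n" for i
  proof -
    have "replicate i 0 \<in> nodes (word_tree (map fst w))" using that assms(1) by (simp add: nodes_word_tree)
    then have "map (\<lambda>j. \<rho> (replicate i 0 @ [j])) [0..<arity (word_tree (map fst w)) (replicate i 0)]
      \<in> delta ?T (\<rho> (replicate i 0)) (lab (word_tree (map fst w)) (replicate i 0))"
      using \<rho>(1) unfolding accepting_run_def by blast
    then show ?thesis using qs[OF that] that by (simp only: lab_word_tree length_map nth_map)
  qed
  have R1: "R1 (qs ! i) (qs ! Suc i)" if "Suc i < ?n" for i
    using run[of i] that qs[of "Suc i"]
    by (simp add: arity_word_tree delta_single replicate_append_same)
  have L1: "L1 (qs ! (?n - 1))"
    using run[of "?n - 1"] assms(1) by (simp add: arity_word_tree delta_Nil)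
  have F1: "F1 (qs ! 0)"
    using \<rho>(1) qs[of 0] assms(1) by (auto simp: accepting_run_def A_def local_odta_def)
  have lab: "lab t' (replicate i 0) = (qs ! i, snd (w ! i))" if "i < ?n" for i
    using t'(2)[of "replicate i 0"] that assms(1)
    by (auto simp: nodes_word_tree lab_word_tree qs_def prod_eq_iff)
  define ds where "ds = sorted_list_of_set (snd ` set w)"
  have ds: "set ds = snd ` set w" "sorted_wrt (<) ds"
    by (auto simp: ds_def)
  have "V_string {..<N} t' = map (\<lambda>d. {a. a < N \<and> (\<exists>i < ?n. snd (w ! i) = d \<and> qs ! i = a)}) ds"
    unfolding ds_def by (rule V_string_word[OF nodes lab])
  with t'(3) have "map (\<lambda>d. {a. a < N \<and> (\<exists>i < ?n. snd (w ! i) = d \<and> qs ! i = a)}) ds \<in> nfa_lang (odta_aut A)"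
    by (simp only:)
  then obtain rs where rs: "map (\<lambda>d. {a. a < N \<and> (\<exists>i < ?n. snd (w ! i) = d \<and> qs ! i = a)}) ds = map (\<lambda>q. {q}) rs"
     "rs \<noteq> []" "F2 (rs ! 0)" "\<forall>i. Suc i < length rs \<longrightarrow> R2 (rs ! i) (rs ! Suc i)" "L2 (last rs)"
    unfolding nfa_lang_local by (elim exE conjE) (rule that)
  have rs_len: "length rs = length ds" using arg_cong[OF rs(1), of length] by simp
  have rs_nth: "{a. a < N \<and> (\<exists>i < ?n. snd (w ! i) = ds ! j \<and> qs ! i = a)} = {rs ! j}" if "j < length ds" for j
    using arg_cong[OF rs(1), of "\<lambda>xs. xs ! j"] that rs_len by simp
  \<comment> \<open>A data value is read as a singleton, so two positions sharing it carry the same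
    letter; that letter is a key, so the positions are equal.\<close>
  have inj: "i = i'" if "i < ?n" "i' < ?n" "snd (w ! i) = snd (w ! i')" for i i'
  proof -
    have "snd (w ! i) \<in> set ds" using that ds by simp
    then obtain j where j: "j < length ds" "ds ! j = snd (w ! i)" by (auto simp: in_set_conv_nth)
    have "qs ! i \<in> {rs ! j}" "qs ! i' \<in> {rs ! j}"
      unfolding rs_nth[OF j(1), symmetric] using that qs j(2) by auto
    then have "qs ! i = qs ! i'" by simp
    have "replicate i (0::nat) = replicate i' 0"
    proof (rule inj_onD[OF t'(4)[of "qs ! i"]])
      show "replicate i 0 \<in> {u \<in> nodes t'. fst (lab t' u) = qs ! i}"
        using that(1) lab node by simp
      show "replicate i' 0 \<in> {u \<in> nodes t'. fst (lab t' u) = qs ! i}"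
        using that(2) lab node \<open>qs ! i = qs ! i'\<close> by simp
    qed (use that lab qs in auto)
    then show ?thesis by (metis length_replicate)
  qed
  have "\<exists>i < ?n. snd (w ! i) = d" if "d \<in> set ds" for d
    using that unfolding ds(1) by (auto simp: in_set_conv_nth) (metis snd_conv)
  then obtain pos where pos: "\<And>d. d \<in> set ds \<Longrightarrow> pos d < ?n \<and> snd (w ! pos d) = d" by metis
  define ps where "ps = map pos ds"
  have ps_data: "map (\<lambda>i. snd (w ! i)) ps = ds"
    using pos by (auto simp: ps_def intro!: map_idI)
  have "distinct (map snd w)"
    using inj by (auto simp: distinct_conv_nth)
  then have "card (snd ` set w) = ?n"
    by (metis distinct_card length_map set_map)
  then have len_ps: "length ps = ?n" by (simp add: ps_def ds_def)
  have ps_set: "set ps = {..<?n}"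
  proof
    show "set ps \<subseteq> {..<?n}" using pos by (auto simp: ps_def)
    show "{..<?n} \<subseteq> set ps"
    proof
      fix i assume "i \<in> {..<?n}"
      then have "snd (w ! i) \<in> set ds" "i < ?n" using ds by auto
      then have "pos (snd (w ! i)) = i" using inj pos by metis
      with \<open>snd (w ! i) \<in> set ds\<close> show "i \<in> set ps" by (force simp: ps_def)
    qed
  qed
  have rs_ps: "rs ! j = qs ! (ps ! j)" if "j < ?n" for j
  proof -
    have j: "j < length ds" using that len_ps by (simp add: ps_def)
    have "qs ! (ps ! j) \<in> {rs ! j}"
      unfolding rs_nth[OF j, symmetric] using pos[of "ds ! j"] j qs by (auto simp: ps_def)
    then show ?thesis by simp
  qed
  have "length rs = ?n" using rs_len len_ps by (simp add: ps_def)
  moreover from this have "last rs = qs ! (ps ! (?n - 1))"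
    using rs(2) rs_ps[of "?n - 1"] assms(1) by (simp add: last_conv_nth)
  ultimately have "local_run w qs ps"
    unfolding local_run_def
    using len qs R1 L1 F1 len_ps ps_set ps_data ds(2) rs(3,4,5) rs_ps assms(1)
    by (auto simp: Suc_lessD)
  then show ?thesis by blast
qed

lemma local_run_imp_accepts:
  assumes "w \<noteq> []" "local_run w qs ps"
  shows "odta_accepts A (word_tree w)"
proof -
  let ?n = "length w" and ?T = "odta_trans A"
  define t' where "t' = word_tree (zip qs (map snd w))"
  have qs: "length qs = ?n" "\<And>i. i < ?n \<Longrightarrow> qs ! i < N \<and> fst (w ! i) < k \<and> out (qs ! i) (fst (w ! i))"
    "F1 (qs ! 0)" "\<And>i. Suc i < ?n \<Longrightarrow> R1 (qs ! i) (qs ! Suc i)" "L1 (qs ! (?n - 1))"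
    and ps: "length ps = ?n" "set ps = {..<?n}" "sorted_wrt (<) (map (\<lambda>i. snd (w ! i)) ps)"
     "F2 (qs ! (ps ! 0))" "\<And>i. Suc i < ?n \<Longrightarrow> R2 (qs ! (ps ! i)) (qs ! (ps ! Suc i))"
     "L2 (qs ! (ps ! (?n - 1)))"
    using assms(2) unfolding local_run_def by blast+
  have ne: "zip qs (map snd w) \<noteq> []" "map fst w \<noteq> []" using qs(1) assms(1) by (cases w; cases qs; auto)+
  have nodes: "nodes t' = (\<lambda>i. replicate i 0) ` {..<?n}"
    using ne qs(1) by (simp add: t'_def nodes_word_tree)
  have lab: "lab t' (replicate i 0) = (qs ! i, snd (w ! i))" if "i < ?n" for i
    using that qs(1) by (simp add: t'_def lab_word_tree)
  have inj: "i = i'" if "i < ?n" "i' < ?n" "snd (w ! i) = snd (w ! i')" for i i'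
  proof -
    have "i \<in> set ps" "i' \<in> set ps" using that ps(2) by auto
    then obtain j j' where "i = ps ! j" "i' = ps ! j'" "j < ?n" "j' < ?n"
      unfolding in_set_conv_nth ps(1) by auto
    then show ?thesis
      using that ps(1) sorted_wrt_nth_less[OF ps(3), of j j'] sorted_wrt_nth_less[OF ps(3), of j' j]
      by (cases j j' rule: linorder_cases) auto
  qed
  define \<rho> where "\<rho> u = qs ! length u" for u :: "nat list"
  have "accepting_run ?T (word_tree (map fst w)) \<rho>"
    unfolding accepting_run_def
  proof (intro conjI ballI)
    show "\<rho> [] \<in> set (tr_final ?T)"
      using qs(2)[of 0] qs(3) assms(1) by (simp add: \<rho>_def A_def local_odta_def)
    fix u assume "u \<in> nodes (word_tree (map fst w))"
    then obtain i where i: "u = replicate i 0" "i < ?n" using ne by (auto simp: nodes_word_tree)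
    show "\<rho> u < tr_states ?T" using qs(2) i by (simp add: \<rho>_def A_def local_odta_def)
    have "\<not> Suc i < ?n \<Longrightarrow> i = ?n - 1" using i(2) by simp
    then show "map (\<lambda>i. \<rho> (u @ [i])) [0..<arity (word_tree (map fst w)) u]
        \<in> delta ?T (\<rho> u) (lab (word_tree (map fst w)) u)"
      using qs(2)[of i] qs(2)[of "Suc i"] qs(4)[of i] qs(5) i
      by (auto simp: \<rho>_def arity_word_tree lab_word_tree delta_single delta_Nil)
  qed
  moreover have "(\<rho> u, lab (word_tree (map fst w)) u, lab (map_tree fst t') u) \<in> set (tr_out ?T)"
    if "u \<in> nodes t'" for u
    using that qs(2) lab unfolding nodes
    by (auto simp: \<rho>_def lab_word_tree lab_map_tree nodes out_local)
  ultimately have 1: "output_on ?T (proj_tree (word_tree w)) (proj_tree t')"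
    using assms(1) ne nodes
    by (auto simp: output_on_def proj_tree_def map_word_tree nodes_map_tree nodes_word_tree)
  have 2: "snd (lab t' u) = snd (lab (word_tree w) u)" if "u \<in> nodes (word_tree w)" for u
    using that assms(1) lab by (auto simp: nodes_word_tree lab_word_tree)
  let ?ds = "map (\<lambda>i. snd (w ! i)) ps"
  have "(!) w ` set ps = set w" unfolding ps(2) by (auto simp: set_conv_nth)
  then have "snd ` set w = snd ` (!) w ` set ps" by simp
  then have "snd ` set w = set ?ds" by (simp only: set_map image_image)
  moreover have "sorted ?ds" "distinct ?ds"
    using ps(3) by (auto simp: strict_sorted_iff)
  ultimately have "sorted_list_of_set (snd ` set w) = ?ds"
    by (metis sorted_list_of_set.idem_if_sorted_distinct)
  then have "V_string {..<N} t' =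
      map (\<lambda>p. {a. a < N \<and> (\<exists>i < ?n. snd (w ! i) = snd (w ! p) \<and> qs ! i = a)}) ps"
    using V_string_word[OF nodes, of qs N] lab by simp
  also have "\<dots> = map (\<lambda>p. {qs ! p}) ps"
    using inj ps(2) qs(2) by (intro map_cong) auto
  finally have V: "V_string {..<N} t' = map (\<lambda>q. {q}) (map ((!) qs) ps)"
    by simp
  have psn: "ps \<noteq> []" using ps(1) assms(1) by auto
  have "V_string {..<N} t' \<in> nfa_lang (odta_aut A)"
    unfolding nfa_lang_local V
    using ps psn qs(2) assms(1)
    by (intro exI[of _ "map ((!) qs) ps"]) (auto simp: last_conv_nth)
  then have 3: "V_string {..<odta_letters A} t' \<in> nfa_lang (odta_aut A)"
    by (simp add: A_def local_odta_def)
  have 4: "inj_on (\<lambda>u. snd (lab t' u)) {u \<in> nodes t'. fst (lab t' u) = a}" for a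
    using inj lab unfolding inj_on_def nodes by auto
  show ?thesis unfolding odta_accepts_def using 1 2 3 4 by blast
qed

end

section \<open>Evaluation of formulas from local records\<close>

lemma enc_nat_eq_Leaf [simp]: "enc_nat m = Leaf \<longleftrightarrow> m = 0"
  by (cases m) auto

lemma Leaf_eq_enc_nat [simp]: "Leaf = enc_nat m \<longleftrightarrow> m = 0"
  by (cases m) auto

lemma subtrees_refl: "t \<in> set (subtrees t)"
  by (cases t) auto

lemma subtrees_trans: "u \<in> set (subtrees t) \<Longrightarrow> set (subtrees u) \<subseteq> set (subtrees t)"
  by (induction t) auto

lemma left_in_subtrees: "left t \<in> set (subtrees t)"
  by (cases t) (auto simp: subtrees_refl)

lemma right_in_subtrees: "right t \<in> set (subtrees t)"
  by (cases t) (auto simp: subtrees_refl)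

definition dec_var :: "val \<Rightarrow> var" where
  "dec_var v = (if v = Leaf then VX else VY)"

text \<open>Every value is read as a formula, since the automaton treats all subtrees of the code alike.\<close>

function dec :: "val \<Rightarrow> fo2" where
  "dec Leaf = Lab 0 VX"
| "dec (Pair t b) =
    (if t = enc_nat 0 then Lab (length (vl (left b))) (dec_var (right b))
     else if t = enc_nat 1 then Eq (dec_var (left b)) (dec_var (right b))
     else if t = enc_nat 2 then Succ (dec_var (left b)) (dec_var (right b))
     else if t = enc_nat 3 then DSucc (dec_var (left b)) (dec_var (right b))
     else if t = enc_nat 4 then Neg (dec b)
     else if t = enc_nat 5 then And (dec (left b)) (dec (right b))
     else if t = enc_nat 6 then Or (dec (left b)) (dec (right b))
     else if t = enc_nat 7 then Exi (dec_var (left b)) (dec (right b))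
     else if t = enc_nat 8 then All (dec_var (left b)) (dec (right b))
     else Neg (Eq VX VX))"
  by pat_completeness auto
termination
proof (relation "measure val_size")
qed (auto simp: less_Suc_eq_le val_size_left val_size_right intro: trans_le_add2)

lemma dec_var_enc_var [simp]: "dec_var (enc_var x) = x"
  by (cases x) (auto simp: dec_var_def)

lemma dec_enc_fo2: "dec (enc_fo2 \<phi>) = \<phi>"
  by (induction \<phi>) (simp_all del: enc_nat.simps)

text \<open>The data values of a text have no gaps.\<close>

lemma data_succ_text:
  assumes "text_word k w" "x < length w" "y < length w"
  shows "data_succ w (snd (w ! x)) (snd (w ! y)) \<longleftrightarrow> snd (w ! y) = Suc (snd (w ! x))"
proof -
  have set: "snd ` set w = {1..length w}" using assms(1) by (simp add: text_word_def)
  have "snd (w ! y) \<in> snd ` set w" using assms(3) by simp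
  then have "Suc (snd (w ! x)) \<in> snd ` set w" if "snd (w ! x) < snd (w ! y)"
    using that unfolding set by simp
  then show ?thesis by (fastforce simp: data_succ_def)
qed

text \<open>A text with an arbitrary labelling \<open>g\<close>. It is interpreted with the
  rearranged word for soundness and with the given text for completeness.\<close>

locale faithful =
  fixes k :: nat and w :: data_word and C :: "val list" and g :: "nat \<Rightarrow> val"
  assumes is_text: "text_word k w"
begin

abbreviation "n \<equiv> length w"

definition D :: "nat \<Rightarrow> nat \<Rightarrow> bool" where
  "D x y \<longleftrightarrow> x < n \<and> y < n \<and> snd (w ! y) = Suc (snd (w ! x))"

lemma data_inj: "x < n \<Longrightarrow> y < n \<Longrightarrow> snd (w ! x) = snd (w ! y) \<Longrightarrow> x = y"
  using is_text by (auto simp: text_word_def distinct_conv_nth)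

lemma D_fun: "D x y \<Longrightarrow> D x z \<Longrightarrow> y = z"
  by (auto simp: D_def intro: data_inj)

lemma D_inj: "D x z \<Longrightarrow> D y z \<Longrightarrow> x = y"
  by (auto simp: D_def intro: data_inj)

lemma D_asym: "D x y \<Longrightarrow> \<not> D y x"
  by (auto simp: D_def)

lemma D_irrefl: "\<not> D x x"
  by (auto simp: D_def)

definition pos_rel :: "nat \<Rightarrow> nat \<Rightarrow> nat" where
  "pos_rel x y = (if y = x then 3 else if y = Suc x then 1 else if x = Suc y then 2 else 0)"

definition data_rel :: "nat \<Rightarrow> nat \<Rightarrow> nat" where
  "data_rel x y = (if D x y then 1 else if D y x then 2 else 0)"

text \<open>The guesses of the letter at \<open>x\<close> are true of \<open>w\<close>. This is all
  that the evaluation of formulas needs to know about the labelling.\<close>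

definition records :: "nat \<Rightarrow> bool" where
  "records x \<longleftrightarrow>
     core (g x) \<in> set C \<and> left (core (g x)) = enc_nat (fst (w ! x)) \<and>
     next_pos (g x) = (if Suc x < n then Pair (core (g (Suc x))) Leaf else Leaf) \<and>
     prev_pos (g x) = (if 0 < x then Pair (core (g (x - 1))) Leaf else Leaf) \<and>
     (\<forall>y. D x y \<longrightarrow> next_data (g x) = Pair (core (g y)) Leaf) \<and>
     ((\<forall>y. \<not> D x y) \<longrightarrow> next_data (g x) = Leaf) \<and>
     (\<forall>y. D y x \<longrightarrow> prev_data (g x) = Pair (core (g y)) Leaf) \<and>
     ((\<forall>y. \<not> D y x) \<longrightarrow> prev_data (g x) = Leaf) \<and>
     next_claim (g x) = (if D x (Suc x) then enc_nat 1 else if 0 < x \<and> D x (x - 1) then enc_nat 2 else enc_nat 0) \<and>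
     prev_claim (g x) = (if D (Suc x) x then enc_nat 1 else if 0 < x \<and> D (x - 1) x then enc_nat 2 else enc_nat 0) \<and>
     (\<forall>c\<in>set C. \<forall>j<6. Pair (enc_nat j) c \<in> set (vl (total_counts (g x))) \<longleftrightarrow> j < card {y. y < n \<and> core (g y) = c})"

definition slot :: "nat \<Rightarrow> nat \<Rightarrow> val" where
  "slot x y = Pair (enc_nat (pos_rel x y)) (Pair (enc_nat (data_rel x y)) (core (g y)))"

text \<open>A data neighbour that is also a word neighbour must be listed once only; this is what
  the claims are for. The resulting distinctness makes counting over the slots the same as counting
  positions.\<close>

lemma slots_conv:
  assumes x: "x < n" and r: "records x"
  shows "\<exists>ys. slots (g x) = map (slot x) ys \<and> distinct ys \<and> set ys \<subseteq> {..<n} \<and> length ys \<le> 5 \<and>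
    (\<forall>y<n. y \<notin> set ys \<longrightarrow> pos_rel x y = 0 \<and> data_rel x y = 0)"
proof -
  define y1 where "y1 = (if Suc x < n then [Suc x] else [])"
  define y2 where "y2 = (if 0 < x then [x - 1] else [])"
  define y3 where "y3 = (if (\<exists>y. D x y) \<and> \<not> D x (Suc x) \<and> \<not> (0 < x \<and> D x (x - 1)) then [THE y. D x y] else [])"
  define y4 where "y4 = (if (\<exists>y. D y x) \<and> \<not> D (Suc x) x \<and> \<not> (0 < x \<and> D (x - 1) x) then [THE y. D y x] else [])"
  have the3: "(THE y. D x y) = y" if "D x y" for y using that D_fun by blast
  have the4: "(THE y. D y x) = y" if "D y x" for y using that D_inj by blast
  have nc: "next_claim (g x) = (if D x (Suc x) then enc_nat 1 else if 0 < x \<and> D x (x - 1) then enc_nat 2 else enc_nat 0)"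
    and pc: "prev_claim (g x) = (if D (Suc x) x then enc_nat 1 else if 0 < x \<and> D (x - 1) x then enc_nat 2 else enc_nat 0)"
    and np: "next_pos (g x) = (if Suc x < n then Pair (core (g (Suc x))) Leaf else Leaf)"
    and pp: "prev_pos (g x) = (if 0 < x then Pair (core (g (x - 1))) Leaf else Leaf)"
    and nd: "\<And>y. D x y \<Longrightarrow> next_data (g x) = Pair (core (g y)) Leaf" "(\<And>y. \<not> D x y) \<Longrightarrow> next_data (g x) = Leaf"
    and pd: "\<And>y. D y x \<Longrightarrow> prev_data (g x) = Pair (core (g y)) Leaf" "(\<And>y. \<not> D y x) \<Longrightarrow> prev_data (g x) = Leaf"
    using r unfolding records_def by blast+
  have cr1: "claim_rel 1 (g x) = enc_nat (data_rel x (Suc x))"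
    unfolding claim_rel_def nc pc data_rel_def using D_asym[of x "Suc x"] by (simp del: enc_nat.simps)
  have cr2: "claim_rel 2 (g x) = enc_nat (data_rel x (x - 1))" if "0 < x"
  proof -
    have "\<not> (D x (Suc x) \<and> D x (x - 1))" "\<not> (D (Suc x) x \<and> D (x - 1) x)"
      using D_fun[of x "Suc x" "x - 1"] D_inj[of "Suc x" x "x - 1"] by auto
    then show ?thesis
      unfolding claim_rel_def nc pc data_rel_def using D_asym[of x "x - 1"] that by (auto simp del: enc_nat.simps)
  qed
  have "slots (g x) = map (slot x) ([x] @ y1 @ y2 @ y3 @ y4)"
  proof -
    have 0: "Pair (enc_nat 3) (Pair (enc_nat 0) (core (g x))) = slot x x"
      by (simp add: slot_def pos_rel_def data_rel_def D_irrefl)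
    have 1: "(if next_pos (g x) = Leaf then [] else [Pair (enc_nat 1) (Pair (claim_rel 1 (g x)) (left (next_pos (g x))))])
        = map (slot x) y1"
      unfolding np cr1 by (simp add: y1_def slot_def pos_rel_def)
    have 2: "(if prev_pos (g x) = Leaf then [] else [Pair (enc_nat 2) (Pair (claim_rel 2 (g x)) (left (prev_pos (g x))))])
        = map (slot x) y2"
      unfolding pp by (auto simp: y2_def slot_def pos_rel_def cr2)
    have 3: "(if next_data (g x) \<noteq> Leaf \<and> next_claim (g x) = enc_nat 0
        then [Pair (enc_nat 0) (Pair (enc_nat 1) (left (next_data (g x))))] else []) = map (slot x) y3"
    proof (cases "\<exists>y. D x y")
      case True
      then obtain y where y: "D x y" by blast
      have "x \<noteq> y" using y D_irrefl by auto
      then show ?thesis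
        unfolding nc nd(1)[OF y] y3_def using y the3[OF y]
        by (auto simp: slot_def pos_rel_def data_rel_def)
    next
      case False
      then show ?thesis using nd(2) by (simp add: y3_def)
    qed
    have 4: "(if prev_data (g x) \<noteq> Leaf \<and> prev_claim (g x) = enc_nat 0
        then [Pair (enc_nat 0) (Pair (enc_nat 2) (left (prev_data (g x))))] else []) = map (slot x) y4"
    proof (cases "\<exists>y. D y x")
      case True
      then obtain y where y: "D y x" by blast
      have "x \<noteq> y" using y D_irrefl by auto
      then show ?thesis
        unfolding pc pd(1)[OF y] y4_def using y the4[OF y] D_asym[OF y]
        by (auto simp: slot_def pos_rel_def data_rel_def)
    next
      case False
      then show ?thesis using pd(2) by (simp add: y4_def)
    qed
    show ?thesis unfolding slots_def 0 1 2 3 4 by simp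
  qed
  moreover
    have m1: "y = Suc x \<and> Suc x < n" if "y \<in> set y1" for y using that unfolding y1_def by (cases "Suc x < n") simp_all
    have m2: "Suc y = x" if "y \<in> set y2" for y using that unfolding y2_def by (cases x) simp_all
    have m3: "D x y \<and> y \<noteq> Suc x \<and> Suc y \<noteq> x \<and> x \<noteq> y" if y: "y \<in> set y3" for y
    proof -
      have *: "\<exists>y. D x y" "\<not> D x (Suc x)" "\<not> (0 < x \<and> D x (x - 1))" "y = (THE y. D x y)"
      proof -
        have "(\<exists>y. D x y) \<and> \<not> D x (Suc x) \<and> \<not> (0 < x \<and> D x (x - 1))"
          by (rule ccontr) (use y in \<open>simp only: y3_def if_False list.set empty_iff\<close>)
        moreover from this have "y3 = [THE y. D x y]" unfolding y3_def by (rule if_P)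
        ultimately show "\<exists>y. D x y" "\<not> D x (Suc x)" "\<not> (0 < x \<and> D x (x - 1))" "y = (THE y. D x y)"
          using y by (blast, blast, blast, simp)
      qed
      then have "D x y" using the3 by blast
      moreover have "Suc y \<noteq> x" using *(3) \<open>D x y\<close> by auto
      ultimately show ?thesis using *(2) D_irrefl by blast
    qed
    have m4: "D y x \<and> y \<noteq> Suc x \<and> Suc y \<noteq> x \<and> x \<noteq> y" if y: "y \<in> set y4" for y
    proof -
      have *: "\<exists>y. D y x" "\<not> D (Suc x) x" "\<not> (0 < x \<and> D (x - 1) x)" "y = (THE y. D y x)"
      proof -
        have "(\<exists>y. D y x) \<and> \<not> D (Suc x) x \<and> \<not> (0 < x \<and> D (x - 1) x)"
          by (rule ccontr) (use y in \<open>simp only: y4_def if_False list.set empty_iff\<close>)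
        moreover from this have "y4 = [THE y. D y x]" unfolding y4_def by (rule if_P)
        ultimately show "\<exists>y. D y x" "\<not> D (Suc x) x" "\<not> (0 < x \<and> D (x - 1) x)" "y = (THE y. D y x)"
          using y by (blast, blast, blast, simp)
      qed
      then have "D y x" using the4 by blast
      moreover have "Suc y \<noteq> x" using *(3) \<open>D y x\<close> by auto
      ultimately show ?thesis using *(2) D_irrefl by blast
    qed
  moreover have "distinct ([x] @ y1 @ y2 @ y3 @ y4)"
  proof -
    have "x \<notin> set y1" "x \<notin> set y2" "x \<notin> set y3" "x \<notin> set y4"
      using m1[of x] m2[of x] m3[of x] m4[of x] by auto
    moreover have "set y1 \<inter> set y2 = {}"
      by (rule equals0I) (auto dest!: m1 m2)
    moreover have "set y1 \<inter> set y3 = {}" "set y1 \<inter> set y4 = {}"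
      using m1 m3 m4 by (meson IntE equals0I)+
    moreover have "set y2 \<inter> set y3 = {}" "set y2 \<inter> set y4 = {}"
      using m2 m3 m4 by (meson IntE equals0I)+
    moreover have "set y3 \<inter> set y4 = {}"
      using m3 m4 D_asym by (meson IntE equals0I)
    moreover have "distinct y1" "distinct y2" "distinct y3" "distinct y4"
      by (simp_all add: y1_def y2_def y3_def y4_def)
    ultimately show ?thesis by (simp add: Int_Un_distrib)
  qed
  moreover have "set ([x] @ y1 @ y2 @ y3 @ y4) \<subseteq> {..<n}"
  proof
    fix y assume "y \<in> set ([x] @ y1 @ y2 @ y3 @ y4)"
    then consider "y = x" | "y \<in> set y1" | "y \<in> set y2" | "y \<in> set y3" | "y \<in> set y4" by auto
    then show "y \<in> {..<n}"
      by cases (use x in \<open>auto simp: D_def dest: m1 m2 m3 m4\<close>)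
  qed
  moreover have "length ([x] @ y1 @ y2 @ y3 @ y4) \<le> 5"
    by (auto simp: y1_def y2_def y3_def y4_def)
  moreover have "pos_rel x y = 0 \<and> data_rel x y = 0" if "y < n" "y \<notin> set ([x] @ y1 @ y2 @ y3 @ y4)" for y
  proof -
    have 1: "y \<noteq> x" "y \<noteq> Suc x" "x \<noteq> Suc y"
      using that by (cases x; cases "Suc x < n"; simp add: y1_def y2_def; linarith)+
    moreover have "\<not> D x y"
    proof
      assume D: "D x y"
      have "\<not> D x (Suc x)" "\<not> (0 < x \<and> D x (x - 1))"
        using 1 D_fun[OF D, of "Suc x"] D_fun[OF D, of "x - 1"] by auto
      with D have "y3 = [THE y. D x y]" unfolding y3_def by (intro if_P) blast
      then have "y \<in> set y3" unfolding the3[OF D] by (simp only: list.set insertI1)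
      then show False using that(2) by simp
    qed
    moreover have "\<not> D y x"
    proof
      assume D: "D y x"
      have "\<not> D (Suc x) x" "\<not> (0 < x \<and> D (x - 1) x)"
        using 1 D_inj[OF D, of "Suc x"] D_inj[OF D, of "x - 1"] by auto
      with D have "y4 = [THE y. D y x]" unfolding y4_def by (intro if_P) blast
      then have "y \<in> set y4" unfolding the4[OF D] by (simp only: list.set insertI1)
      then show False using that(2) by simp
    qed
    ultimately show ?thesis by (simp add: pos_rel_def data_rel_def)
  qed
  ultimately show ?thesis by blast
qed

text \<open>A position outside the slots has both relations 0, so its suitability as a witness
  depends on its core alone. Whether a core occurs outside is a comparison of its total count with
  its count in the slots, which is below 6 and thus covered by the thresholds.\<close>

lemma witness_iff:
  assumes x: "x < n" and r: "\<And>y. y < n \<Longrightarrow> records y"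
  shows "witness C (g x) v p \<longleftrightarrow> (\<exists>y<n. bev (pair_truth v (core (g x)) (core (g y))
     (enc_nat (pos_rel x y)) (enc_nat (data_rel x y))) p)"
proof -
  obtain ys where ys: "slots (g x) = map (slot x) ys" "distinct ys" "set ys \<subseteq> {..<n}" "length ys \<le> 5"
     "\<And>y. y < n \<Longrightarrow> y \<notin> set ys \<Longrightarrow> pos_rel x y = 0 \<and> data_rel x y = 0"
    using slots_conv[OF x r[OF x]] by blast
  let ?B = "\<lambda>y. bev (pair_truth v (core (g x)) (core (g y)) (enc_nat (pos_rel x y)) (enc_nat (data_rel x y))) p"
  have near: "(\<exists>s\<in>set (slots (g x)). bev (pair_truth v (core (g x)) (right (right s)) (left s) (left (right s))) p)
      \<longleftrightarrow> (\<exists>y\<in>set ys. ?B y)"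
    unfolding ys(1) by (simp add: slot_def)
  have count: "Pair (enc_nat (length (filter (\<lambda>s. right (right s) = c) (slots (g x))))) c \<in> set (vl (total_counts (g x)))
      \<longleftrightarrow> (\<exists>y<n. y \<notin> set ys \<and> core (g y) = c)" if c: "c \<in> set C" for c
  proof -
    let ?m = "length (filter (\<lambda>s. right (right s) = c) (slots (g x)))"
    let ?Y = "{y. y < n \<and> core (g y) = c}" and ?N = "{y \<in> set ys. core (g y) = c}"
    have "?m = length (filter (\<lambda>y. core (g y) = c) ys)"
      unfolding ys(1) by (simp add: filter_map comp_def slot_def)
    also have "\<dots> = card ?N"
      using ys(2) distinct_card[of "filter (\<lambda>y. core (g y) = c) ys"] by simp
    finally have m: "?m = card ?N" .
    have "?m \<le> length ys" unfolding ys(1) by (metis length_filter_le length_map)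
    then have "?m < 6" using ys(4) by simp
    then have "Pair (enc_nat ?m) c \<in> set (vl (total_counts (g x))) \<longleftrightarrow> card ?N < card ?Y"
      using r[OF x] c unfolding records_def m by blast
    also have "\<dots> \<longleftrightarrow> (\<exists>y<n. y \<notin> set ys \<and> core (g y) = c)"
    proof
      assume less: "card ?N < card ?Y"
      have "\<not> ?Y \<subseteq> ?N"
        using less card_mono[of ?N ?Y] by auto
      then show "\<exists>y<n. y \<notin> set ys \<and> core (g y) = c" by blast
    next
      assume "\<exists>y<n. y \<notin> set ys \<and> core (g y) = c"
      then have "?N \<subset> ?Y" using ys(3) by auto
      then show "card ?N < card ?Y" by (intro psubset_card_mono) auto
    qed
    finally show ?thesis .
  qed
  have "(\<exists>c\<in>set C. bev (pair_truth v (core (g x)) c (enc_nat 0) (enc_nat 0)) p \<and>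
        Pair (enc_nat (length (filter (\<lambda>s. right (right s) = c) (slots (g x))))) c \<in> set (vl (total_counts (g x))))
      \<longleftrightarrow> (\<exists>y<n. y \<notin> set ys \<and> ?B y)" (is "?l = ?r")
  proof
    assume ?l
    then obtain c where "c \<in> set C" "bev (pair_truth v (core (g x)) c (enc_nat 0) (enc_nat 0)) p"
        "\<exists>y<n. y \<notin> set ys \<and> core (g y) = c"
      using count by blast
    then show ?r using ys(5) by metis
  next
    assume ?r
    then obtain y where y: "y < n" "y \<notin> set ys" "?B y" by blast
    then have "bev (pair_truth v (core (g x)) (core (g y)) (enc_nat 0) (enc_nat 0)) p" using ys(5) by metis
    moreover have "core (g y) \<in> set C" using r[OF y(1)] by (simp add: records_def)
    ultimately show ?l using count y by blast
  qed
  moreover have "(\<exists>y<n. ?B y) \<longleftrightarrow> (\<exists>y\<in>set ys. ?B y) \<or> (\<exists>y<n. y \<notin> set ys \<and> ?B y)"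
    using ys(3) by blast
  ultimately show ?thesis unfolding witness_def near by simp
qed

text \<open>A constant assignment suffices because a formula that begins with a quantifier depends
  on the other variable only.\<close>

definition correct :: "val \<Rightarrow> bool" where
  "correct p \<longleftrightarrow> (\<forall>a\<in>set (subtrees p). left a = enc_nat 7 \<or> left a = enc_nat 8 \<longrightarrow>
     (\<forall>x<n. a \<in> set (vl (right (core (g x)))) \<longleftrightarrow> sat w (\<lambda>_. x) (dec a)))"

definition assign :: "val \<Rightarrow> nat \<Rightarrow> nat \<Rightarrow> var \<Rightarrow> nat" where
  "assign v x y z = (if z = dec_var v then y else x)"

lemma assign_upd: "(assign v x y)(z := i) = (\<lambda>_. if z = dec_var v then x else y)(z := i)"
proof
  fix z' show "((assign v x y)(z := i)) z' = ((\<lambda>_. if z = dec_var v then x else y)(z := i)) z'"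
    by (cases z; cases z'; cases "dec_var v") (auto simp: assign_def)
qed

text \<open>Boolean combinations are handled by \<open>bev\<close> and atoms by the relations. A
  quantified subformula is looked up in the core of the position assigned to its free variable: this
  is \<open>x\<close> if the bound variable is the one coded by \<open>v\<close>, and
  \<open>y\<close> otherwise.\<close>

lemma pair_truth_iff:
  assumes x: "x < n" "records x" and y: "y < n" "records y" and c: "correct p"
  shows "bev (pair_truth v (core (g x)) (core (g y)) (enc_nat (pos_rel x y)) (enc_nat (data_rel x y))) p
    \<longleftrightarrow> sat w (assign v x y) (dec p)"
  using c
proof (induction p rule: dec.induct)
  \<comment> \<open>Since \<open>left Leaf = Leaf\<close> is the tag 0, \<open>pair_truth\<close>
    takes \<open>Leaf\<close> for a test of letter 0 at the variable coded by \<open>Leaf\<close>;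
    the default of \<open>dec\<close> is chosen to match.\<close>
  case 1
  have "left (core (g x)) = enc_nat (fst (w ! x))" "left (core (g y)) = enc_nat (fst (w ! y))"
    using x y by (auto simp: records_def)
  then show ?case by (simp add: pair_truth_def assign_def dec_var_def)
next
  case (2 t b)
  have sub: "correct b" "correct (left b)" "correct (right b)"
    using "2.prems" subtrees_trans[OF left_in_subtrees[of b]] subtrees_trans[OF right_in_subtrees[of b]]
    by (auto simp: correct_def)
  let ?A = "pair_truth v (core (g x)) (core (g y)) (enc_nat (pos_rel x y)) (enc_nat (data_rel x y)) (Pair t b)"
  have dv: "dec_var u = dec_var u' \<longleftrightarrow> (u = Leaf) = (u' = Leaf)" for u u'
    by (auto simp: dec_var_def)
  have lab_eq: "left (core (g x)) = enc_nat (fst (w ! x))" "left (core (g y)) = enc_nat (fst (w ! y))"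
    using x y by (auto simp: records_def)
  consider (lab) "t = enc_nat 0" | (eq) "t = enc_nat 1" | (succ) "t = enc_nat 2" | (dsucc) "t = enc_nat 3"
    | (bool) "t \<in> enc_nat ` {4, 5, 6}" | (quant) "t \<in> enc_nat ` {7, 8}"
    | (junk) "t \<notin> enc_nat ` {0, 1, 2, 3, 4, 5, 6, 7, 8}"
    by blast
  then show ?case
  proof cases
    case lab
    then show ?thesis
      by (simp add: pair_truth_def assign_def dv lab_eq del: enc_nat.simps nthv.simps)
  next
    case eq
    then show ?thesis
      by (auto simp: pair_truth_def assign_def dv pos_rel_def simp del: enc_nat.simps)
  next
    case succ
    then show ?thesis
      by (auto simp: pair_truth_def assign_def dv pos_rel_def simp del: enc_nat.simps)
  next
    case dsucc
    have D: "data_succ w (snd (w ! i)) (snd (w ! j)) \<longleftrightarrow> D i j" if "i < n" "j < n" for i j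
      using data_succ_text[OF is_text that] that by (simp add: D_def)
    show ?thesis
      using dsucc x(1) y(1) D_irrefl D_asym
      by (auto simp: pair_truth_def assign_def dv data_rel_def D simp del: enc_nat.simps)
  next
    case bool
    then show ?thesis
      using "2.IH" sub by (auto simp del: enc_nat.simps)
  next
    case quant
    have q: "Pair t b \<in> set (vl (right (core (g z)))) \<longleftrightarrow> sat w (\<lambda>_. z) (dec (Pair t b))" if "z < n" for z
      using "2.prems" quant that unfolding correct_def by (auto simp del: enc_nat.simps dec.simps)
    have "?A \<longleftrightarrow> Pair t b \<in> set (vl (right (core (g (if dec_var (left b) = dec_var v then x else y)))))"
      using quant by (auto simp: pair_truth_def dv simp del: enc_nat.simps)
    also have "\<dots> \<longleftrightarrow> sat w (\<lambda>_. if dec_var (left b) = dec_var v then x else y) (dec (Pair t b))"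
      using q[of "if dec_var (left b) = dec_var v then x else y"] x(1) y(1) by auto
    also have "\<dots> \<longleftrightarrow> sat w (assign v x y) (dec (Pair t b))"
      using quant by (auto simp: assign_upd simp del: enc_nat.simps)
    finally show ?thesis using quant by (auto simp del: enc_nat.simps dec.simps)
  next
    \<comment> \<open>Trees with no valid tag are false for \<open>pair_truth\<close>, and
      \<open>dec\<close> reads them as a contradiction.\<close>
    case junk
    then show ?thesis by (auto simp: pair_truth_def simp del: enc_nat.simps)
  qed
qed

end

lemma sat_cong: "(\<And>z. z \<in> fv \<phi> \<Longrightarrow> s z = s' z) \<Longrightarrow> sat w s \<phi> = sat w s' \<phi>"
proof (induction \<phi> arbitrary: s s')
  case (Neg \<phi>)
  then have "sat w s \<phi> = sat w s' \<phi>" by (intro Neg.IH) auto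
  then show ?case by simp
next
  case (And \<phi> \<psi>)
  have "sat w s \<phi> = sat w s' \<phi>" using And.prems by (intro And.IH(1)) auto
  moreover have "sat w s \<psi> = sat w s' \<psi>" using And.prems by (intro And.IH(2)) auto
  ultimately show ?case by simp
next
  case (Or \<phi> \<psi>)
  have "sat w s \<phi> = sat w s' \<phi>" using Or.prems by (intro Or.IH(1)) auto
  moreover have "sat w s \<psi> = sat w s' \<psi>" using Or.prems by (intro Or.IH(2)) auto
  ultimately show ?case by simp
next
  case (Exi x \<phi>)
  have "sat w (s(x := i)) \<phi> = sat w (s'(x := i)) \<phi>" for i
    using Exi.prems by (intro Exi.IH) auto
  then show ?case by simp
next
  case (All x \<phi>)
  have "sat w (s(x := i)) \<phi> = sat w (s'(x := i)) \<phi>" for i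
    using All.prems by (intro All.IH) auto
  then show ?case by simp
qed auto

lemma left_subtree_enc_nat: "a \<in> set (subtrees (enc_nat m)) \<Longrightarrow> left a = Leaf"
  by (induction m) auto

context faithful
begin

text \<open>Needed for universal quantifiers. The tag adds no quantified subtree, because all
  subtrees of a unary number have \<open>Leaf\<close> on the left.\<close>

lemma correct_Neg: "correct p \<Longrightarrow> correct (Pair (enc_nat 4) p)"
  using left_subtree_enc_nat[of _ 4] by (auto simp: correct_def)

lemma correct_subtree: "correct p \<Longrightarrow> q \<in> set (subtrees p) \<Longrightarrow> correct q"
  using subtrees_trans by (fastforce simp: correct_def)

lemma upd_assign: "(\<lambda>_. x)(dec_var v := y) = assign v x y"
  by (auto simp: assign_def)

lemma quantifier_iff:
  assumes x: "x < n" and r: "\<And>y. y < n \<Longrightarrow> records y" and c: "correct (right (right a))"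
  shows "left a = enc_nat 7 \<Longrightarrow> witness C (g x) (left (right a)) (right (right a)) \<longleftrightarrow> sat w (\<lambda>_. x) (dec a)"
    and "left a = enc_nat 8 \<Longrightarrow>
      \<not> witness C (g x) (left (right a)) (Pair (enc_nat 4) (right (right a))) \<longleftrightarrow> sat w (\<lambda>_. x) (dec a)"
proof -
  have w: "witness C (g x) v p \<longleftrightarrow> (\<exists>y<n. sat w (assign v x y) (dec p))" if "correct p" for v p
    using witness_iff[OF x r, of v p] pair_truth_iff[OF x r[OF x] _ r that] by auto
  show "witness C (g x) (left (right a)) (right (right a)) \<longleftrightarrow> sat w (\<lambda>_. x) (dec a)" if "left a = enc_nat 7"
    using that w[OF c] by (cases a) (auto simp: upd_assign simp del: enc_nat.simps)
  show "\<not> witness C (g x) (left (right a)) (Pair (enc_nat 4) (right (right a))) \<longleftrightarrow> sat w (\<lambda>_. x) (dec a)"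
    if "left a = enc_nat 8"
    using that w[OF correct_Neg[OF c]]
    by (cases a) (auto simp: upd_assign simp del: enc_nat.simps)
qed

text \<open>By induction on the size of codes: once the entries for the inner quantifiers are right,
  \<open>witness\<close> computes the truth of the outer ones, and \<open>letter_ok\<close> equates
  the entries with it.\<close>

lemma letters_ok_imp_models:
  assumes r: "\<And>y. y < n \<Longrightarrow> records y" and ok: "\<And>x. x < n \<Longrightarrow> letter_ok C f (g x)"
  shows "models w (dec f)"
proof -
  have "a \<in> set (vl (right (core (g x)))) \<longleftrightarrow> sat w (\<lambda>_. x) (dec a)"
    if "a \<in> set (subtrees f)" "left a = enc_nat 7 \<or> left a = enc_nat 8" "x < n" for a x
    using that
  proof (induction "val_size a" arbitrary: a x rule: less_induct)
    case less
    let ?p = "right (right a)"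
    have sub: "?p \<in> set (subtrees a)"
      using right_in_subtrees subtrees_trans by blast
    have "a \<noteq> Leaf" using less.prems(2) by auto
    then have "val_size ?p < val_size a"
      using val_size_right[of "right a"] by (cases a) auto
    then have "correct ?p"
      unfolding correct_def
      using less.hyps subtrees_trans[OF sub] subtrees_trans[OF less.prems(1)] val_size_subtrees[of _ ?p]
      by (meson le_less_trans subsetD)
    from quantifier_iff[OF less.prems(3) r this] show ?case
      using ok[OF less.prems(3)] less.prems unfolding letter_ok_def by blast
  qed
  then have c: "correct f" by (simp add: correct_def)
  have 0: "0 < n" using is_text by (auto simp: text_word_def ordered_data_word_def)
  have "bev (pair_truth Leaf (core (g 0)) (core (g 0)) (enc_nat 3) (enc_nat 0)) f"
    using ok[OF 0] unfolding letter_ok_def by blast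
  then have "sat w (assign Leaf 0 0) (dec f)"
    using pair_truth_iff[OF 0 r[OF 0] 0 r[OF 0] c, of Leaf] D_irrefl
    by (simp add: pos_rel_def data_rel_def del: enc_nat.simps)
  moreover have "assign Leaf 0 0 = (\<lambda>_. 0)" by (auto simp: assign_def)
  ultimately show ?thesis by (simp add: models_def)
qed

lemma correct_imp_letter_truth:
  assumes x: "x < n" and r: "\<And>y. y < n \<Longrightarrow> records y" and c: "correct f"
    and m: "models w (dec f)" "fv (dec f) = {}"
  shows "\<forall>a\<in>set (subtrees f).
        (left a = enc_nat 7 \<longrightarrow> (a \<in> set (vl (right (core (g x)))) =
           witness C (g x) (left (right a)) (right (right a)))) \<and>
        (left a = enc_nat 8 \<longrightarrow> (a \<in> set (vl (right (core (g x)))) =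
           (\<not> witness C (g x) (left (right a)) (Pair (enc_nat 4) (right (right a))))))"
    and "bev (pair_truth Leaf (core (g x)) (core (g x)) (enc_nat 3) (enc_nat 0)) f"
proof -
  have "correct (right (right a))" if "a \<in> set (subtrees f)" for a
    using that correct_subtree[OF c] right_in_subtrees subtrees_trans by blast
  note q = quantifier_iff[OF x r this]
  have "a \<in> set (vl (right (core (g x)))) \<longleftrightarrow> sat w (\<lambda>_. x) (dec a)"
    if "a \<in> set (subtrees f)" "left a = enc_nat 7 \<or> left a = enc_nat 8" for a
    using c that x unfolding correct_def by blast
  with q show "\<forall>a\<in>set (subtrees f).
        (left a = enc_nat 7 \<longrightarrow> (a \<in> set (vl (right (core (g x)))) =
           witness C (g x) (left (right a)) (right (right a)))) \<and>
        (left a = enc_nat 8 \<longrightarrow> (a \<in> set (vl (right (core (g x)))) =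
           (\<not> witness C (g x) (left (right a)) (Pair (enc_nat 4) (right (right a))))))"
    by blast
  have "sat w (assign Leaf x x) (dec f)"
    using m sat_cong[of "dec f" "\<lambda>_. 0" "assign Leaf x x" w] by (simp add: models_def)
  then show "bev (pair_truth Leaf (core (g x)) (core (g x)) (enc_nat 3) (enc_nat 0)) f"
    using pair_truth_iff[OF x r[OF x] x r[OF x] c, of Leaf] D_irrefl
    by (simp add: pos_rel_def data_rel_def del: enc_nat.simps)
qed

end

section \<open>Rearranging the data order\<close>

text \<open>For a permutation of a finite set this means having a single cycle. In terms of
  invariant sets, merging cycles becomes a matter of counting such sets.\<close>

definition transitive_on :: "'a set \<Rightarrow> ('a \<Rightarrow> 'a) \<Rightarrow> bool" where
  "transitive_on X h \<longleftrightarrow> (\<forall>A\<subseteq>X. A \<noteq> {} \<and> h ` A \<subseteq> A \<longrightarrow> A = X)"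

text \<open>An injection maps a finite invariant set onto itself, so no point outside can be mapped
  into it.\<close>

lemma invariant_complement:
  assumes "finite X" "bij_betw h X X" "A \<subseteq> X" "h ` A \<subseteq> A" "y \<in> X"
  shows "h y \<in> A \<longleftrightarrow> y \<in> A"
proof -
  have inj: "inj_on h X" using assms(2) by (simp add: bij_betw_def)
  have "h ` A = A"
    using assms(1,3,4) inj by (intro endo_inj_surj) (auto intro: finite_subset inj_on_subset)
  then show ?thesis using inj assms(3,5) by (auto simp: inj_on_def)
qed

text \<open>
  Exchanging the values of two points in different invariant sets merges orbits: every set invariant
  under the new map contains both or neither of them, by counting.
\<close>

lemma swap_invariant:
  assumes X: "finite X" "bij_betw h X X" and A: "A \<subseteq> X" "h ` A \<subseteq> A"
    and x: "x \<in> A" "x' \<in> X" "x' \<notin> A"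
    and B: "B \<subseteq> X" "(h \<circ> transpose x x') ` B \<subseteq> B"
  shows "x \<in> B \<longleftrightarrow> x' \<in> B" and "h ` B \<subseteq> B"
proof -
  have inj: "inj_on h X" using X(2) by (simp add: bij_betw_def)
  note compl = invariant_complement[OF X A]
  have step: "h (transpose x x' y) \<in> B" if "y \<in> B" for y
    using B(2) that by auto
  have step': "h y \<in> B" if "y \<in> B" "y \<noteq> x" "y \<noteq> x'" for y
    using step[OF that(1)] that(2,3) by simp
  have False if "x \<in> B" "x' \<notin> B"
  proof -
    \<comment> \<open>If \<open>B\<close> contained \<open>x\<close> but not \<open>x'\<close>, then
      \<open>h\<close> would map this set injectively into the smaller set \<open>B - A\<close>: the
      swap makes \<open>h x'\<close> the image of \<open>x\<close>, which stays in \<open>B\<close>,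
      and it lies outside \<open>A\<close> because \<open>x'\<close> does.\<close>
    let ?S = "insert x' (B - A)"
    have "h ` ?S \<subseteq> B - A"
    proof safe
      show "h x' \<in> B" using step[of x] that by simp
      show "h x' \<in> A \<Longrightarrow> False" using compl x by simp
      fix y assume "y \<in> B" "y \<notin> A"
      then show "h y \<in> B" using step' x that by metis
      assume "h y \<in> A"
      with \<open>y \<in> B\<close> \<open>y \<notin> A\<close> show False using compl B(1) by blast
    qed
    moreover have "inj_on h ?S" by (rule inj_on_subset[OF inj]) (use B(1) x in auto)
    moreover have "finite (B - A)" using X(1) B(1) by (auto intro: finite_subset)
    ultimately have "card ?S \<le> card (B - A)" by (metis card_image card_mono)
    then show False using \<open>finite (B - A)\<close> that by simp
  qed
  moreover have False if "x' \<in> B" "x \<notin> B"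
  proof -
    let ?S = "insert x (B \<inter> A)"
    have "h ` ?S \<subseteq> B \<inter> A"
    proof safe
      show "h x \<in> B" using step[of x'] that by simp
      show "h x \<in> A" using A(2) x(1) by blast
      fix y assume "y \<in> B" "y \<in> A"
      then show "h y \<in> B" using step' x that by metis
      show "h y \<in> A" using A(2) \<open>y \<in> A\<close> by blast
    qed
    moreover have "inj_on h ?S" by (rule inj_on_subset[OF inj]) (use B(1) A(1) x in auto)
    moreover have "finite (B \<inter> A)" using X(1) B(1) by (auto intro: finite_subset)
    ultimately have "card ?S \<le> card (B \<inter> A)" by (metis card_image card_mono)
    then show False using \<open>finite (B \<inter> A)\<close> that by simp
  qed
  ultimately show iff: "x \<in> B \<longleftrightarrow> x' \<in> B" by blast
  show "h ` B \<subseteq> B"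
  proof safe
    fix y assume "y \<in> B"
    consider "y = x" | "y = x'" | "y \<noteq> x" "y \<noteq> x'" by blast
    then show "h y \<in> B"
    proof cases
      case 1
      then show ?thesis using step[of x'] iff \<open>y \<in> B\<close> by simp
    next
      case 2
      then show ?thesis using step[of x] iff \<open>y \<in> B\<close> by simp
    next
      case 3
      then show ?thesis using step' \<open>y \<in> B\<close> by blast
    qed
  qed
qed

text \<open>In the application \<open>f\<close> follows the claims on the claimed positions
  \<open>K\<close>, \<open>f0\<close> is the given data order as a cycle, \<open>E\<close> describes
  block ends and \<gamma> is the letter; \<mu> guarantees that blocks end. Among the admissible
  \<sigma> take one for which \<open>f \<circ> \<sigma>\<close> has the fewest invariant sets, and
  let \<open>A\<close> be a proper one. If two unclaimed points of equal letter lie on different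
  sides of \<open>A\<close>, exchanging them destroys \<open>A\<close> and creates no invariant set.
  Otherwise \<open>A\<close> is closed under equality of letters among unclaimed points, and this
  makes it invariant under \<open>f0\<close>, which has a single cycle.\<close>

lemma merge_cycles:
  fixes f f0 :: "'a \<Rightarrow> 'a" and \<gamma> :: "'a \<Rightarrow> 'b" and E :: "'a \<Rightarrow> 'c" and \<mu> :: "'a \<Rightarrow> nat"
  assumes X: "finite X" and f: "bij_betw f X X" and f0: "bij_betw f0 X X" "transitive_on X f0"
    and same: "\<And>x. x \<in> X \<Longrightarrow> x \<notin> K \<Longrightarrow> f x = f0 x"
    and E: "\<And>x. x \<in> X \<Longrightarrow> x \<in> K \<Longrightarrow> E (f x) = E x \<and> E (f0 x) = E x"
    and \<gamma>: "\<And>x y. x \<in> X \<Longrightarrow> y \<in> X \<Longrightarrow> x \<notin> K \<Longrightarrow> y \<notin> K \<Longrightarrow> E x = E y \<Longrightarrow> \<gamma> x = \<gamma> y"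
    and \<mu>: "\<And>x. x \<in> X \<Longrightarrow> x \<in> K \<Longrightarrow> \<mu> (f x) < \<mu> x"
  obtains \<sigma> where "bij_betw \<sigma> X X" "\<And>x. x \<in> X \<Longrightarrow> \<gamma> (\<sigma> x) = \<gamma> x" "\<And>x. x \<in> K \<Longrightarrow> \<sigma> x = x"
    "transitive_on X (f \<circ> \<sigma>)"
proof -
  define good where "good \<sigma> \<longleftrightarrow> bij_betw \<sigma> X X \<and> (\<forall>x\<in>X. \<gamma> (\<sigma> x) = \<gamma> x) \<and> (\<forall>x\<in>K. \<sigma> x = x)" for \<sigma>
  define Inv where "Inv h = {A. A \<subseteq> X \<and> h ` A \<subseteq> A}" for h :: "'a \<Rightarrow> 'a"
  have "good id" by (simp add: good_def)
  from ex_has_least_nat[of good id "\<lambda>\<sigma>. card (Inv (f \<circ> \<sigma>))", OF this]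
  obtain \<sigma> where \<sigma>: "good \<sigma>"
    and min: "\<forall>\<tau>. good \<tau> \<longrightarrow> card (Inv (f \<circ> \<sigma>)) \<le> card (Inv (f \<circ> \<tau>))"
    by (elim exE conjE)
  let ?h = "f \<circ> \<sigma>"
  have h: "bij_betw ?h X X" using \<sigma> f by (auto simp: good_def intro: bij_betw_trans)
  have "transitive_on X ?h"
    unfolding transitive_on_def
  proof (intro allI impI, rule ccontr)
    fix A assume A: "A \<subseteq> X" "A \<noteq> {} \<and> ?h ` A \<subseteq> A" "A \<noteq> X"
    note compl = invariant_complement[OF X h A(1) conjunct2[OF A(2)]]
    have "\<exists>x x'. x \<in> A \<and> x \<notin> K \<and> x' \<in> X \<and> x' \<notin> A \<and> x' \<notin> K \<and> \<gamma> x = \<gamma> x'"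
    proof (rule ccontr)
      assume "\<not> ?thesis"
      then have closed: "x' \<in> A" if "x \<in> A" "x \<notin> K" "x' \<in> X" "x' \<notin> K" "\<gamma> x = \<gamma> x'" for x x'
        using that by blast
      \<comment> \<open>Since \<sigma> fixes \<open>K\<close>, following \<open>f\<close> through a
        block never crosses the border of \<open>A\<close>, so the end of the block lies on the same
        side as the start.\<close>
      have end_pt: "\<exists>u. u \<in> X \<and> u \<notin> K \<and> E u = E y \<and> (u \<in> A \<longleftrightarrow> y \<in> A)" if "y \<in> X" for y
        using that
      proof (induction "\<mu> y" arbitrary: y rule: less_induct)
        case less
        show ?case
        proof (cases "y \<in> K")
          case True
          have fy: "f y \<in> X" using f less.prems by (auto simp: bij_betw_def)
          have "?h y = f y" using True \<sigma> by (simp add: good_def)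
          then have "f y \<in> A \<longleftrightarrow> y \<in> A" using compl[OF less.prems] by simp
          moreover have "E (f y) = E y" using E less.prems True by blast
          ultimately show ?thesis using less.hyps[OF \<mu>[OF less.prems True] fy] by metis
        qed (use less.prems in blast)
      qed
      have "f0 x \<in> A" if "x \<in> A" for x
      proof (cases "x \<in> K")
        case False
        have "x \<in> X" using that A(1) by blast
        then have "x \<in> \<sigma> ` X" using \<sigma> by (simp add: good_def bij_betw_def)
        then obtain x'' where x'': "x'' \<in> X" "\<sigma> x'' = x" by blast
        have "x'' \<notin> K" using x'' False \<sigma> by (auto simp: good_def)
        moreover have "\<gamma> x = \<gamma> x''" using x'' \<sigma> by (auto simp: good_def)
        ultimately have "x'' \<in> A" using closed[OF that False x''(1)] by simp
        then have "?h x'' \<in> A" using A(2) by blast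
        then show ?thesis using x'' same[OF \<open>x \<in> X\<close> False] by simp
      next
        case True
        have x: "x \<in> X" using that A(1) by blast
        have yX: "f x \<in> X" and zX: "f0 x \<in> X" using f f0(1) x by (auto simp: bij_betw_def)
        have "?h x = f x" using True \<sigma> by (simp add: good_def)
        then have y: "f x \<in> A" using that A(2) by (metis image_subset_iff)
        \<comment> \<open>The claimed and the given successor of \<open>x\<close> lie in blocks with
          equal end descriptions. \<open>A\<close> contains the first block end, hence by closedness
          the second, and hence the given successor.\<close>
        obtain u where u: "u \<in> X" "u \<notin> K" "E u = E (f x)" "u \<in> A" using end_pt[OF yX] y by blast
        obtain v where v: "v \<in> X" "v \<notin> K" "E v = E (f0 x)" "v \<in> A \<longleftrightarrow> f0 x \<in> A" using end_pt[OF zX] by blast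
        have "\<gamma> u = \<gamma> v" using \<gamma>[OF u(1) v(1) u(2) v(2)] u(3) v(3) E[OF x True] by simp
        then show ?thesis using closed[OF u(4,2) v(1,2)] v(4) by simp
      qed
      then have "A = X" using f0(2) A(1,2) unfolding transitive_on_def by (metis image_subsetI)
      with A(3) show False by blast
    qed
    then obtain x x' where x: "x \<in> A" "x \<notin> K" "x' \<in> X" "x' \<notin> A" "x' \<notin> K" "\<gamma> x = \<gamma> x'" by blast
    let ?t = "transpose x x'"
    have xX: "x \<in> X" using x A by blast
    have "bij_betw ?t X X" using x xX by (simp add: bij_betw_transpose_iff)
    then have "bij_betw (\<sigma> \<circ> ?t) X X" using \<sigma> unfolding good_def by (blast intro: bij_betw_trans)
    then have "good (\<sigma> \<circ> ?t)"
      using \<sigma> x xX unfolding good_def by (auto simp: transpose_def)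
    from min[rule_format, OF this] have le: "card (Inv ?h) \<le> card (Inv (?h \<circ> ?t))" by (simp add: comp_assoc)
    have "Inv (?h \<circ> ?t) \<subset> Inv ?h"
    proof
      show "Inv (?h \<circ> ?t) \<subseteq> Inv ?h"
        using swap_invariant(2)[OF X h A(1) conjunct2[OF A(2)] x(1,3,4)] unfolding Inv_def by blast
      have "A \<in> Inv ?h" using A by (auto simp: Inv_def)
      moreover have "A \<notin> Inv (?h \<circ> ?t)"
        using swap_invariant(1)[OF X h A(1) conjunct2[OF A(2)] x(1,3,4) A(1)] x unfolding Inv_def by blast
      ultimately show "Inv (?h \<circ> ?t) \<noteq> Inv ?h" by blast
    qed
    moreover have "finite (Inv ?h)" using X by (auto simp: Inv_def intro: finite_subset[of _ "Pow X"])
    ultimately have "card (Inv (?h \<circ> ?t)) < card (Inv ?h)" by (intro psubset_card_mono)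
    with le show False by simp
  qed
  with \<sigma> show ?thesis by (intro that) (auto simp: good_def)
qed

text \<open>Cuts the cycle between \<open>l\<close> and \<open>p\<close> and numbers it from
  \<open>p\<close>. An initial piece of the orbit that returns to \<open>p\<close> is invariant and
  so is everything; hence there is no return before \<open>n\<close> steps.\<close>

lemma cycle_list:
  assumes h: "bij_betw h {..<n} {..<n}" "transitive_on {..<n} h" and p: "p < n" "l < n" "h l = p"
  obtains r :: "nat \<Rightarrow> nat" where "bij_betw r {..<n} {..<n}" "r p = 0" "r l = n - 1"
    "\<And>x. x < n \<Longrightarrow> x \<noteq> l \<Longrightarrow> r (h x) = Suc (r x)"
proof -
  let ?P = "\<lambda>j. (h ^^ j) p"
  have hX: "h x < n" if "x < n" for x using h(1) that by (auto simp: bij_betw_def)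
  have inj: "x = y" if "x < n" "y < n" "h x = h y" for x y
    using h(1) that by (auto simp: bij_betw_def inj_on_def)
  have PX: "?P j < n" for j by (induction j) (auto simp: p(1) hX)
  have period: "n \<le> m" if "?P m = p" "0 < m" for m
  proof -
    have "h ` ?P ` {..<m} \<subseteq> ?P ` {..<m}"
    proof safe
      fix j assume "j < m"
      show "h (?P j) \<in> ?P ` {..<m}"
      proof (cases "Suc j = m")
        case True
        then have "h (?P j) = ?P 0" using that by auto
        then show ?thesis using that(2) by blast
      next
        case False
        then have "h (?P j) = ?P (Suc j)" "Suc j < m" using \<open>j < m\<close> by auto
        then show ?thesis by blast
      qed
    qed
    moreover have "?P ` {..<m} \<subseteq> {..<n}" "?P ` {..<m} \<noteq> {}" using PX that(2) by auto
    ultimately have "?P ` {..<m} = {..<n}" using h(2) unfolding transitive_on_def by blast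
    then show ?thesis by (metis card_image_le card_lessThan finite_lessThan)
  qed
  have inj_P: "inj_on ?P {..<n}"
  proof (rule linorder_inj_onI')
    fix i j assume "i \<in> {..<n}" "j \<in> {..<n}" "i < j"
    show "?P i \<noteq> ?P j"
    proof
      assume "?P i = ?P j"
      then have "?P (j - i) = p" using \<open>i < j\<close>
      proof (induction i arbitrary: j)
        case (Suc i)
        then obtain j' where j: "j = Suc j'" by (cases j) auto
        then have "?P i = ?P j'" using Suc.prems(1) PX inj by auto
        then show ?case using Suc.IH[of j'] Suc.prems j by simp
      qed simp
      then show False using period[of "j - i"] \<open>i < j\<close> \<open>j \<in> {..<n}\<close> by auto
    qed
  qed
  have img: "?P ` {..<n} = {..<n}"
    using inj_P PX by (intro card_subset_eq) (auto simp: card_image)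
  have last: "?P (n - 1) = l"
  proof -
    have "l \<in> ?P ` {..<n}" unfolding img using p(2) by simp
    then obtain j where j: "j < n" "?P j = l" by auto
    then have "?P (Suc j) = p" using p(3) by simp
    then have "n \<le> Suc j" by (rule period) simp
    then have "j = n - 1" using j(1) by simp
    then show ?thesis using j(2) by simp
  qed
  let ?r = "inv_into {..<n} ?P"
  have r: "?r (?P j) = j" if "j < n" for j using inj_P that by (intro inv_into_f_f) auto
  show ?thesis
  proof
    show "bij_betw ?r {..<n} {..<n}" using inj_P img by (intro bij_betw_inv_into) (simp add: bij_betw_def)
    show "?r p = 0" using r[of 0] p(1) by simp
    show "?r l = n - 1" using r[of "n - 1"] last p(1) by simp
    fix x assume x: "x < n" "x \<noteq> l"
    have "x \<in> ?P ` {..<n}" unfolding img using x(1) by simp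
    then obtain j where j: "j < n" "?P j = x" by auto
    then have "Suc j < n" using last x(2) by (cases "j = n - 1") auto
    then have "?r (?P (Suc j)) = Suc j" by (rule r)
    then show "?r (h x) = Suc (?r x)" using r[OF j(1)] j(2) by auto
  qed
qed

lemma set_thresholds: "set thresholds = enc_nat ` {..<6}"
proof -
  have "{..<6} = {0, 1, 2, 3, 4, 5::nat}" by auto
  then show ?thesis by (simp del: enc_nat.simps)
qed

lemma code_letterD:
  assumes "l \<in> set (code_letters C T)"
  shows "core l \<in> set C" "next_claim l \<in> enc_nat ` {0, 1, 2}" "prev_claim l \<in> enc_nat ` {0, 1, 2}"
    "l = Pair (left l) (right l)"
proof -
  obtain b e where l: "l = Pair b e" "b \<in> set (basics C T)"
    using assms by (auto simp: code_letters_def)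
  obtain xs where xs: "b = lv xs" "list_all2 (\<lambda>x ys. x \<in> set ys) xs [C, Leaf # map (\<lambda>c. Pair c Leaf) C,
      Leaf # map (\<lambda>c. Pair c Leaf) C, Leaf # map (\<lambda>c. Pair c Leaf) C, Leaf # map (\<lambda>c. Pair c Leaf) C,
      map enc_nat [0, 1, 2], map enc_nat [0, 1, 2], map enc_nat [0, 1, 2, 3, 4], map enc_nat [0, 1, 2, 3, 4], T, T]"
    using l(2) unfolding basics_def Let_def set_tuples by blast
  have len: "length xs = 11" using list_all2_lengthD[OF xs(2)] by simp
  have nth: "nthv i (left l) = xs ! i" if "i < 11" for i
    using nthv_lv[of i xs] that l xs len by simp
  show "core l \<in> set C"
    using list_all2_nthD[OF xs(2), of 0] nth[of 0] len by (simp del: nthv.simps)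
  show "next_claim l \<in> enc_nat ` {0, 1, 2}"
    using list_all2_nthD[OF xs(2), of 5] nth[of 5] len by (simp del: nthv.simps enc_nat.simps)
  show "prev_claim l \<in> enc_nat ` {0, 1, 2}"
    using list_all2_nthD[OF xs(2), of 6] nth[of 6] len by (simp del: nthv.simps enc_nat.simps)
  show "l = Pair (left l) (right l)" using l by simp
qed

text \<open>The last element is sent to the first one, so that the data order becomes a permutation;
  the extra step is cut out again at the end.\<close>

lemma cyclic_successor:
  assumes ps: "length ps = n" "set ps = {..<n}" and n: "0 < n"
  obtains s where "bij_betw s {..<n} {..<n}" "transitive_on {..<n} s" "s (ps ! (n - 1)) = ps ! 0"
    "\<And>x. x < n \<Longrightarrow> x \<noteq> ps ! (n - 1) \<Longrightarrow> \<exists>i. Suc i < n \<and> x = ps ! i \<and> s x = ps ! Suc i"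
proof -
  have dist: "distinct ps" using ps by (simp add: card_distinct)
  then have bij: "bij_betw ((!) ps) {..<n} {..<n}" using ps bij_betw_nth by blast
  define idx where "idx = inv_into {..<n} ((!) ps)"
  define s where "s x = ps ! (Suc (idx x) mod n)" for x
  have idx: "idx (ps ! i) = i" if "i < n" for i
    unfolding idx_def using bij that by (simp add: bij_betw_def)
  have s: "s (ps ! i) = ps ! (Suc i mod n)" if "i < n" for i
    using idx[OF that] by (simp add: s_def)
  have ex: "\<exists>i<n. x = ps ! i" if "x < n" for x
  proof -
    have "x \<in> set ps" using that ps by simp
    then show ?thesis using ps(1) by (auto simp: in_set_conv_nth)
  qed
  have lt: "ps ! i < n" if "i < n" for i
    using nth_mem[of i ps] that unfolding ps by simp
  show ?thesis
  proof
    have img: "s ` {..<n} = {..<n}"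
    proof
      show "s ` {..<n} \<subseteq> {..<n}"
      proof (rule image_subsetI)
        fix x
        show "s x \<in> {..<n}" unfolding s_def using lt[of "Suc (idx x) mod n"] n by simp
      qed
      show "{..<n} \<subseteq> s ` {..<n}"
      proof
        fix x assume "x \<in> {..<n}"
        then obtain i where i: "i < n" "x = ps ! i" using ex by auto
        let ?j = "if i = 0 then n - 1 else i - 1"
        have "?j < n" "Suc ?j mod n = i" using i n by auto
        then have "x = s (ps ! ?j)" using s i by metis
        then show "x \<in> s ` {..<n}" using lt \<open>?j < n\<close> by blast
      qed
    qed
    then show "bij_betw s {..<n} {..<n}"
      by (simp add: bij_betw_def eq_card_imp_inj_on)
    show "transitive_on {..<n} s"
      unfolding transitive_on_def
    proof (intro allI impI)
      fix A assume A: "A \<subseteq> {..<n}" "A \<noteq> {} \<and> s ` A \<subseteq> A"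
      then obtain x where x: "x \<in> A" by blast
      then obtain j where j: "j < n" "x = ps ! j" using A ex by blast
      have step: "ps ! ((j + m) mod n) \<in> A" for m
      proof (induction m)
        case (Suc m)
        then have "s (ps ! ((j + m) mod n)) \<in> A" using A by blast
        moreover have "s (ps ! ((j + m) mod n)) = ps ! ((j + Suc m) mod n)"
          using s[of "(j + m) mod n"] n by (simp add: mod_Suc_eq)
        ultimately show ?case by simp
      qed (use x j in simp)
      have "ps ! i \<in> A" if "i < n" for i
        using step[of "n - j + i"] j that by simp
      then show "A = {..<n}" using A ex by blast
    qed
    show "s (ps ! (n - 1)) = ps ! 0" using s[of "n - 1"] n by simp
    fix x assume x: "x < n" "x \<noteq> ps ! (n - 1)"
    then obtain i where i: "i < n" "x = ps ! i" using ex by blast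
    then have "Suc i < n" using x by (cases "i = n - 1") auto
    then show "\<exists>i. Suc i < n \<and> x = ps ! i \<and> s x = ps ! Suc i" using s[OF i(1)] i by auto
  qed
qed

lemma partial_counts:
  assumes "first_pos C (g 0)" "\<And>i. Suc i < n \<Longrightarrow> pos_link C (g i) (g (Suc i))" "x < n" "c \<in> set C" "j < 6"
  shows "Pair (enc_nat j) c \<in> set (vl (partial_counts_of (g x))) \<longleftrightarrow> j < card {y. y \<le> x \<and> core (g y) = c}"
  using assms(3,5)
proof (induction x arbitrary: j)
  case 0
  have "{y. y \<le> 0 \<and> core (g y) = c} = (if core (g 0) = c then {0} else {})" by (auto simp del: nthv.simps)
  then show ?case
    using assms(1,4) 0 unfolding first_pos_def set_thresholds by (auto simp del: nthv.simps)
next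
  case (Suc x)
  let ?Y = "\<lambda>x. {y. y \<le> x \<and> core (g y) = c}"
  have "?Y (Suc x) = (if core (g (Suc x)) = c then insert (Suc x) (?Y x) else ?Y x)"
    by (auto simp: le_Suc_eq simp del: nthv.simps)
  then have card: "card (?Y (Suc x)) = (if core (g (Suc x)) = c then Suc (card (?Y x)) else card (?Y x))"
    by (simp del: nthv.simps)
  have "Pair (enc_nat j) c \<in> set (vl (partial_counts_of (g (Suc x)))) \<longleftrightarrow>
     Pair (enc_nat j) c \<in> set (vl (partial_counts_of (g x))) \<or> c = core (g (Suc x)) \<and>
       (enc_nat j = Leaf \<or> Pair (right (enc_nat j)) c \<in> set (vl (partial_counts_of (g x))))"
    using assms(2)[OF Suc.prems(1)] assms(4) Suc.prems(2) unfolding pos_link_def set_thresholds by blast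
  also have "\<dots> \<longleftrightarrow> j < card (?Y x) \<or> c = core (g (Suc x)) \<and> j < Suc (card (?Y x))"
    using Suc.IH[of j] Suc.IH[of "j - 1"] Suc.prems by (cases j) (auto simp del: nthv.simps)
  finally show ?case unfolding card by (auto simp del: nthv.simps)
qed

text \<open>The map \<open>F\<close> follows the claims and elsewhere the given order. It is a
  permutation, but possibly with several cycles; \<open>h = F \<circ> \<sigma>\<close> has one. As
  \<sigma> preserves letters and fixes claimed positions, all links and claims survive, and
  \<open>r\<close> is the new rank of a position.\<close>

lemma rearrange:
  fixes g :: "nat \<Rightarrow> val"
  assumes n: "0 < n"
    and letter: "\<And>x. x < n \<Longrightarrow> g x \<in> set (code_letters C T)"
    and ok: "\<And>x. x < n \<Longrightarrow> letter_ok C f (g x)"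
    and fp: "first_pos C (g 0)" and pl: "\<And>x. Suc x < n \<Longrightarrow> pos_link C (g x) (g (Suc x))"
    and lp: "last_pos (g (n - 1))"
    and ps: "length ps = n" "set ps = {..<n}"
    and fd: "first_data (g (ps ! 0))" and dl: "\<And>i. Suc i < n \<Longrightarrow> data_link (g (ps ! i)) (g (ps ! Suc i))"
    and ld: "last_data (g (ps ! (n - 1)))"
  obtains h r p l where "bij_betw r {..<n} {..<n}" "p < n" "l < n"
    "\<And>x. x < n \<Longrightarrow> h x < n" "\<And>x. x < n \<Longrightarrow> x \<noteq> l \<Longrightarrow> r (h x) = Suc (r x)"
    "r p = 0" "r l = n - 1" "prev_data (g p) = Leaf" "next_data (g l) = Leaf"
    "\<And>x. x < n \<Longrightarrow> x \<noteq> l \<Longrightarrow> data_link (g x) (g (h x))"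
    "\<And>x. x < n \<Longrightarrow> next_claim (g x) = enc_nat 1 \<Longrightarrow> h x = Suc x \<and> x \<noteq> l"
    "\<And>x. x < n \<Longrightarrow> next_claim (g x) = enc_nat 2 \<Longrightarrow> Suc (h x) = x \<and> x \<noteq> l"
proof -
  define p l where "p = ps ! 0" and "l = ps ! (n - 1)"
  have pX: "p < n" and lX: "l < n"
    using nth_mem[of 0 ps] nth_mem[of "n - 1" ps] n unfolding ps p_def l_def by simp_all
  obtain f0 where f0: "bij_betw f0 {..<n} {..<n}" "transitive_on {..<n} f0" "f0 l = p"
     "\<And>x. x < n \<Longrightarrow> x \<noteq> l \<Longrightarrow> \<exists>i. Suc i < n \<and> x = ps ! i \<and> f0 x = ps ! Suc i"
    using cyclic_successor[OF ps n] unfolding p_def l_def by blast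
  have dl0: "data_link (g x) (g (f0 x))" if "x < n" "x \<noteq> l" for x
    using f0(4)[OF that] dl by auto
  have pd: "prev_data (g p) = Leaf" using fd by (simp only: first_data_def p_def)
  have nd: "next_data (g x) = Leaf \<longleftrightarrow> x = l" if "x < n" for x
  proof (cases "x = l")
    case True
    then show ?thesis using ld by (simp only: last_data_def l_def simp_thms)
  next
    case False
    then show ?thesis using dl0[OF that False] unfolding data_link_def by (simp only: val.distinct simp_thms)
  qed
  note c12 = code_letterD[OF letter]
  have okD: "next_claim (g x) = enc_nat 0 \<or> next_claim (g x) \<noteq> prev_claim (g x)"
    "next_claim (g x) = enc_nat 1 \<Longrightarrow> next_pos (g x) \<noteq> Leaf \<and> next_data (g x) \<noteq> Leaf"
    "next_claim (g x) = enc_nat 2 \<Longrightarrow> prev_pos (g x) \<noteq> Leaf \<and> next_data (g x) \<noteq> Leaf"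
    "prev_claim (g x) = enc_nat 1 \<Longrightarrow> next_pos (g x) \<noteq> Leaf \<and> prev_data (g x) \<noteq> Leaf"
    "prev_claim (g x) = enc_nat 2 \<Longrightarrow> prev_pos (g x) \<noteq> Leaf \<and> prev_data (g x) \<noteq> Leaf"
    "next_claim (g x) = enc_nat 0 \<Longrightarrow> right (g x) = left (g x)" if "x < n" for x
    using ok[OF that] unfolding letter_ok_def by blast+
  have o1: "Suc x < n \<and> x \<noteq> l" if "x < n" "next_claim (g x) = enc_nat 1" for x
  proof -
    have "x \<noteq> n - 1" using okD(2)[OF that] lp by (auto simp: last_pos_def simp del: nthv.simps)
    then show ?thesis using okD(2)[OF that] nd that(1) by auto
  qed
  have o2: "0 < x \<and> x \<noteq> l" if "x < n" "next_claim (g x) = enc_nat 2" for x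
  proof -
    have "x \<noteq> 0" using okD(3)[OF that] fp unfolding first_pos_def by metis
    then show ?thesis using okD(3)[OF that] nd that(1) by auto
  qed
  have pl1: "prev_claim (g (Suc x)) = enc_nat 2" "data_link (g x) (g (Suc x))"
    if "x < n" "next_claim (g x) = enc_nat 1" for x
    using pl[of x] o1[OF that] that(2) unfolding pos_link_def by blast+
  have pl2: "prev_claim (g (x - 1)) = enc_nat 1" "data_link (g x) (g (x - 1))"
    if "x < n" "next_claim (g x) = enc_nat 2" for x
  proof -
    have "pos_link C (g (x - 1)) (g x)" using pl[of "x - 1"] o2[OF that] that(1) by simp
    then show "prev_claim (g (x - 1)) = enc_nat 1" "data_link (g x) (g (x - 1))"
      using that(2) unfolding pos_link_def by blast+
  qed
  have claims: "next_claim (g x) = enc_nat 0 \<or> next_claim (g x) = enc_nat 1 \<or> next_claim (g x) = enc_nat 2"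
    "prev_claim (g x) = enc_nat 0 \<or> prev_claim (g x) = enc_nat 1 \<or> prev_claim (g x) = enc_nat 2" if "x < n" for x
    using c12(2,3)[OF that] by auto
  define F where "F x = (if next_claim (g x) = enc_nat 1 then Suc x
    else if next_claim (g x) = enc_nat 2 then x - 1 else f0 x)" for x
  define K where "K = {x. x < n \<and> next_claim (g x) \<noteq> enc_nat 0}"
  have ne: "enc_nat 1 \<noteq> enc_nat 2" "enc_nat 1 \<noteq> enc_nat 0" "enc_nat 2 \<noteq> enc_nat 0"
    by (simp_all del: enc_nat.simps)
  have f0X: "f0 x < n" if "x < n" for x using f0(1) that by (auto simp: bij_betw_def)
  have FX: "F x < n" if "x < n" for x
    using o1[OF that] o2[OF that] f0X[OF that] that by (auto simp: F_def simp del: nthv.simps)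
  have p0: "prev_claim (g p) = enc_nat 0"
    using okD(4,5)[OF pX] pd claims(2)[OF pX] by blast
  have l0: "next_claim (g l) = enc_nat 0"
    using claims(1)[OF lX] o1[OF lX] o2[OF lX] by blast
  \<comment> \<open>The claim at the target reveals which of the three rules of \<open>F\<close> led
    there. Each rule is injective on the positions using it, and so \<open>F\<close> is
    injective.\<close>
  have pcF: "prev_claim (g (F x)) = (if next_claim (g x) = enc_nat 1 then enc_nat 2
      else if next_claim (g x) = enc_nat 2 then enc_nat 1 else enc_nat 0)" if "x < n" for x
  proof -
    have "prev_claim (g (f0 x)) = enc_nat 0" if "next_claim (g x) = enc_nat 0"
    proof (cases "x = l")
      case True
      then show ?thesis using f0(3) p0 by simp
    next
      case False
      then show ?thesis using dl0[OF \<open>x < n\<close>] that unfolding data_link_def by blast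
    qed
    then show ?thesis using claims(1)[OF that] pl1(1)[OF that] pl2(1)[OF that] ne unfolding F_def by presburger
  qed
  have inj_F: "inj_on F {..<n}"
  proof (rule inj_onI)
    fix x y assume xy: "x \<in> {..<n}" "y \<in> {..<n}" "F x = F y"
    have "prev_claim (g (F x)) = prev_claim (g (F y))" using xy(3) by simp
    then have eq: "next_claim (g x) = next_claim (g y)"
      using pcF[of x] pcF[of y] xy claims(1)[of x] claims(1)[of y] ne by (metis lessThan_iff)
    show "x = y"
    proof (cases "next_claim (g x) = enc_nat 1")
      case True
      then show ?thesis using xy(3) eq unfolding F_def by simp
    next
      case False
      show ?thesis
      proof (cases "next_claim (g x) = enc_nat 2")
        case True
        then have "x - 1 = y - 1" using xy(3) eq False unfolding F_def by simp
        then show ?thesis using o2[of x] o2[of y] True eq xy by auto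
      next
        case F2: False
        then have "f0 x = f0 y" using xy(3) eq False unfolding F_def by simp
        then show ?thesis using f0(1) xy by (auto simp: bij_betw_def inj_on_def)
      qed
    qed
  qed
  moreover have "F ` {..<n} = {..<n}" by (rule endo_inj_surj) (use FX inj_F in auto)
  ultimately have bij_F: "bij_betw F {..<n} {..<n}" by (simp add: bij_betw_def)
  have linkF: "data_link (g x) (g (F x))" if "x \<in> K" for x
    using that claims(1)[of x] pl1(2)[of x] pl2(2)[of x] ne unfolding K_def F_def by auto
  obtain \<sigma> where \<sigma>: "bij_betw \<sigma> {..<n} {..<n}" "\<And>x. x \<in> {..<n} \<Longrightarrow> g (\<sigma> x) = g x"
     "\<And>x. x \<in> K \<Longrightarrow> \<sigma> x = x" "transitive_on {..<n} (F \<circ> \<sigma>)"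
  \<comment> \<open>The measure is the distance to the border of the word in the direction of the
    claim, and 0 at block ends. It decreases because a chain of claims cannot turn back.\<close>
  proof (rule merge_cycles[of "{..<n}" F f0 K "\<lambda>x. right (g x)" g
       "\<lambda>x. if next_claim (g x) = enc_nat 1 then n - x else if next_claim (g x) = enc_nat 2 then x + 1 else 0"])
    show "F x = f0 x" if "x \<in> {..<n}" "x \<notin> K" for x
      using that ne unfolding K_def F_def by auto
    show "right (g (F x)) = right (g x) \<and> right (g (f0 x)) = right (g x)" if x: "x \<in> {..<n}" "x \<in> K" for x
    proof -
      have nc: "next_claim (g x) \<noteq> enc_nat 0" using x unfolding K_def by blast
      then have "x \<noteq> l" using l0 by blast
      then have "data_link (g x) (g (f0 x))" using dl0 x by blast
      then show ?thesis using linkF[OF x(2)] nc unfolding data_link_def by metis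
    qed
    show "g x = g y" if xy: "x \<in> {..<n}" "y \<in> {..<n}" "x \<notin> K" "y \<notin> K" "right (g x) = right (g y)" for x y
    proof -
      have "next_claim (g x) = enc_nat 0" "next_claim (g y) = enc_nat 0" "x < n" "y < n"
        using xy by (auto simp: K_def simp del: nthv.simps enc_nat.simps)
      then have "left (g x) = left (g y)" using okD(6) xy(5) by metis
      then show ?thesis using c12(4)[OF \<open>x < n\<close>] c12(4)[OF \<open>y < n\<close>] xy(5) by metis
    qed
    show "(if next_claim (g (F x)) = enc_nat 1 then n - F x else if next_claim (g (F x)) = enc_nat 2 then F x + 1 else 0)
        < (if next_claim (g x) = enc_nat 1 then n - x else if next_claim (g x) = enc_nat 2 then x + 1 else 0)"
      if x: "x \<in> {..<n}" "x \<in> K" for x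
    proof -
      have xn: "x < n" using x by simp
      note pc = pcF[OF xn] and dir = okD(1)[OF FX[OF xn]]
      consider (one) "next_claim (g x) = enc_nat 1" | (two) "next_claim (g x) = enc_nat 2"
        using claims(1)[OF xn] x(2) by (auto simp: K_def simp del: nthv.simps enc_nat.simps)
      then show ?thesis
      proof cases
        case one
        then have "F x = Suc x" "next_claim (g (F x)) \<noteq> enc_nat 2"
          using pc dir ne unfolding F_def by auto
        then show ?thesis using one xn by auto
      next
        case two
        then have "F x = x - 1" "next_claim (g (F x)) \<noteq> enc_nat 1"
          using pc dir ne unfolding F_def by auto
        then show ?thesis using two ne o2[OF xn two] by auto
      qed
    qed
  qed (use bij_F f0 in auto)
  define h where "h = F \<circ> \<sigma>"
  have \<sigma>X: "\<sigma> x < n" if "x < n" for x using \<sigma>(1) that by (auto simp: bij_betw_def)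
  have bij_h: "bij_betw h {..<n} {..<n}" unfolding h_def using \<sigma>(1) bij_F by (rule bij_betw_trans)
  have \<sigma>K: "\<sigma> x \<notin> K" if "x < n" "x \<notin> K" for x
  proof
    assume K: "\<sigma> x \<in> K"
    then have "\<sigma> (\<sigma> x) = \<sigma> x" using \<sigma>(3) by blast
    then have "\<sigma> x = x" using \<sigma>(1) \<sigma>X that(1) by (auto simp: bij_betw_def inj_on_def)
    with K that show False by simp
  qed
  \<comment> \<open>Only the letter of \<open>l\<close> lacks a data successor, so \<sigma> fixes
    \<open>l\<close>, and the artificial step from \<open>l\<close> to \<open>p\<close> remains as
    the place for the cut.\<close>
  have "next_data (g (\<sigma> l)) = Leaf" using \<sigma>(2)[of l] lX nd[OF lX] by simp
  then have "\<sigma> l = l" using nd[OF \<sigma>X[OF lX]] by simp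
  then have hl: "h l = p" using l0 ne f0(3) by (simp add: h_def F_def del: enc_nat.simps nthv.simps)
  have hK: "h x = F x" if "x \<in> K" for x using \<sigma>(3)[OF that] by (simp add: h_def)
  have link: "data_link (g x) (g (h x))" if x: "x < n" "x \<noteq> l" for x
  proof (cases "x \<in> K")
    case True
    then show ?thesis using linkF hK by simp
  next
    case False
    have "\<sigma> x \<notin> K" by (rule \<sigma>K[OF x(1) False])
    then have "h x = f0 (\<sigma> x)" using \<sigma>X[OF x(1)] ne unfolding h_def F_def K_def by auto
    moreover have eq: "g (\<sigma> x) = g x" using \<sigma>(2) x(1) by simp
    moreover have "\<sigma> x \<noteq> l" using nd[OF \<sigma>X[OF x(1)]] nd[OF x(1)] eq x(2) by simp
    ultimately show ?thesis using dl0[OF \<sigma>X[OF x(1)]] by simp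
  qed
  obtain r where r: "bij_betw r {..<n} {..<n}" "r p = 0" "r l = n - 1"
      "\<And>x. x < n \<Longrightarrow> x \<noteq> l \<Longrightarrow> r (h x) = Suc (r x)"
    using cycle_list[OF bij_h \<sigma>(4)[folded h_def] pX lX hl] by blast
  show ?thesis
  proof (rule that[OF r(1) pX lX _ r(4,2,3) pd _ link])
    show "h x < n" if "x < n" for x using bij_h that by (auto simp: bij_betw_def)
    show "next_data (g l) = Leaf" using nd[OF lX] by simp
    show "h x = Suc x \<and> x \<noteq> l" if "x < n" "next_claim (g x) = enc_nat 1" for x
    proof -
      have "x \<in> K" using that ne unfolding K_def by simp
      then show ?thesis using hK o1[OF that] that(2) unfolding F_def by simp
    qed
    show "Suc (h x) = x \<and> x \<noteq> l" if "x < n" "next_claim (g x) = enc_nat 2" for x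
    proof -
      have "x \<in> K" using that ne unfolding K_def by simp
      then show ?thesis using hK o2[OF that] that(2) ne unfolding F_def by simp
    qed
  qed
qed

text \<open>The new data values are the ranks in the rearranged order, plus 1 because a text starts
  at 1. It remains to check that all guesses are true of the new text.\<close>

lemma soundness:
  fixes w :: data_word and g :: "nat \<Rightarrow> val" and ps :: "nat list"
  defines "n \<equiv> length w"
  assumes n: "0 < n"
    and w: "\<And>x. x < n \<Longrightarrow> fst (w ! x) < k \<and> left (core (g x)) = enc_nat (fst (w ! x))"
    and letter: "\<And>x. x < n \<Longrightarrow> g x \<in> set (code_letters C T)"
    and ok: "\<And>x. x < n \<Longrightarrow> letter_ok C f (g x)"
    and fp: "first_pos C (g 0)" and pl: "\<And>x. Suc x < n \<Longrightarrow> pos_link C (g x) (g (Suc x))"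
    and lp: "last_pos (g (n - 1))"
    and ps: "length ps = n" "set ps = {..<n}"
    and fd: "first_data (g (ps ! 0))" and dl: "\<And>i. Suc i < n \<Longrightarrow> data_link (g (ps ! i)) (g (ps ! Suc i))"
    and ld: "last_data (g (ps ! (n - 1)))"
  shows "\<exists>w'. text_word k w' \<and> models w' (dec f) \<and> proj_word w = proj_word w'"
proof -
  show ?thesis
  proof (rule rearrange[of n g C T f ps])
    fix h r p l
    assume r: "bij_betw r {..<n} {..<n}" and pX: "p < n" and lX: "l < n"
      and hX: "\<And>x. x < n \<Longrightarrow> h x < n" and rh: "\<And>x. x < n \<Longrightarrow> x \<noteq> l \<Longrightarrow> r (h x) = Suc (r x)"
      and rp: "r p = 0" and rl: "r l = n - 1" and pdp: "prev_data (g p) = Leaf" and ndl: "next_data (g l) = Leaf"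
      and link: "\<And>x. x < n \<Longrightarrow> x \<noteq> l \<Longrightarrow> data_link (g x) (g (h x))"
      and h1: "\<And>x. x < n \<Longrightarrow> next_claim (g x) = enc_nat 1 \<Longrightarrow> h x = Suc x \<and> x \<noteq> l"
      and h2: "\<And>x. x < n \<Longrightarrow> next_claim (g x) = enc_nat 2 \<Longrightarrow> Suc (h x) = x \<and> x \<noteq> l"
    have rX: "r x < n" if "x < n" for x using r that by (auto simp: bij_betw_def)
    have rinj: "x = y" if "x < n" "y < n" "r x = r y" for x y
      using r that by (auto simp: bij_betw_def inj_on_def)
    define w' where "w' = map (\<lambda>i. (fst (w ! i), Suc (r i))) [0..<n]"
    have len: "length w' = n" by (simp add: w'_def)
    have nth: "w' ! i = (fst (w ! i), Suc (r i))" if "i < n" for i using that by (simp add: w'_def)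
    have proj: "proj_word w = proj_word w'"
      by (rule nth_equalityI) (auto simp: proj_word_def len n_def[symmetric] nth)
    have is_text': "text_word k w'"
      unfolding text_word_def ordered_data_word_def
    proof (intro conjI)
      show "w' \<noteq> []" using n len by auto
      show "fst ` set w' \<subseteq> {..<k}" using w by (auto simp: w'_def)
      show "distinct (map snd w')"
        using rinj by (auto simp: w'_def distinct_map inj_on_def comp_def)
      have "snd ` set w' = Suc ` r ` {..<n}" by (force simp: w'_def image_iff atLeast0LessThan)
      also have "r ` {..<n} = {..<n}" using r by (simp add: bij_betw_def)
      finally show "snd ` set w' = {1..length w'}" by (simp add: len image_Suc_lessThan)
    qed
    interpret faithful k w' C g by unfold_locales (rule is_text')
    have D: "D x y \<longleftrightarrow> x < n \<and> x \<noteq> l \<and> y = h x" for x y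
    proof
      assume "D x y"
      then have xy: "x < n" "y < n" "r y = Suc (r x)" by (auto simp: D_def len nth)
      then have "x \<noteq> l" using rX[of y] rl by auto
      then show "x < n \<and> x \<noteq> l \<and> y = h x" using xy rh[of x] rinj[of y "h x"] hX by auto
    next
      assume "x < n \<and> x \<noteq> l \<and> y = h x"
      then show "D x y" using rh[of x] hX[of x] by (auto simp: D_def len nth)
    qed
    have okD: "prev_claim (g x) = enc_nat 1 \<Longrightarrow> next_pos (g x) \<noteq> Leaf \<and> prev_data (g x) \<noteq> Leaf"
      "prev_claim (g x) = enc_nat 2 \<Longrightarrow> prev_pos (g x) \<noteq> Leaf \<and> prev_data (g x) \<noteq> Leaf" if "x < n" for x
      using ok[OF that] unfolding letter_ok_def by blast+
    have ne: "enc_nat 1 \<noteq> enc_nat 2" "enc_nat 1 \<noteq> enc_nat 0" "enc_nat 2 \<noteq> enc_nat 0"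
      by (simp_all del: enc_nat.simps)
    have claims: "next_claim (g x) = enc_nat 0 \<or> next_claim (g x) = enc_nat 1 \<or> next_claim (g x) = enc_nat 2"
      "prev_claim (g x) = enc_nat 0 \<or> prev_claim (g x) = enc_nat 1 \<or> prev_claim (g x) = enc_nat 2" if "x < n" for x
      using code_letterD(2,3)[OF letter[OF that]] by auto
    have nd: "x \<noteq> l \<Longrightarrow> next_data (g x) \<noteq> Leaf" if "x < n" for x
      using link[OF that] unfolding data_link_def by auto
    have pl': "pos_link C (g (x - 1)) (g x)" if "0 < x" "x < n" for x
      using pl[of "x - 1"] that by simp
    have nc1: "next_claim (g x) = enc_nat 1 \<longleftrightarrow> D x (Suc x)" if x: "x < n" for x
    proof
      assume "next_claim (g x) = enc_nat 1"
      then show "D x (Suc x)" using h1[OF x] x by (auto simp: D)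
    next
      \<comment> \<open>An accidental coincidence is impossible: without a claim, the colour that
        \<open>x\<close> expects of its data successor would be both equal to and different from the
        colour of \<open>Suc x\<close>.\<close>
      assume d: "D x (Suc x)"
      then have x': "x \<noteq> l" "h x = Suc x" "Suc x < n" using hX[OF x] by (auto simp: D)
      have "next_colour (g x) = colour (g (Suc x))"
        using link[OF x x'(1)] unfolding data_link_def x'(2) by blast
      then show "next_claim (g x) = enc_nat 1"
        using pl[OF x'(3)] nd[OF x x'(1)] unfolding pos_link_def by blast
    qed
    have nc2: "next_claim (g x) = enc_nat 2 \<longleftrightarrow> 0 < x \<and> D x (x - 1)" if x: "x < n" for x
    proof
      assume "next_claim (g x) = enc_nat 2"
      then have "Suc (h x) = x" "x \<noteq> l" using h2[OF x] by auto
      then show "0 < x \<and> D x (x - 1)" using x by (auto simp: D)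
    next
      assume d: "0 < x \<and> D x (x - 1)"
      then have x': "x \<noteq> l" "h x = x - 1" by (auto simp: D)
      have "next_colour (g x) = colour (g (x - 1))"
        using link[OF x x'(1)] unfolding data_link_def x'(2) by blast
      then show "next_claim (g x) = enc_nat 2"
        using pl'[OF conjunct1[OF d] x] nd[OF x x'(1)] unfolding pos_link_def by blast
    qed
    have npos: "next_pos (g x) = (if Suc x < n then Pair (core (g (Suc x))) Leaf else Leaf)" if x: "x < n" for x
    proof (cases "Suc x < n")
      case True
      then show ?thesis using pl[OF True] unfolding pos_link_def by simp
    next
      case False
      then have "x = n - 1" using x by simp
      then show ?thesis using lp False unfolding last_pos_def by simp
    qed
    have ppos: "prev_pos (g x) = (if 0 < x then Pair (core (g (x - 1))) Leaf else Leaf)" if x: "x < n" for x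
    proof (cases "0 < x")
      case True
      then show ?thesis using pl'[OF True x] unfolding pos_link_def by simp
    next
      case False
      then show ?thesis using fp unfolding first_pos_def by simp
    qed
    have pc1: "prev_claim (g x) = enc_nat 1 \<longleftrightarrow> D (Suc x) x" if x: "x < n" for x
    proof (cases "Suc x < n")
      case True
      have "prev_claim (g x) = enc_nat 1 \<longleftrightarrow> next_claim (g (Suc x)) = enc_nat 2"
        using pl[OF True] unfolding pos_link_def by blast
      then show ?thesis using nc2[OF True] by simp
    next
      case False
      then show ?thesis using okD(1)[OF x] npos[OF x] by (auto simp: D_def len)
    qed
    have pc2: "prev_claim (g x) = enc_nat 2 \<longleftrightarrow> 0 < x \<and> D (x - 1) x" if x: "x < n" for x
    proof (cases "0 < x")
      case True
      have "prev_claim (g x) = enc_nat 2 \<longleftrightarrow> next_claim (g (x - 1)) = enc_nat 1"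
        using pl'[OF True x] unfolding pos_link_def by blast
      then show ?thesis using nc1[of "x - 1"] True x by simp
    next
      case False
      then show ?thesis using okD(2)[OF x] ppos[OF x] by auto
    qed
    have total_eq: "total_counts (g x) = total_counts (g (n - 1))" if "x < n" for x
    proof -
      have *: "total_counts (g y) = total_counts (g 0)" if "y < n" for y
        using that
      proof (induction y)
        case (Suc y)
        then show ?case using pl[OF Suc.prems] unfolding pos_link_def by simp
      qed simp
      have "n - 1 < n" using n by simp
      then show ?thesis using *[OF that] * by metis
    qed
    have records: "records x" if x: "x < length w'" for x
      unfolding records_def
    proof (intro conjI allI impI ballI)
      have xn: "x < n" using x len by simp
      show "core (g x) \<in> set C" by (rule code_letterD(1)[OF letter[OF xn]])
      show "left (core (g x)) = enc_nat (fst (w' ! x))" using w[OF xn] nth[OF xn] by simp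
      show "next_pos (g x) = (if Suc x < length w' then Pair (core (g (Suc x))) Leaf else Leaf)"
        unfolding len by (rule npos[OF xn])
      show "prev_pos (g x) = (if 0 < x then Pair (core (g (x - 1))) Leaf else Leaf)"
        by (rule ppos[OF xn])
      show "next_data (g x) = Pair (core (g y)) Leaf" if "D x y" for y
        using that link[OF xn] unfolding D data_link_def by blast
      show "next_data (g x) = Leaf" if "\<forall>y. \<not> D x y"
        using that ndl xn by (auto simp: D simp del: nthv.simps)
      show "prev_data (g x) = Pair (core (g y)) Leaf" if "D y x" for y
        using that link[of y] unfolding D data_link_def by blast
      show "prev_data (g x) = Leaf" if nD: "\<forall>y. \<not> D y x"
      proof -
        have "x = p"
        proof (rule ccontr)
          assume "x \<noteq> p"
          then have "r x \<noteq> 0" using rinj[OF xn pX] rp by auto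
          then have "r x - 1 \<in> {..<n}" using rX[OF xn] by auto
          then have "r x - 1 \<in> r ` {..<n}" using r by (simp add: bij_betw_def)
          then obtain y where "y < n" "r y = r x - 1" by auto
          then have "D y x" using \<open>r x \<noteq> 0\<close> xn by (auto simp: D_def len nth)
          with nD show False by blast
        qed
        then show ?thesis using pdp by simp
      qed
      show "next_claim (g x) = (if D x (Suc x) then enc_nat 1 else if 0 < x \<and> D x (x - 1) then enc_nat 2 else enc_nat 0)"
        using claims(1)[OF xn] unfolding nc1[OF xn, symmetric] nc2[OF xn, symmetric] by (elim disjE) (simp_all only: ne ne[symmetric] if_True if_False simp_thms)
      show "prev_claim (g x) = (if D (Suc x) x then enc_nat 1 else if 0 < x \<and> D (x - 1) x then enc_nat 2 else enc_nat 0)"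
        using claims(2)[OF xn] unfolding pc1[OF xn, symmetric] pc2[OF xn, symmetric] by (elim disjE) (simp_all only: ne ne[symmetric] if_True if_False simp_thms)
      fix c j assume c: "c \<in> set C" and j: "j < (6::nat)"
      have "partial_counts_of (g (n - 1)) = total_counts (g x)" using lp total_eq[OF xn] unfolding last_pos_def by simp
      moreover have "{y. y \<le> n - 1 \<and> core (g y) = c} = {y. y < length w' \<and> core (g y) = c}"
        using n by (auto simp: len simp del: nthv.simps)
      ultimately show "Pair (enc_nat j) c \<in> set (vl (total_counts (g x))) \<longleftrightarrow> j < card {y. y < length w' \<and> core (g y) = c}"
        using partial_counts[OF fp pl _ c j, of n "n - 1"] n by simp
    qed
    have "models w' (dec f)"
      by (rule letters_ok_imp_models[OF records]) (use ok len in auto)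
    with is_text' proj show "\<exists>w'. text_word k w' \<and> models w' (dec f) \<and> proj_word w = proj_word w'" by blast
  qed (fact n letter ok fp pl lp ps fd dl ld)+
qed

section \<open>Labelling a text\<close>

text \<open>When a vertex is added, its at most \<open>d\<close> neighbours leave one of the colours
  \<open>0\<close> to \<open>d\<close> free.\<close>

lemma greedy_colouring:
  fixes E :: "'a \<Rightarrow> 'a \<Rightarrow> bool"
  assumes "finite X" and sym: "\<And>u v. E u v \<Longrightarrow> E v u" and irrefl: "\<And>u. \<not> E u u"
    and deg: "\<And>v. v \<in> X \<Longrightarrow> card {u \<in> X. E v u} \<le> d"
  shows "\<exists>col. \<forall>v\<in>X. col v \<le> d \<and> (\<forall>u\<in>X. E u v \<longrightarrow> col u \<noteq> (col v :: nat))"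
  using assms(1) deg
proof (induction X rule: finite_induct)
  case (insert v X)
  have "card {u \<in> X. E w u} \<le> d" if "w \<in> X" for w
  proof -
    have "card {u \<in> X. E w u} \<le> card {u \<in> insert v X. E w u}"
      using insert.hyps by (intro card_mono) auto
    with insert.prems[of w] that show ?thesis by simp
  qed
  then obtain col where col: "\<And>w u. w \<in> X \<Longrightarrow> u \<in> X \<Longrightarrow> E u w \<Longrightarrow> col u \<noteq> col w" "\<And>w. w \<in> X \<Longrightarrow> col w \<le> d"
    using insert.IH by blast
  let ?N = "{u \<in> X. E v u}"
  have "card (col ` ?N) \<le> card ?N" using insert.hyps by (intro card_image_le) auto
  also have "\<dots> \<le> d"
  proof -
    have "card ?N \<le> card {u \<in> insert v X. E v u}" using insert.hyps by (intro card_mono) auto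
    with insert.prems[of v] show ?thesis by simp
  qed
  finally have "card (col ` ?N) < card {..d}" by simp
  then have "\<not> {..d} \<subseteq> col ` ?N"
    using card_mono[of "col ` ?N" "{..d}"] insert.hyps by auto
  then obtain c where c: "c \<le> d" "c \<notin> col ` ?N" by auto
  show ?case
  proof (intro exI[of _ "col(v := c)"] ballI conjI impI)
    fix w assume "w \<in> insert v X"
    then show "(col(v := c)) w \<le> d" using col(2) c(1) by auto
    fix u assume "u \<in> insert v X" "E u w"
    then show "(col(v := c)) u \<noteq> (col(v := c)) w"
      using \<open>w \<in> insert v X\<close> col(1)[of w u] c(2) sym irrefl insert.hyps(2) by (auto split: if_splits)
  qed
qed simp

lemma filter_in_subseqs: "filter P xs \<in> set (subseqs xs)"
  by (induction xs) (auto simp: Let_def)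

text \<open>The true 1-types, neighbours, counts and coincidences are written into the letters. Only
  the colours and the block ends have to be constructed.\<close>

lemma completeness:
  fixes w :: data_word
  defines "n \<equiv> length w"
  assumes is_text: "text_word k w" and m: "models w (dec f)" "fv (dec f) = {}"
  shows "\<exists>g ps. (\<forall>x<n. g x \<in> set (letter_list k f) \<and> letter_ok (cores k f) f (g x) \<and>
       left (core (g x)) = enc_nat (fst (w ! x))) \<and>
     first_pos (cores k f) (g 0) \<and> (\<forall>x. Suc x < n \<longrightarrow> pos_link (cores k f) (g x) (g (Suc x))) \<and>
     last_pos (g (n - 1)) \<and> length ps = n \<and> set ps = {..<n} \<and> sorted_wrt (<) (map (\<lambda>i. snd (w ! i)) ps) \<and>
     first_data (g (ps ! 0)) \<and> (\<forall>i. Suc i < n \<longrightarrow> data_link (g (ps ! i)) (g (ps ! Suc i))) \<and>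
     last_data (g (ps ! (n - 1)))"
proof -
  define C where "C = cores k f"
  have n: "0 < n" using is_text by (auto simp: n_def text_word_def ordered_data_word_def)
  have data: "bij_betw (\<lambda>x. snd (w ! x)) {..<n} {1..n}"
  proof -
    have "(\<lambda>x. snd (w ! x)) ` {..<n} = snd ` set w"
      unfolding n_def by (force simp: in_set_conv_nth image_iff)
    moreover have "inj_on (\<lambda>x. snd (w ! x)) {..<n}"
      using is_text by (auto simp: text_word_def n_def inj_on_def distinct_conv_nth)
    ultimately show ?thesis using is_text by (simp add: bij_betw_def text_word_def n_def)
  qed
  define D where "D x y \<longleftrightarrow> x < n \<and> y < n \<and> snd (w ! y) = Suc (snd (w ! x))" for x y
  have data_inj: "x = y" if "x < n" "y < n" "snd (w ! x) = snd (w ! y)" for x y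
    using data that by (auto simp: bij_betw_def inj_on_def)
  have D_fun: "y = z" if "D x y" "D x z" for x y z using that data_inj by (auto simp: D_def)
  have D_inj: "x = y" if "D x z" "D y z" for x y z using that data_inj by (auto simp: D_def)
  have D_asym: "\<not> D y x" if "D x y" for x y using that by (auto simp: D_def)
  define sd where "sd x = (THE y. D x y)" for x
  define pd where "pd x = (THE y. D y x)" for x
  have sd: "sd x = y" if "D x y" for x y unfolding sd_def using that D_fun by blast
  have pd: "pd y = x" if "D x y" for x y unfolding pd_def using that D_inj by blast
  \<comment> \<open>Some word neighbour of \<open>y\<close> has \<open>z\<close> as its data
    successor, so it expects the colour of \<open>z\<close>, which must not be that of
    \<open>y\<close>.\<close>
  define conflict where "conflict z y \<longleftrightarrow> z \<noteq> y \<and> (\<exists>x. D x z \<and> (y = Suc x \<or> x = Suc y))" for z y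
  obtain col where col: "\<And>v. v < n \<Longrightarrow> col v \<le> (4::nat)"
    "\<And>u v. u < n \<Longrightarrow> v < n \<Longrightarrow> conflict u v \<Longrightarrow> col u \<noteq> col v"
  proof -
    have "card {u \<in> {..<n}. conflict v u \<or> conflict u v} \<le> 4" for v
    proof -
      \<comment> \<open>Either \<open>u\<close> is next to the data predecessor of \<open>v\<close>,
        or \<open>u\<close> is the data successor of a position next to \<open>v\<close>. Two
        choices each make four conflicts, hence five colours.\<close>
      have "{u \<in> {..<n}. conflict v u \<or> conflict u v} \<subseteq> {Suc (pd v), pd v - 1, sd (v - 1), sd (Suc v)}"
      proof
        fix u assume "u \<in> {u \<in> {..<n}. conflict v u \<or> conflict u v}"
        then obtain x where "D x v \<and> (u = Suc x \<or> x = Suc u) \<or> D x u \<and> (v = Suc x \<or> x = Suc v)"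
          unfolding conflict_def by blast
        then show "u \<in> {Suc (pd v), pd v - 1, sd (v - 1), sd (Suc v)}"
          using sd[of x u] pd[of x v] by (elim disjE conjE) simp_all
      qed
      then have "card {u \<in> {..<n}. conflict v u \<or> conflict u v} \<le> card {Suc (pd v), pd v - 1, sd (v - 1), sd (Suc v)}"
        by (intro card_mono) auto
      also have "\<dots> \<le> 4" by (simp add: card_insert_if)
      finally show ?thesis .
    qed
    then have "\<exists>col. \<forall>v\<in>{..<n}. col v \<le> 4 \<and> (\<forall>u\<in>{..<n}. conflict u v \<or> conflict v u \<longrightarrow> col u \<noteq> (col v :: nat))"
      by (intro greedy_colouring[where E = "\<lambda>u v. conflict u v \<or> conflict v u"])
        (blast | simp add: conflict_def)+
    then obtain col :: "nat \<Rightarrow> nat" where "\<forall>v\<in>{..<n}. col v \<le> 4 \<and> (\<forall>u\<in>{..<n}. conflict u v \<or> conflict v u \<longrightarrow> col u \<noteq> col v)" ..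
    then show thesis by (intro that[of col]) auto
  qed
  define cr where "cr x = Pair (enc_nat (fst (w ! x))) (lv (filter (\<lambda>a. sat w (\<lambda>_. x) (dec a)) (subtrees f)))" for x
  define counts_of where "counts_of M = lv (filter (\<lambda>p. \<exists>j c. p = Pair (enc_nat j) c \<and> j < card {y \<in> M. cr y = c})
    (concat (map (\<lambda>j. map (Pair j) C) thresholds)))" for M
  define nc where "nc x = (if D x (Suc x) then 1 else if 0 < x \<and> D x (x - 1) then 2 else 0 :: nat)" for x
  define pc where "pc x = (if D (Suc x) x then 1 else if 0 < x \<and> D (x - 1) x then 2 else 0 :: nat)" for x
  define b where "b x = lv [cr x, if Suc x < n then Pair (cr (Suc x)) Leaf else Leaf,
     if 0 < x then Pair (cr (x - 1)) Leaf else Leaf,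
     if \<exists>y. D x y then Pair (cr (sd x)) Leaf else Leaf, if \<exists>y. D y x then Pair (cr (pd x)) Leaf else Leaf,
     enc_nat (nc x), enc_nat (pc x), enc_nat (col x), if \<exists>y. D x y then enc_nat (col (sd x)) else enc_nat 0,
     counts_of {..<n}, counts_of {..x}]" for x
  \<comment> \<open>The first position from \<open>x\<close> on, in the data order, that makes no
    claim.\<close>
  define block_end where "block_end x =
    (THE u. u < n \<and> snd (w ! u) = (LEAST m. snd (w ! x) \<le> m \<and> (\<exists>u<n. snd (w ! u) = m \<and> nc u = 0)))" for x
  \<comment> \<open>Such a position exists, as the one with the greatest data value makes no claim;
    the default 0 makes the letter legal without proving this.\<close>
  define g where "g x = Pair (b x) (b (if block_end x < n then block_end x else 0))" for x
  have cr_C: "cr x \<in> set C" if "x < n" for x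
  proof -
    have "fst (w ! x) < k"
    proof -
      have "fst (w ! x) \<in> fst ` set w" using that by (simp add: n_def)
      then show ?thesis using is_text by (auto simp: text_word_def ordered_data_word_def)
    qed
    then show ?thesis by (auto simp: cr_def C_def cores_def intro!: imageI filter_in_subseqs simp del: subseqs.simps)
  qed
  have counts: "counts_of M \<in> set (counts C)" for M
    unfolding counts_of_def counts_def set_map by (intro imageI filter_in_subseqs)
  have counts_iff: "Pair (enc_nat j) c \<in> set (vl (counts_of M)) \<longleftrightarrow> j < card {y \<in> M. cr y = c}"
    if "c \<in> set C" "j < 6" for M c j
  proof -
    have "enc_nat j \<in> set thresholds" unfolding set_thresholds using that(2) by blast
    then have "Pair (enc_nat j) c \<in> set (concat (map (\<lambda>j. map (Pair j) C) thresholds))"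
      unfolding set_concat set_map
      by (intro UN_I[OF imageI[OF \<open>enc_nat j \<in> set thresholds\<close>]]) (use that(1) in simp)
    then show ?thesis
      unfolding counts_of_def vl_lv set_filter mem_Collect_eq val.inject enc_nat_inject by blast
  qed
  have sd_n: "sd x < n" if "D x y" for x y using sd[OF that] that by (simp add: D_def)
  have pd_n: "pd y < n" if "D x y" for x y using pd[OF that] that by (simp add: D_def)
  have b_basics: "b x \<in> set (basics C (counts C))" if x: "x < n" for x
  proof -
    have num5: "enc_nat c \<in> set (map enc_nat [0, 1, 2, 3, 4])" if "c \<le> 4" for c
    proof -
      have "c = 0 \<or> c = 1 \<or> c = 2 \<or> c = 3 \<or> c = 4" using that by linarith
      then show ?thesis by auto
    qed
    have num3: "enc_nat c \<in> set (map enc_nat [0, 1, 2])" if "c \<le> 2" for c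
    proof -
      have "c = 0 \<or> c = 1 \<or> c = 2" using that by linarith
      then show ?thesis by auto
    qed
    have opt: "(if P then Pair (cr y) Leaf else Leaf) \<in> set (Leaf # map (\<lambda>c. Pair c Leaf) C)" if "P \<Longrightarrow> y < n" for P y
      using that cr_C by auto
    have oc: "(if \<exists>y. D x y then enc_nat (col (sd x)) else enc_nat 0) \<in> set (map enc_nat [0, 1, 2, 3, 4])"
    proof (cases "\<exists>y. D x y")
      case True
      then have "col (sd x) \<le> 4" using col(1) sd_n by blast
      from num5[OF this] True show ?thesis by (simp only: if_True)
    next
      case False
      then show ?thesis using num5[of 0] by (simp only: if_False)
    qed
    have le: "nc x \<le> 2" "pc x \<le> 2" by (auto simp: nc_def pc_def)
    show ?thesis
      unfolding b_def basics_def Let_def set_tuples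
    proof (intro imageI, unfold mem_Collect_eq list_all2_Cons, intro conjI)
      show "cr x \<in> set C" by (rule cr_C[OF x])
      show "(if Suc x < n then Pair (cr (Suc x)) Leaf else Leaf) \<in> set (Leaf # map (\<lambda>c. Pair c Leaf) C)"
        "(if 0 < x then Pair (cr (x - 1)) Leaf else Leaf) \<in> set (Leaf # map (\<lambda>c. Pair c Leaf) C)"
        by (rule opt, use x in simp)+
      show "(if \<exists>y. D x y then Pair (cr (sd x)) Leaf else Leaf) \<in> set (Leaf # map (\<lambda>c. Pair c Leaf) C)"
        by (rule opt) (use sd_n in blast)
      show "(if \<exists>y. D y x then Pair (cr (pd x)) Leaf else Leaf) \<in> set (Leaf # map (\<lambda>c. Pair c Leaf) C)"
        by (rule opt) (use pd_n in blast)
    qed (fact num3[OF le(1)] num3[OF le(2)] num5[OF col(1)[OF x]] oc counts list.rel_intros(1))+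
  qed
  have acc: "core (g x) = cr x" "next_pos (g x) = (if Suc x < n then Pair (cr (Suc x)) Leaf else Leaf)"
     "prev_pos (g x) = (if 0 < x then Pair (cr (x - 1)) Leaf else Leaf)"
     "next_data (g x) = (if \<exists>y. D x y then Pair (cr (sd x)) Leaf else Leaf)"
     "prev_data (g x) = (if \<exists>y. D y x then Pair (cr (pd x)) Leaf else Leaf)"
     "next_claim (g x) = enc_nat (nc x)" "prev_claim (g x) = enc_nat (pc x)" "colour (g x) = enc_nat (col x)"
     "next_colour (g x) = (if \<exists>y. D x y then enc_nat (col (sd x)) else enc_nat 0)"
     "total_counts (g x) = counts_of {..<n}" "partial_counts_of (g x) = counts_of {..x}" for x
    unfolding g_def left.simps b_def by (simp_all only: nthv_lv length_Cons list.size) (simp_all del: enc_nat.simps)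
  have next_link: "next_data (g x) = Pair (core (g y)) Leaf" "prev_data (g y) = Pair (core (g x)) Leaf"
    "next_colour (g x) = colour (g y)" if "D x y" for x y
    using that sd[OF that] pd[OF that] unfolding acc by auto
  have claims_link: "nc x = 0 \<longleftrightarrow> pc y = 0" if "D x y" for x y
  proof -
    have "D x z \<longleftrightarrow> z = y" for z using that D_fun[OF that] by blast
    moreover have "D z y \<longleftrightarrow> z = x" for z using that D_inj[OF that] by blast
    ultimately show ?thesis by (auto simp: nc_def pc_def)
  qed
  have end_link: "block_end x = block_end y" if d: "D x y" and "nc x \<noteq> 0" for x y
  proof -
    \<comment> \<open>Passing from \<open>x\<close> to its data successor drops the single value of
      \<open>x\<close>, which does not qualify because \<open>x\<close> makes a claim; so the least
      qualifying value stays the same.\<close>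
    have "snd (w ! x) \<le> m \<and> (\<exists>u<n. snd (w ! u) = m \<and> nc u = 0) \<longleftrightarrow>
        snd (w ! y) \<le> m \<and> (\<exists>u<n. snd (w ! u) = m \<and> nc u = 0)" for m
    proof (cases "m = snd (w ! x)")
      case True
      have "nc u \<noteq> 0" if "u < n" "snd (w ! u) = m" for u
        using data_inj[of u x] that True d \<open>nc x \<noteq> 0\<close> by (auto simp: D_def)
      then show ?thesis by blast
    next
      case False
      then show ?thesis using d by (auto simp: D_def)
    qed
    then show ?thesis by (simp add: block_end_def)
  qed
  have end_self: "block_end x = x" if "x < n" "nc x = 0" for x
  proof -
    have "(LEAST m. snd (w ! x) \<le> m \<and> (\<exists>u<n. snd (w ! u) = m \<and> nc u = 0)) = snd (w ! x)"
      using that by (intro Least_equality) auto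
    then show ?thesis unfolding block_end_def using that data_inj by auto
  qed
  have link: "data_link (g x) (g y)" if "D x y" for x y
  proof -
    have "next_claim (g x) \<noteq> enc_nat 0 \<longrightarrow> right (g x) = right (g y)"
      unfolding acc enc_nat_inject using end_link[OF that] by (simp add: g_def)
    moreover have "(next_claim (g x) = enc_nat 0) = (prev_claim (g y) = enc_nat 0)"
      unfolding acc enc_nat_inject by (rule claims_link[OF that])
    ultimately show ?thesis
      unfolding data_link_def using next_link[OF that] by blast
  qed
  have has_next: "next_data (g x) \<noteq> Leaf \<longleftrightarrow> (\<exists>y. D x y)" for x unfolding acc by simp
  have letter: "g x \<in> set (letter_list k f)" if "x < n" for x
    using b_basics[OF that] b_basics[OF n] b_basics
    unfolding letter_list_def code_letters_def g_def C_def[symmetric] by auto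
  interpret F: faithful k w C g by unfold_locales (rule is_text)
  have FD: "F.D = D" by (intro ext) (simp add: F.D_def D_def n_def)
  have records: "F.records x" if "x < length w" for x
    unfolding F.records_def FD
  proof (intro conjI allI impI ballI)
    have xn: "x < n" using that by (simp add: n_def)
    show "core (g x) \<in> set C" unfolding acc by (rule cr_C[OF xn])
    show "left (core (g x)) = enc_nat (fst (w ! x))" unfolding acc by (simp add: cr_def)
    show "next_pos (g x) = (if Suc x < length w then Pair (core (g (Suc x))) Leaf else Leaf)"
      unfolding acc n_def ..
    show "prev_pos (g x) = (if 0 < x then Pair (core (g (x - 1))) Leaf else Leaf)"
      unfolding acc ..
    show "next_data (g x) = Pair (core (g y)) Leaf" if "D x y" for y by (rule next_link(1)[OF that])
    show "prev_data (g x) = Pair (core (g y)) Leaf" if "D y x" for y by (rule next_link(2)[OF that])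
    show "next_data (g x) = Leaf" if "\<forall>y. \<not> D x y" using that unfolding acc by simp
    show "prev_data (g x) = Leaf" if "\<forall>y. \<not> D y x" using that unfolding acc by simp
    show "next_claim (g x) = (if D x (Suc x) then enc_nat 1 else if 0 < x \<and> D x (x - 1) then enc_nat 2 else enc_nat 0)"
      unfolding acc nc_def by (simp del: enc_nat.simps)
    show "prev_claim (g x) = (if D (Suc x) x then enc_nat 1 else if 0 < x \<and> D (x - 1) x then enc_nat 2 else enc_nat 0)"
      unfolding acc pc_def by (simp del: enc_nat.simps)
    fix c j assume "c \<in> set C" "j < (6::nat)"
    then show "Pair (enc_nat j) c \<in> set (vl (total_counts (g x))) \<longleftrightarrow> j < card {y. y < length w \<and> core (g y) = c}"
      unfolding acc by (simp add: counts_iff n_def)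
  qed
  have "F.correct f"
    unfolding F.correct_def acc by (simp add: cr_def)
  have ok: "letter_ok C f (g x)" if x: "x < n" for x
    unfolding letter_ok_def
  proof (intro conjI)
    have xl: "x < length w" using x by (simp add: n_def)
    note truth = F.correct_imp_letter_truth[OF xl records \<open>F.correct f\<close> m]
    show "\<forall>a\<in>set (subtrees f).
        (left a = enc_nat 7 \<longrightarrow> (a \<in> set (vl (right (core (g x))))) =
           witness C (g x) (left (right a)) (right (right a))) \<and>
        (left a = enc_nat 8 \<longrightarrow> (a \<in> set (vl (right (core (g x))))) =
           (\<not> witness C (g x) (left (right a)) (Pair (enc_nat 4) (right (right a)))))"
      by (rule truth(1))
    show "bev (pair_truth Leaf (core (g x)) (core (g x)) (enc_nat 3) (enc_nat 0)) f" by (rule truth(2))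
    show "next_claim (g x) = enc_nat 0 \<or> next_claim (g x) \<noteq> prev_claim (g x)"
      unfolding acc enc_nat_inject nc_def pc_def using D_asym[of x "Suc x"] D_asym[of x "x - 1"] by auto
    show "next_claim (g x) = enc_nat 1 \<longrightarrow> next_pos (g x) \<noteq> Leaf \<and> next_data (g x) \<noteq> Leaf"
      unfolding has_next acc enc_nat_inject nc_def by (auto simp: D_def)
    show "next_claim (g x) = enc_nat 2 \<longrightarrow> prev_pos (g x) \<noteq> Leaf \<and> next_data (g x) \<noteq> Leaf"
      unfolding has_next unfolding acc enc_nat_inject nc_def by auto
    show "prev_claim (g x) = enc_nat 1 \<longrightarrow> next_pos (g x) \<noteq> Leaf \<and> prev_data (g x) \<noteq> Leaf"
      unfolding acc enc_nat_inject pc_def by (auto simp: D_def)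
    show "prev_claim (g x) = enc_nat 2 \<longrightarrow> prev_pos (g x) \<noteq> Leaf \<and> prev_data (g x) \<noteq> Leaf"
      unfolding acc enc_nat_inject pc_def by auto
    show "next_claim (g x) = enc_nat 0 \<longrightarrow> right (g x) = left (g x)"
      unfolding acc enc_nat_inject using end_self[OF x] x by (simp add: g_def)
  qed
  have first: "first_pos C (g 0)"
    unfolding first_pos_def set_thresholds
  proof (intro conjI ballI)
    show "prev_pos (g 0) = Leaf" unfolding acc by simp
    fix c j' assume c: "c \<in> set C" and "j' \<in> enc_nat ` {..<6}"
    then obtain j where j: "j' = enc_nat j" "j < 6" by auto
    have "{y \<in> {..0}. cr y = c} = (if cr 0 = c then {0} else {})" by auto
    then show "(Pair j' c \<in> set (vl (partial_counts_of (g 0)))) = (j' = Leaf \<and> c = core (g 0))"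
      unfolding acc j(1) counts_iff[OF c j(2)] by auto
  qed
  have colour_ok: "next_claim (g x) \<noteq> enc_nat i \<and> next_data (g x) \<noteq> Leaf \<longrightarrow> next_colour (g x) \<noteq> colour (g y)"
    if y: "y < n" "y = Suc x \<and> i = 1 \<or> x = Suc y \<and> i = 2" for x y i
  proof
    assume *: "next_claim (g x) \<noteq> enc_nat i \<and> next_data (g x) \<noteq> Leaf"
    then obtain z where z: "D x z" using has_next by blast
    \<comment> \<open>If the data successor were the neighbour \<open>y\<close> itself, the claim
      would be \<open>i\<close>. So the two differ, which is the remaining condition for a
      conflict.\<close>
    have "z \<noteq> y"
      using * y(2) z D_fun[OF z, of "Suc x"] unfolding acc enc_nat_inject nc_def by (auto split: if_splits)
    then have "conflict z y" using z y(2) by (auto simp: conflict_def)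
    then have "col z \<noteq> col y" using col(2)[of z y] z y(1) by (auto simp: D_def)
    then show "next_colour (g x) \<noteq> colour (g y)"
      unfolding next_link(3)[OF z] unfolding acc enc_nat_inject .
  qed
  have pos: "pos_link C (g x) (g (Suc x))" if x: "Suc x < n" for x
    unfolding pos_link_def
  proof (intro conjI)
    have i1: "nc x = 1 \<longleftrightarrow> D x (Suc x)" by (simp add: nc_def)
    have i2: "pc (Suc x) = 2 \<longleftrightarrow> D x (Suc x)" using D_inj[of "Suc (Suc x)" "Suc x" x] by (auto simp: pc_def)
    have i3: "pc x = 1 \<longleftrightarrow> D (Suc x) x" by (simp add: pc_def)
    have i4: "nc (Suc x) = 2 \<longleftrightarrow> D (Suc x) x" using D_fun[of "Suc x" "Suc (Suc x)" x] by (auto simp: nc_def)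
    show "next_pos (g x) = Pair (core (g (Suc x))) Leaf" unfolding acc using x by simp
    show "prev_pos (g (Suc x)) = Pair (core (g x)) Leaf" unfolding acc by simp
    show "(next_claim (g x) = enc_nat 1) = (prev_claim (g (Suc x)) = enc_nat 2)"
      unfolding acc enc_nat_inject i1 i2 ..
    show "(next_claim (g (Suc x)) = enc_nat 2) = (prev_claim (g x) = enc_nat 1)"
      unfolding acc enc_nat_inject i3 i4 ..
    show "next_claim (g x) = enc_nat 1 \<longrightarrow> data_link (g x) (g (Suc x))"
      using link unfolding acc enc_nat_inject i1 by blast
    show "next_claim (g (Suc x)) = enc_nat 2 \<longrightarrow> data_link (g (Suc x)) (g x)"
      using link unfolding acc enc_nat_inject i4 by blast
    show "next_claim (g x) \<noteq> enc_nat 1 \<and> next_data (g x) \<noteq> Leaf \<longrightarrow> next_colour (g x) \<noteq> colour (g (Suc x))"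
      by (rule colour_ok) (use x in auto)
    show "next_claim (g (Suc x)) \<noteq> enc_nat 2 \<and> next_data (g (Suc x)) \<noteq> Leaf \<longrightarrow> next_colour (g (Suc x)) \<noteq> colour (g x)"
      by (rule colour_ok) (use x in auto)
    show "total_counts (g x) = total_counts (g (Suc x))" unfolding acc ..
    show "\<forall>c\<in>set C. \<forall>j\<in>set thresholds. (Pair j c \<in> set (vl (partial_counts_of (g (Suc x))))) =
        (Pair j c \<in> set (vl (partial_counts_of (g x))) \<or> c = core (g (Suc x)) \<and> (j = Leaf \<or> Pair (right j) c \<in> set (vl (partial_counts_of (g x)))))"
      unfolding set_thresholds
    proof (intro ballI)
      fix c j' assume c: "c \<in> set C" and "j' \<in> enc_nat ` {..<6}"
      then obtain j where j: "j' = enc_nat j" "j < 6" by auto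
      have "{y \<in> {..Suc x}. cr y = c} = (if cr (Suc x) = c then insert (Suc x) {y \<in> {..x}. cr y = c} else {y \<in> {..x}. cr y = c})"
        by (auto simp: le_Suc_eq)
      then have card: "card {y \<in> {..Suc x}. cr y = c} =
          (if cr (Suc x) = c then Suc (card {y \<in> {..x}. cr y = c}) else card {y \<in> {..x}. cr y = c})"
        by simp
      show "(Pair j' c \<in> set (vl (partial_counts_of (g (Suc x))))) =
        (Pair j' c \<in> set (vl (partial_counts_of (g x))) \<or> c = core (g (Suc x)) \<and> (j' = Leaf \<or> Pair (right j') c \<in> set (vl (partial_counts_of (g x)))))"
      proof (cases j)
        case 0
        then show ?thesis unfolding acc j(1) counts_iff[OF c j(2)] card by auto
      next
        case (Suc i)
        have "right (enc_nat j) = enc_nat i" "i < 6" using Suc j(2) by auto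
        then show ?thesis unfolding acc j(1) counts_iff[OF c j(2)] card
          using Suc counts_iff[OF c \<open>i < 6\<close>] by auto
      qed
    qed
  qed
  have last: "last_pos (g (n - 1))"
  proof -
    have "{..n - 1} = {..<n}" using n by auto
    then show ?thesis unfolding last_pos_def acc using n by simp
  qed
  define ps where "ps = map (inv_into {..<n} (\<lambda>x. snd (w ! x))) [1..<Suc n]"
  have ps_nth: "ps ! i < n \<and> snd (w ! (ps ! i)) = Suc i" if "i < n" for i
  proof -
    have "Suc i \<in> (\<lambda>x. snd (w ! x)) ` {..<n}" using data that by (simp add: bij_betw_def)
    moreover have "ps ! i = inv_into {..<n} (\<lambda>x. snd (w ! x)) (Suc i)"
      using that by (simp add: ps_def del: upt_Suc)
    ultimately show ?thesis using inv_into_into f_inv_into_f by (metis lessThan_iff)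
  qed
  have len: "length ps = n" by (simp add: ps_def)
  have "set ps = inv_into {..<n} (\<lambda>x. snd (w ! x)) ` {1..n}"
    by (simp only: ps_def set_map set_upt atLeastLessThanSuc_atLeastAtMost)
  also have "\<dots> = {..<n}" using bij_betw_inv_into[OF data] by (simp add: bij_betw_def)
  finally have set_ps: "set ps = {..<n}" .
  have sorted: "sorted_wrt (<) (map (\<lambda>i. snd (w ! i)) ps)"
    by (simp add: sorted_wrt_iff_nth_less len ps_nth)
  have "data_link (g (ps ! i)) (g (ps ! Suc i))" if "Suc i < n" for i
    using ps_nth[of i] ps_nth[of "Suc i"] that by (intro link) (simp add: D_def)
  moreover have "first_data (g (ps ! 0))"
  proof -
    have "\<not> D y (ps ! 0)" for y
    proof
      assume d: "D y (ps ! 0)"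
      then have "snd (w ! y) = 0" using ps_nth[OF n] by (simp add: D_def)
      moreover have "y \<in> {..<n}" using d by (simp add: D_def)
      then have "snd (w ! y) \<in> {1..n}" by (rule bij_betw_apply[OF data])
      ultimately show False by simp
    qed
    then show ?thesis unfolding first_data_def acc by simp
  qed
  moreover have "last_data (g (ps ! (n - 1)))"
  proof -
    have "\<not> D (ps ! (n - 1)) y" for y
    proof
      assume d: "D (ps ! (n - 1)) y"
      then have "snd (w ! y) = Suc n" using ps_nth[of "n - 1"] n by (simp add: D_def)
      moreover have "y \<in> {..<n}" using d by (simp add: D_def)
      then have "snd (w ! y) \<in> {1..n}" by (rule bij_betw_apply[OF data])
      ultimately show False by simp
    qed
    then show ?thesis unfolding last_data_def acc by simp
  qed
  moreover have "left (core (g x)) = enc_nat (fst (w ! x))" for x unfolding acc by (simp add: cr_def)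
  ultimately show ?thesis
    using letter ok first pos last len set_ps sorted unfolding C_def
    by (intro exI[of _ g] exI[of _ ps]) blast
qed

theorem theorem6p6:
  shows "\<exists>(P :: program) (c :: nat). \<forall>(k :: nat) (\<phi> :: fo2). fo2_sentence k \<phi> \<longrightarrow>
    (\<exists>(S :: weak_odta) (t :: nat).
       wf_weak_odta k S \<and>
       runs P (enc_input k \<phi>) (enc_weak_odta S) t \<and>
       t \<le> 2 ^ (2 ^ (c * (k + fo2_size \<phi>) ^ c)) \<and>
       (\<forall>w. text_word k w \<and> models w \<phi> \<longrightarrow> odta_accepts S (word_tree w)) \<and>
       (\<forall>w. ordered_data_word k w \<and> odta_accepts S (word_tree w) \<longrightarrow>
          (\<exists>w'. text_word k w' \<and> models w' \<phi> \<and> proj_word w = proj_word w')))"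
proof -
  obtain P c where P: "\<And>k \<phi>. fo2_sentence k \<phi> \<Longrightarrow>
    \<exists>t. runs P (enc_input k \<phi>) (enc_weak_odta (fo2_odta k (enc_fo2 \<phi>))) t \<and>
      t \<le> 2 ^ (2 ^ (c * (k + fo2_size \<phi>) ^ c))"
    using fo2_odta_time by blast
  have sem: "wf_weak_odta k (fo2_odta k (enc_fo2 \<phi>)) \<and>
     (\<forall>w. text_word k w \<and> models w \<phi> \<longrightarrow> odta_accepts (fo2_odta k (enc_fo2 \<phi>)) (word_tree w)) \<and>
     (\<forall>w. ordered_data_word k w \<and> odta_accepts (fo2_odta k (enc_fo2 \<phi>)) (word_tree w) \<longrightarrow>
          (\<exists>w'. text_word k w' \<and> models w' \<phi> \<and> proj_word w = proj_word w'))"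
    if \<phi>: "fo2_sentence k \<phi>" for k \<phi>
  proof -
    define f where "f = enc_fo2 \<phi>"
    define C where "C = cores k f"
    define N where "N = length (letter_list k f)"
    define L where "L q = rev (letter_list k f) ! q" for q
    define run where "run = local_run k N (\<lambda>q. first_pos C (L q)) (\<lambda>q. last_pos (L q))
      (\<lambda>q. first_data (L q)) (\<lambda>q. last_data (L q)) (\<lambda>q q'. pos_link C (L q) (L q'))
      (\<lambda>q q'. data_link (L q) (L q'))
      (\<lambda>q a. letter_ok C f (L q) \<and> left (core (L q)) = enc_nat a)"
    have odta: "fo2_odta k f = local_odta k N (\<lambda>q. first_pos C (L q)) (\<lambda>q q'. pos_link C (L q) (L q'))
      (\<lambda>q. last_pos (L q)) (\<lambda>q a. letter_ok C f (L q) \<and> left (core (L q)) = enc_nat a)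
      (\<lambda>q. first_data (L q)) (\<lambda>q q'. data_link (L q) (L q')) (\<lambda>q. last_data (L q))"
      by (simp only: fo2_odta_def Let_def C_def N_def L_def)
    have L_mem: "L q \<in> set (letter_list k f)" if "q < N" for q
      using that nth_mem[of q "rev (letter_list k f)"] by (simp add: L_def N_def)
    have dec: "dec f = \<phi>" by (simp add: f_def dec_enc_fo2)
    have complete: "odta_accepts (fo2_odta k f) (word_tree w)" if w: "text_word k w" "models w \<phi>" for w
    proof -
      have "fv (dec f) = {}" using \<phi> by (simp add: dec fo2_sentence_def)
      from completeness[OF w(1) w(2)[folded dec] this] obtain g ps where
        g: "\<forall>x<length w. g x \<in> set (letter_list k f) \<and> letter_ok C f (g x) \<and> left (core (g x)) = enc_nat (fst (w ! x))"
        "first_pos C (g 0)" "\<forall>x. Suc x < length w \<longrightarrow> pos_link C (g x) (g (Suc x))" "last_pos (g (length w - 1))"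
        and ps: "length ps = length w" "set ps = {..<length w}" "sorted_wrt (<) (map (\<lambda>i. snd (w ! i)) ps)"
        "first_data (g (ps ! 0))" "\<forall>i. Suc i < length w \<longrightarrow> data_link (g (ps ! i)) (g (ps ! Suc i))"
        "last_data (g (ps ! (length w - 1)))"
        unfolding C_def by (elim exE conjE)
      have ne: "w \<noteq> []" "0 < length w" using w(1) by (auto simp: text_word_def ordered_data_word_def)
      have "\<exists>q<N. L q = g x" if "x < length w" for x
      proof -
        have "g x \<in> set (rev (letter_list k f))" using g(1) that by simp
        then obtain q where "q < length (rev (letter_list k f))" "rev (letter_list k f) ! q = g x"
          unfolding in_set_conv_nth by blast
        then show ?thesis by (intro exI[of _ q]) (simp add: L_def N_def)
      qed
      then obtain q where q: "\<And>x. x < length w \<Longrightarrow> q x < N \<and> L (q x) = g x" by metis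
      define qs where "qs = map q [0..<length w]"
      have qs: "qs ! x < N" "L (qs ! x) = g x" if "x < length w" for x using q[OF that] that by (auto simp: qs_def)
      have ps_lt: "ps ! i < length w" if "i < length w" for i
        using nth_mem[of i ps] that unfolding ps(1,2) by simp
      have "fst (w ! x) < k" if "x < length w" for x
        using w(1) nth_mem[OF that] by (auto simp: text_word_def ordered_data_word_def)
      then have "run w qs ps"
        unfolding run_def local_run_def
        using g ps qs ps_lt ne(2) by (simp add: qs_def del: nthv.simps enc_nat.simps)
      then show ?thesis
        unfolding odta run_def by (rule local_run_imp_accepts[OF ne(1)])
    qed
    moreover have "\<exists>w'. text_word k w' \<and> models w' \<phi> \<and> proj_word w = proj_word w'"
      if w: "ordered_data_word k w" "odta_accepts (fo2_odta k f) (word_tree w)" for w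
    proof -
      have ne: "w \<noteq> []" using w(1) by (simp add: ordered_data_word_def)
      obtain qs ps where "run w qs ps"
        using accepts_imp_local_run[OF ne w(2)[unfolded odta]] unfolding run_def by blast
      note run = this[unfolded run_def local_run_def]
      show ?thesis
        unfolding dec[symmetric]
      proof (rule soundness[where g = "\<lambda>i. L (qs ! i)" and ps = ps and C = C and T = "counts C"])
        show "L (qs ! x) \<in> set (code_letters C (counts C))" if "x < length w" for x
          using L_mem[of "qs ! x"] run that by (simp add: letter_list_def C_def)
      qed (use run ne in blast)+
    qed
    moreover have "wf_weak_odta k (fo2_odta k f)"
      unfolding odta by (rule wf_local_odta)
    ultimately show ?thesis
      unfolding f_def[symmetric] by blast
  qed
  show ?thesis
  proof (intro exI[of _ P] exI[of _ c] allI impI)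
    fix k \<phi> assume \<phi>: "fo2_sentence k \<phi>"
    let ?S = "fo2_odta k (enc_fo2 \<phi>)"
    obtain t where t: "runs P (enc_input k \<phi>) (enc_weak_odta ?S) t"
        "t \<le> 2 ^ (2 ^ (c * (k + fo2_size \<phi>) ^ c))"
      using P[OF \<phi>] by (elim exE conjE)
    show "\<exists>S t. wf_weak_odta k S \<and> runs P (enc_input k \<phi>) (enc_weak_odta S) t \<and>
       t \<le> 2 ^ (2 ^ (c * (k + fo2_size \<phi>) ^ c)) \<and>
       (\<forall>w. text_word k w \<and> models w \<phi> \<longrightarrow> odta_accepts S (word_tree w)) \<and>
       (\<forall>w. ordered_data_word k w \<and> odta_accepts S (word_tree w) \<longrightarrow>
          (\<exists>w'. text_word k w' \<and> models w' \<phi> \<and> proj_word w = proj_word w'))"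
      by (rule exI[of _ ?S], rule exI[of _ t], rule conjI[OF conjunct1[OF sem[OF \<phi>]]],
        rule conjI[OF t(1)], rule conjI[OF t(2)], rule conjunct2[OF sem[OF \<phi>]])
  qed
qed

end
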